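(* Let $A$ be a unital algebra over a commutative ring $\mathbb{K}$, let $\Delta\in A$ be a well-tempered element, and let $B=\widehat{A}_\Delta$ be the corresponding homotope. Then $$\mathrm{Hdim}\,B\le \max(\mathrm{Hdim}\,A,\,2).$$
   Context: Algebras over $\mathbb{K}$ are associative and assumed to be free as $\mathbb{K}$-modules; tensor products are over $\mathbb{K}$. Homotope: for a unital $\mathbb{K}$-algebra $A$ and $\Delta\in A$, $B^+=A_\Delta$ is the algebra with underlying module $A$ and multiplication $a\cdot_\Delta b=a\Delta b$; $B=\widehat{A}_\Delta=\mathbb{K}\cdot 1\oplus B^+$ is obtained by adjoining a unit, so $B^+$ is a two-sided ideal of $B$. Well-tempered: $\Delta\in A$ is well-tempered if the multiplication map $B^+\otimes B^+\to B^+$ is surjective (equivalently $A\Delta A=A$, the two-sided ideal generated by $\Delta$ being all of $A$) and $B^+$ is projective both as a left and as a right $B$-module. Hochschild dimension: for a $\mathbb{K}$-algebra $R$, $\mathrm{Hdim}\,R=\mathrm{Hdim}_{\mathbb{K}}R$ is the projective dimension (possibly infinite) of $R$ as an $R\otimes_{\mathbb{K}}R^{opp}$-module. *)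

theory Defs
  imports "HOL-Library.Poly_Mapping" "HOL-Library.Extended_Nat"
    "HOL-Algebra.Module" "HOL-Algebra.QuotRing" "HOL-Algebra.Generated_Groups"
begin

section \<open>Modules over not necessarily commutative rings\<close>

text \<open>The locale \<^locale>\<open>module\<close> of the library requires a commutative ring of scalars.\<close>

locale lmodule = R?: ring R + M?: abelian_group M
  for R :: "('r, 'p) ring_scheme" (structure) and M :: "('r, 'm, 'q) module_scheme" (structure) +
  assumes smult_closed [simp, intro]:
      "\<lbrakk>a \<in> carrier R; x \<in> carrier M\<rbrakk> \<Longrightarrow> a \<odot>\<^bsub>M\<^esub> x \<in> carrier M"
    and smult_l_distr:
      "\<lbrakk>a \<in> carrier R; b \<in> carrier R; x \<in> carrier M\<rbrakk> \<Longrightarrow>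
        (a \<oplus> b) \<odot>\<^bsub>M\<^esub> x = a \<odot>\<^bsub>M\<^esub> x \<oplus>\<^bsub>M\<^esub> b \<odot>\<^bsub>M\<^esub> x"
    and smult_r_distr:
      "\<lbrakk>a \<in> carrier R; x \<in> carrier M; y \<in> carrier M\<rbrakk> \<Longrightarrow>
        a \<odot>\<^bsub>M\<^esub> (x \<oplus>\<^bsub>M\<^esub> y) = a \<odot>\<^bsub>M\<^esub> x \<oplus>\<^bsub>M\<^esub> a \<odot>\<^bsub>M\<^esub> y"
    and smult_assoc1:
      "\<lbrakk>a \<in> carrier R; b \<in> carrier R; x \<in> carrier M\<rbrakk> \<Longrightarrow>
        (a \<otimes> b) \<odot>\<^bsub>M\<^esub> x = a \<odot>\<^bsub>M\<^esub> (b \<odot>\<^bsub>M\<^esub> x)"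
    and smult_one [simp]:
      "x \<in> carrier M \<Longrightarrow> \<one> \<odot>\<^bsub>M\<^esub> x = x"

definition lmodule_hom ::
    "('r, 'p) ring_scheme \<Rightarrow> ('r, 'm, 'q) module_scheme \<Rightarrow> ('r, 'n, 's) module_scheme \<Rightarrow> ('m \<Rightarrow> 'n) set"
  where "lmodule_hom R M N =
    {h \<in> carrier M \<rightarrow> carrier N.
      (\<forall>x\<in>carrier M. \<forall>y\<in>carrier M. h (x \<oplus>\<^bsub>M\<^esub> y) = h x \<oplus>\<^bsub>N\<^esub> h y) \<and>
      (\<forall>a\<in>carrier R. \<forall>x\<in>carrier M. h (a \<odot>\<^bsub>M\<^esub> x) = a \<odot>\<^bsub>N\<^esub> h x)}"

text \<open>The free module on a set \<open>X\<close>: finitely supported functions from \<open>X\<close> to the ring.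
  The multiplicative fields of the record carry no meaning for a module.\<close>

definition free_lmodule :: "('r, 'p) ring_scheme \<Rightarrow> 'x set \<Rightarrow> ('r, 'x \<Rightarrow> 'r) module"
  where "free_lmodule R X =
    \<lparr>carrier = {f. range f \<subseteq> carrier R \<and> finite {x. f x \<noteq> \<zero>\<^bsub>R\<^esub>} \<and> {x. f x \<noteq> \<zero>\<^bsub>R\<^esub>} \<subseteq> X},
     mult = undefined, one = undefined,
     zero = (\<lambda>x. \<zero>\<^bsub>R\<^esub>), add = (\<lambda>f g x. f x \<oplus>\<^bsub>R\<^esub> g x),
     smult = (\<lambda>a f x. a \<otimes>\<^bsub>R\<^esub> f x)\<rparr>"

text \<open>A basis can be taken inside the module, so it suffices to let \<open>X\<close> range over
  sets of the element type.\<close>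

definition is_free_lmodule :: "('r, 'p) ring_scheme \<Rightarrow> ('r, 'm, 'q) module_scheme \<Rightarrow> bool"
  where "is_free_lmodule R M \<longleftrightarrow> lmodule R M \<and>
    (\<exists>(X :: 'm set) h. h \<in> lmodule_hom R (free_lmodule R X) M \<and>
       bij_betw h (carrier (free_lmodule R X)) (carrier M))"

text \<open>Projective modules are the direct summands of free modules: the maps \<open>i\<close>, \<open>p\<close> exhibit \<open>P\<close>
  as a summand of \<open>free_lmodule R X\<close>. A projective module is already a summand of the free module
  on its own elements, so again sets \<open>X\<close> of the element type suffice.\<close>

definition projective_lmodule :: "('r, 'p) ring_scheme \<Rightarrow> ('r, 'm, 'q) module_scheme \<Rightarrow> bool"
  where "projective_lmodule R P \<longleftrightarrow> lmodule R P \<and>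
    (\<exists>(X :: 'm set) i p. i \<in> lmodule_hom R P (free_lmodule R X) \<and>
       p \<in> lmodule_hom R (free_lmodule R X) P \<and> (\<forall>x\<in>carrier P. p (i x) = x))"


section \<open>Projective dimension\<close>

text \<open>A projective resolution consists of modules that share one element type, which must not
  restrict the possible resolutions. We take iterated formal linear combinations of elements of
  \<open>M\<close>. If \<open>X\<close> is a set of such terms, so is (up to encoding) the free module on \<open>X\<close>. Hence the
  resolution \<open>\<dots> \<rightarrow> R\<^bsup>(ker)\<^esup> \<rightarrow> R\<^bsup>(M)\<^esup> \<rightarrow> M\<close> by the free modules on all elements of \<open>M\<close> and of the
  successive kernels, and all the kernels, live in this type. By Schanuel's lemma, if \<open>M\<close> has
  a projective resolution of length \<open>n\<close> in any type, then truncating this one at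
  its \<open>n\<close>-th kernel gives another.\<close>

datatype ('r, 'm) formal_lincomb =
    Generator 'm
  | Combination "('r \<times> ('r, 'm) formal_lincomb) list"

definition projective_resolution ::
    "('r, 'p) ring_scheme \<Rightarrow> ('r, 'm, 'q) module_scheme \<Rightarrow> (nat \<Rightarrow> ('r, 'u) module) \<Rightarrow>
      (nat \<Rightarrow> 'u \<Rightarrow> 'u) \<Rightarrow> ('u \<Rightarrow> 'm) \<Rightarrow> bool"
  where "projective_resolution R M P d e \<longleftrightarrow>
    (\<forall>i. projective_lmodule R (P i)) \<and>
    e \<in> lmodule_hom R (P 0) M \<and>
    (\<forall>i. d i \<in> lmodule_hom R (P (Suc i)) (P i)) \<and>
    e ` carrier (P 0) = carrier M \<and>
    d 0 ` carrier (P 1) = {x \<in> carrier (P 0). e x = \<zero>\<^bsub>M\<^esub>} \<and>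
    (\<forall>i. d (Suc i) ` carrier (P (Suc (Suc i))) = {x \<in> carrier (P (Suc i)). d i x = \<zero>\<^bsub>P i\<^esub>})"

definition has_projective_resolution_of_length ::
    "('r, 'p) ring_scheme \<Rightarrow> ('r, 'm, 'q) module_scheme \<Rightarrow> nat \<Rightarrow> bool"
  where "has_projective_resolution_of_length R M n \<longleftrightarrow>
    (\<exists>(P :: nat \<Rightarrow> ('r, ('r, 'm) formal_lincomb) module) d e.
       projective_resolution R M P d e \<and> (\<forall>i>n. carrier (P i) = {\<zero>\<^bsub>P i\<^esub>}))"

definition projective_dim :: "('r, 'p) ring_scheme \<Rightarrow> ('r, 'm, 'q) module_scheme \<Rightarrow> enat"
  where "projective_dim R M = Inf {enat n |n. has_projective_resolution_of_length R M n}"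


section \<open>Algebras, tensor products and Hochschild dimension\<close>

text \<open>The locale \<^locale>\<open>algebra\<close> of the library requires a commutative multiplication.\<close>

locale unital_algebra = module K A + A?: ring A
  for K :: "('k, 'p) ring_scheme" (structure) and A :: "('k, 'a, 'q) module_scheme" (structure) +
  assumes smult_assoc_l:
      "\<lbrakk>k \<in> carrier K; x \<in> carrier A; y \<in> carrier A\<rbrakk> \<Longrightarrow>
        (k \<odot>\<^bsub>A\<^esub> x) \<otimes>\<^bsub>A\<^esub> y = k \<odot>\<^bsub>A\<^esub> (x \<otimes>\<^bsub>A\<^esub> y)"
    and smult_assoc_r:
      "\<lbrakk>k \<in> carrier K; x \<in> carrier A; y \<in> carrier A\<rbrakk> \<Longrightarrow>
        x \<otimes>\<^bsub>A\<^esub> (k \<odot>\<^bsub>A\<^esub> y) = k \<odot>\<^bsub>A\<^esub> (x \<otimes>\<^bsub>A\<^esub> y)"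

definition opposite :: "('a, 'p) ring_scheme \<Rightarrow> ('a, 'p) ring_scheme"
  where "opposite R = R\<lparr>mult := \<lambda>x y. y \<otimes>\<^bsub>R\<^esub> x\<rparr>"

text \<open>The tensor product over \<open>K\<close> is the quotient of the free abelian group on
  \<open>carrier M \<times> carrier N\<close> by the subgroup generated by the relations of biadditivity and balancedness.
  The multiplication with \<open>(a, b) (c, d) = (a c, b d)\<close> on the free abelian group induces the one
  on the tensor product.\<close>

definition free_pairs_mult ::
    "('a, 'p) ring_scheme \<Rightarrow> ('b, 'q) ring_scheme \<Rightarrow>
      ('a \<times> 'b \<Rightarrow>\<^sub>0 int) \<Rightarrow> ('a \<times> 'b \<Rightarrow>\<^sub>0 int) \<Rightarrow> ('a \<times> 'b \<Rightarrow>\<^sub>0 int)"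
  where "free_pairs_mult M N f g =
    frag_extend (\<lambda>u. frag_extend (\<lambda>v. frag_of (fst u \<otimes>\<^bsub>M\<^esub> fst v, snd u \<otimes>\<^bsub>N\<^esub> snd v)) g) f"

definition free_pairs :: "('a, 'p) ring_scheme \<Rightarrow> ('b, 'q) ring_scheme \<Rightarrow> ('a \<times> 'b \<Rightarrow>\<^sub>0 int) ring"
  where "free_pairs M N =
    \<lparr>carrier = {f. Poly_Mapping.keys f \<subseteq> carrier M \<times> carrier N},
     mult = free_pairs_mult M N, one = frag_of (\<one>\<^bsub>M\<^esub>, \<one>\<^bsub>N\<^esub>),
     zero = 0, add = (+)\<rparr>"

definition tensor_relations ::
    "('k, 'p) ring_scheme \<Rightarrow> ('k, 'a, 'q) module_scheme \<Rightarrow> ('k, 'b, 's) module_scheme \<Rightarrow>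
      ('a \<times> 'b \<Rightarrow>\<^sub>0 int) set"
  where "tensor_relations K M N =
    {frag_of (x \<oplus>\<^bsub>M\<^esub> x', y) - (frag_of (x, y) + frag_of (x', y)) |x x' y.
       x \<in> carrier M \<and> x' \<in> carrier M \<and> y \<in> carrier N} \<union>
    {frag_of (x, y \<oplus>\<^bsub>N\<^esub> y') - (frag_of (x, y) + frag_of (x, y')) |x y y'.
       x \<in> carrier M \<and> y \<in> carrier N \<and> y' \<in> carrier N} \<union>
    {frag_of (k \<odot>\<^bsub>M\<^esub> x, y) - frag_of (x, k \<odot>\<^bsub>N\<^esub> y) |k x y.
       k \<in> carrier K \<and> x \<in> carrier M \<and> y \<in> carrier N}"

definition tensor_kernel ::
    "('k, 'p) ring_scheme \<Rightarrow> ('k, 'a, 'q) module_scheme \<Rightarrow> ('k, 'b, 's) module_scheme \<Rightarrow>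
      ('a \<times> 'b \<Rightarrow>\<^sub>0 int) set"
  where "tensor_kernel K M N = generate (add_monoid (free_pairs M N)) (tensor_relations K M N)"

definition tensor ::
    "('k, 'p) ring_scheme \<Rightarrow> ('k, 'a, 'q) module_scheme \<Rightarrow> ('k, 'b, 's) module_scheme \<Rightarrow>
      ('a \<times> 'b \<Rightarrow>\<^sub>0 int) set ring"
  where "tensor K M N = free_pairs M N Quot tensor_kernel K M N"

text \<open>The additive map \<open>M \<otimes> N \<rightarrow> L\<close> induced by a biadditive balanced map \<open>\<beta>\<close>;
  all representatives of a class have the same value.\<close>

definition free_pairs_lift :: "('c, 'p) ring_scheme \<Rightarrow> ('a \<times> 'b \<Rightarrow> 'c) \<Rightarrow> ('a \<times> 'b \<Rightarrow>\<^sub>0 int) \<Rightarrow> 'c"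
  where "free_pairs_lift L \<beta> f =
    (\<Oplus>\<^bsub>L\<^esub>u\<in>Poly_Mapping.keys f. [Poly_Mapping.lookup f u] \<cdot>\<^bsub>L\<^esub> \<beta> u)"

definition tensor_lift :: "('c, 'p) ring_scheme \<Rightarrow> ('a \<times> 'b \<Rightarrow> 'c) \<Rightarrow> ('a \<times> 'b \<Rightarrow>\<^sub>0 int) set \<Rightarrow> 'c"
  where "tensor_lift L \<beta> X = the_elem (free_pairs_lift L \<beta> ` X)"

definition enveloping_algebra ::
    "('k, 'p) ring_scheme \<Rightarrow> ('k, 'a, 'q) module_scheme \<Rightarrow> ('a \<times> 'a \<Rightarrow>\<^sub>0 int) set ring"
  where "enveloping_algebra K R = tensor K R (opposite R)"

text \<open>\<open>R\<close> as a module over its enveloping algebra: \<open>(a \<otimes> b) r = a r b\<close>.\<close>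

definition enveloping_module ::
    "('k, 'a, 'q) module_scheme \<Rightarrow> (('a \<times> 'a \<Rightarrow>\<^sub>0 int) set, 'a) module"
  where "enveloping_module R =
    \<lparr>carrier = carrier R, mult = mult R, one = one R, zero = zero R, add = add R,
     smult = (\<lambda>X r. tensor_lift R (\<lambda>(a, b). a \<otimes>\<^bsub>R\<^esub> r \<otimes>\<^bsub>R\<^esub> b) X)\<rparr>"

definition Hdim :: "('k, 'p) ring_scheme \<Rightarrow> ('k, 'a, 'q) module_scheme \<Rightarrow> enat"
  where "Hdim K R = projective_dim (enveloping_algebra K R) (enveloping_module R)"


section \<open>Homotopes\<close>

text \<open>The algebra \<open>A\<^sub>\<Delta>\<close> has no unit in general; the field \<open>one\<close>, inherited from \<open>A\<close>,
  carries no meaning.\<close>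

definition homotope :: "('k, 'a, 'q) module_scheme \<Rightarrow> 'a \<Rightarrow> ('k, 'a, 'q) module_scheme"
  where "homotope A \<Delta> = A\<lparr>mult := \<lambda>a b. a \<otimes>\<^bsub>A\<^esub> \<Delta> \<otimes>\<^bsub>A\<^esub> b\<rparr>"

definition adjoin_unit ::
    "('k, 'p) ring_scheme \<Rightarrow> ('k, 'a, 'q) module_scheme \<Rightarrow> ('k, 'k \<times> 'a) module"
  where "adjoin_unit K C =
    \<lparr>carrier = carrier K \<times> carrier C,
     mult = (\<lambda>(k, a) (l, b). (k \<otimes>\<^bsub>K\<^esub> l, k \<odot>\<^bsub>C\<^esub> b \<oplus>\<^bsub>C\<^esub> l \<odot>\<^bsub>C\<^esub> a \<oplus>\<^bsub>C\<^esub> a \<otimes>\<^bsub>C\<^esub> b)),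
     one = (\<one>\<^bsub>K\<^esub>, \<zero>\<^bsub>C\<^esub>),
     zero = (\<zero>\<^bsub>K\<^esub>, \<zero>\<^bsub>C\<^esub>),
     add = (\<lambda>(k, a) (l, b). (k \<oplus>\<^bsub>K\<^esub> l, a \<oplus>\<^bsub>C\<^esub> b)),
     smult = (\<lambda>k (l, a). (k \<otimes>\<^bsub>K\<^esub> l, k \<odot>\<^bsub>C\<^esub> a))\<rparr>"

definition unital_homotope ::
    "('k, 'p) ring_scheme \<Rightarrow> ('k, 'a, 'q) module_scheme \<Rightarrow> 'a \<Rightarrow> ('k, 'k \<times> 'a) module"
  where "unital_homotope K A \<Delta> = adjoin_unit K (homotope A \<Delta>)"

definition homotope_ideal ::
    "('k, 'p) ring_scheme \<Rightarrow> ('k, 'a, 'q) module_scheme \<Rightarrow> ('k \<times> 'a) set"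
  where "homotope_ideal K A = {\<zero>\<^bsub>K\<^esub>} \<times> carrier A"

lemma homotope_simps [simp]:
  "carrier (homotope A \<Delta>) = carrier A"
  "a \<otimes>\<^bsub>homotope A \<Delta>\<^esub> b = a \<otimes>\<^bsub>A\<^esub> \<Delta> \<otimes>\<^bsub>A\<^esub> b"
  "zero (homotope A \<Delta>) = zero A" "add (homotope A \<Delta>) = add A" "smult (homotope A \<Delta>) = smult A"
  by (simp_all add: homotope_def)

text \<open>A left ideal as a left module. Right \<open>R\<close>-modules are left modules over \<open>opposite R\<close>, so
  \<open>ideal_lmodule (opposite R) I\<close> is a right ideal \<open>I\<close> of \<open>R\<close> as a right \<open>R\<close>-module.\<close>

definition ideal_lmodule :: "('a, 'p) ring_scheme \<Rightarrow> 'a set \<Rightarrow> ('a, 'a) module"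
  where "ideal_lmodule R I =
    \<lparr>carrier = I, mult = mult R, one = one R, zero = zero R, add = add R, smult = mult R\<rparr>"

definition well_tempered ::
    "('k, 'p) ring_scheme \<Rightarrow> ('k, 'a, 'q) module_scheme \<Rightarrow> 'a \<Rightarrow> bool"
  where "well_tempered K A \<Delta> \<longleftrightarrow>
    \<Delta> \<in> carrier A \<and>
    (let C = homotope A \<Delta>; B = unital_homotope K A \<Delta>; I = homotope_ideal K A in
      tensor_lift C (\<lambda>(a, b). a \<otimes>\<^bsub>C\<^esub> b) ` carrier (tensor K C C) = carrier C \<and>
      projective_lmodule B (ideal_lmodule B I) \<and>
      projective_lmodule (opposite B) (ideal_lmodule (opposite B) I))"


section \<open>Well-definedness\<close>

text \<open>Tensor products of algebras are rings, \<^const>\<open>tensor_lift\<close> does not depend on representatives,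
  homotopes are algebras, and the structures used as modules above are modules.\<close>

lemma frag_extend_diff_left:
  "frag_extend (\<lambda>u. p u - q u) f = frag_extend p f - frag_extend q f"
  using subset_UNIV
  by (induction f rule: frag_induction) (auto simp: frag_extend_diff)

lemma free_pairs_mult_of [simp]:
  "free_pairs_mult M N (frag_of (a, b)) (frag_of (c, d)) = frag_of (a \<otimes>\<^bsub>M\<^esub> c, b \<otimes>\<^bsub>N\<^esub> d)"
  "free_pairs_mult M N 0 g = 0" "free_pairs_mult M N f 0 = 0"
  by (simp_all add: free_pairs_mult_def frag_extend_eq_0)

lemma free_pairs_mult_diff:
  "free_pairs_mult M N (f - f') g = free_pairs_mult M N f g - free_pairs_mult M N f' g"
  "free_pairs_mult M N f (g - g') = free_pairs_mult M N f g - free_pairs_mult M N f g'"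
  by (simp_all add: free_pairs_mult_def frag_extend_diff frag_extend_diff_left)

lemma free_pairs_mult_minus:
  "free_pairs_mult M N (- f) g = - free_pairs_mult M N f g"
  "free_pairs_mult M N f (- g) = - free_pairs_mult M N f g"
  using free_pairs_mult_diff[of M N 0 f g] free_pairs_mult_diff(2)[of M N f 0 g] by simp_all

lemma free_pairs_mult_add:
  "free_pairs_mult M N (f + f') g = free_pairs_mult M N f g + free_pairs_mult M N f' g"
  "free_pairs_mult M N f (g + g') = free_pairs_mult M N f g + free_pairs_mult M N f g'"
  using free_pairs_mult_diff(1)[of M N f "- f'" g] free_pairs_mult_diff(2)[of M N f g "- g'"]
  by (simp_all add: free_pairs_mult_minus)

lemma keys_diff_subset:
  "\<lbrakk>Poly_Mapping.keys f \<subseteq> S; Poly_Mapping.keys g \<subseteq> S\<rbrakk> \<Longrightarrow> Poly_Mapping.keys (f - g) \<subseteq> S"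
  using keys_diff[of f g] by blast

lemma keys_add_subset:
  "\<lbrakk>Poly_Mapping.keys f \<subseteq> S; Poly_Mapping.keys g \<subseteq> S\<rbrakk> \<Longrightarrow> Poly_Mapping.keys (f + g) \<subseteq> S"
  using keys_add[of f g] by blast

lemma abelian_group_free_pairs: "abelian_group (free_pairs M N)"
proof (rule abelian_groupI)
  fix f assume "f \<in> carrier (free_pairs M N)"
  then show "\<exists>g\<in>carrier (free_pairs M N). g \<oplus>\<^bsub>free_pairs M N\<^esub> f = \<zero>\<^bsub>free_pairs M N\<^esub>"
    by (intro bexI[of _ "- f"]) (auto simp: free_pairs_def)
qed (simp_all add: free_pairs_def add.assoc add.commute keys_add_subset)

lemma a_inv_free_pairs:
  assumes "f \<in> carrier (free_pairs M N)"
  shows "\<ominus>\<^bsub>free_pairs M N\<^esub> f = - f"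
proof -
  interpret F: abelian_group "free_pairs M N" by (rule abelian_group_free_pairs)
  show ?thesis
    by (rule F.minus_equality) (use assms in \<open>simp_all add: free_pairs_def\<close>)
qed

lemma ring_free_pairs:
  assumes "ring M" "ring N"
  shows "ring (free_pairs M N)"
proof -
  interpret M: ring M by fact
  interpret N: ring N by fact
  let ?S = "carrier M \<times> carrier N"
  have closed: "Poly_Mapping.keys (free_pairs_mult M N f g) \<subseteq> ?S"
    if f: "Poly_Mapping.keys f \<subseteq> ?S" and g: "Poly_Mapping.keys g \<subseteq> ?S" for f g
    using f
  proof (induction f rule: frag_induction)
    case (one x)
    show ?case
      using g
    proof (induction g rule: frag_induction)
      case (one y)
      with \<open>x \<in> ?S\<close> show ?case by (cases x; cases y) simp
    qed (simp_all add: free_pairs_mult_diff keys_diff_subset)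
  qed (simp_all add: free_pairs_mult_diff keys_diff_subset)
  have assoc: "free_pairs_mult M N (free_pairs_mult M N f g) h
      = free_pairs_mult M N f (free_pairs_mult M N g h)"
    if f: "Poly_Mapping.keys f \<subseteq> ?S" and g: "Poly_Mapping.keys g \<subseteq> ?S"
      and h: "Poly_Mapping.keys h \<subseteq> ?S" for f g h
    using f
  proof (induction f rule: frag_induction)
    case (one x)
    show ?case
      using g
    proof (induction g rule: frag_induction)
      case (one y)
      show ?case
        using h
      proof (induction h rule: frag_induction)
        case (one z)
        with \<open>x \<in> ?S\<close> \<open>y \<in> ?S\<close> show ?case
          by (cases x; cases y; cases z) (simp add: M.m_assoc N.m_assoc)
      qed (simp_all add: free_pairs_mult_diff)
    qed (simp_all add: free_pairs_mult_diff)
  qed (simp_all add: free_pairs_mult_diff)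
  have units: "free_pairs_mult M N (frag_of (\<one>\<^bsub>M\<^esub>, \<one>\<^bsub>N\<^esub>)) f = f
      \<and> free_pairs_mult M N f (frag_of (\<one>\<^bsub>M\<^esub>, \<one>\<^bsub>N\<^esub>)) = f"
    if "Poly_Mapping.keys f \<subseteq> ?S" for f
    using that
    by (induction f rule: frag_induction) (auto simp: free_pairs_mult_diff)
  show ?thesis
  proof (rule ringI)
    show "abelian_group (free_pairs M N)" by (rule abelian_group_free_pairs)
    show "Group.monoid (free_pairs M N)"
      by (rule monoidI) (use closed assoc units in \<open>simp_all add: free_pairs_def\<close>)
  qed (simp_all add: free_pairs_def free_pairs_mult_add)
qed

context
  fixes K :: "('k, 'p) ring_scheme" and M :: "('k, 'a, 'q) module_scheme"
    and N :: "('k, 'b, 's) module_scheme"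
  assumes M: "unital_algebra K M" and N: "unital_algebra K N"
begin

interpretation M: unital_algebra K M by (rule M)
interpretation N: unital_algebra K N by (rule N)
interpretation F: ring "free_pairs M N"
  by (intro ring_free_pairs M.A.ring_axioms N.A.ring_axioms)

lemma tensor_relations_subset: "tensor_relations K M N \<subseteq> carrier (free_pairs M N)"
proof
  fix r assume "r \<in> tensor_relations K M N"
  then have "Poly_Mapping.keys r \<subseteq> carrier M \<times> carrier N"
    unfolding tensor_relations_def
    by (elim UnE CollectE exE conjE) (simp_all add: keys_diff_subset keys_add_subset)
  then show "r \<in> carrier (free_pairs M N)"
    by (simp add: free_pairs_def)
qed

lemma ideal_tensor_kernel: "ideal (tensor_kernel K M N) (free_pairs M N)"
proof -
  let ?F = "free_pairs M N" and ?R = "tensor_relations K M N" and ?I = "tensor_kernel K M N"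
  have sub: "subgroup ?I (add_monoid ?F)"
    unfolding tensor_kernel_def
    using F.add.generate_is_subgroup tensor_relations_subset by simp
  have zero: "0 \<in> ?I"
    using subgroup.one_closed[OF sub] by (simp add: free_pairs_def)
  have carr: "f \<in> ?I \<Longrightarrow> f \<in> carrier ?F" for f
    using subgroup.subset[OF sub] by auto
  have add: "f \<in> ?I \<Longrightarrow> g \<in> ?I \<Longrightarrow> f + g \<in> ?I" for f g
    using subgroup.m_closed[OF sub] by (simp add: free_pairs_def)
  have neg: "f \<in> ?I \<Longrightarrow> - f \<in> ?I" for f
    using subgroup.m_inv_closed[OF sub, of f] a_inv_free_pairs[OF carr]
    by (simp add: a_inv_def)
  have diff: "f - g \<in> ?I" if "f \<in> ?I" "g \<in> ?I" for f g
    using add[OF that(1) neg[OF that(2)]] by simp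
  have incl: "f \<in> ?R \<Longrightarrow> f \<in> ?I" for f
    by (simp add: tensor_kernel_def generate.incl)
  have rel_l: "frag_of (x \<oplus>\<^bsub>M\<^esub> x', y) - (frag_of (x, y) + frag_of (x', y)) \<in> ?R"
    if "x \<in> carrier M" "x' \<in> carrier M" "y \<in> carrier N" for x x' y
    using that unfolding tensor_relations_def by blast
  have rel_r: "frag_of (x, y \<oplus>\<^bsub>N\<^esub> y') - (frag_of (x, y) + frag_of (x, y')) \<in> ?R"
    if "x \<in> carrier M" "y \<in> carrier N" "y' \<in> carrier N" for x y y'
    using that unfolding tensor_relations_def by blast
  have rel_k: "frag_of (k \<odot>\<^bsub>M\<^esub> x, y) - frag_of (x, k \<odot>\<^bsub>N\<^esub> y) \<in> ?R"
    if "k \<in> carrier K" "x \<in> carrier M" "y \<in> carrier N" for k x y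
    using that unfolding tensor_relations_def by blast
  have rel: "free_pairs_mult M N (frag_of u) r \<in> ?R \<and> free_pairs_mult M N r (frag_of u) \<in> ?R"
    if rR: "r \<in> ?R" and uS: "u \<in> carrier M \<times> carrier N" for r u
  proof -
    obtain a b where u: "u = (a, b)" "a \<in> carrier M" "b \<in> carrier N"
      using uS by blast
    from rR consider
      (l) x x' y where "r = frag_of (x \<oplus>\<^bsub>M\<^esub> x', y) - (frag_of (x, y) + frag_of (x', y))"
        "x \<in> carrier M" "x' \<in> carrier M" "y \<in> carrier N"
    | (r) x y y' where "r = frag_of (x, y \<oplus>\<^bsub>N\<^esub> y') - (frag_of (x, y) + frag_of (x, y'))"
        "x \<in> carrier M" "y \<in> carrier N" "y' \<in> carrier N"
    | (k) k x y where "r = frag_of (k \<odot>\<^bsub>M\<^esub> x, y) - frag_of (x, k \<odot>\<^bsub>N\<^esub> y)"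
        "k \<in> carrier K" "x \<in> carrier M" "y \<in> carrier N"
      by (auto simp: tensor_relations_def)
    then show ?thesis
    proof cases
      case l
      then show ?thesis
        using u by (simp add: free_pairs_mult_diff free_pairs_mult_add M.A.r_distr M.A.l_distr rel_l)
    next
      case r
      then show ?thesis
        using u by (simp add: free_pairs_mult_diff free_pairs_mult_add N.A.r_distr N.A.l_distr rel_r)
    next
      case k
      then show ?thesis
        using u by (simp add: free_pairs_mult_diff M.smult_assoc_l N.smult_assoc_l
            M.smult_assoc_r N.smult_assoc_r rel_k)
    qed
  qed
  have gen: "free_pairs_mult M N (frag_of u) f \<in> ?I \<and> free_pairs_mult M N f (frag_of u) \<in> ?I"
    if "f \<in> ?I" "u \<in> carrier M \<times> carrier N" for f u
    using that(1)[unfolded tensor_kernel_def]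
  proof (induction f rule: generate.induct)
    case one
    then show ?case by (simp add: free_pairs_def zero)
  next
    case (incl h)
    then show ?case using rel that incl by (simp add: tensor_kernel_def generate.incl)
  next
    case (inv h)
    then have "inv\<^bsub>add_monoid ?F\<^esub> h = - h"
      using tensor_relations_subset a_inv_free_pairs[of h M N]
      by (auto simp: a_inv_def)
    then show ?case
      using inv rel that incl neg by (simp add: free_pairs_mult_minus)
  next
    case (eng g h)
    then show ?case by (simp add: free_pairs_def free_pairs_mult_add add)
  qed
  have mult: "free_pairs_mult M N g f \<in> ?I \<and> free_pairs_mult M N f g \<in> ?I"
    if f: "f \<in> ?I" and g: "Poly_Mapping.keys g \<subseteq> carrier M \<times> carrier N" for f g
    using g
    by (induction g rule: frag_induction) (use gen[OF f] zero diff in \<open>auto simp: free_pairs_mult_diff\<close>)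
  show ?thesis
    by (rule idealI[OF F.ring_axioms sub]) (use mult in \<open>auto simp: free_pairs_def\<close>)
qed

lemma ring_tensor: "ring (tensor K M N)"
  unfolding tensor_def by (rule ideal.quotient_is_ring[OF ideal_tensor_kernel])

end

lemma (in abelian_group) free_pairs_lift_superset:
  assumes "finite T" "Poly_Mapping.keys f \<subseteq> T" "\<beta> \<in> T \<rightarrow> carrier G"
  shows "free_pairs_lift G \<beta> f = (\<Oplus>u\<in>T. [Poly_Mapping.lookup f u] \<cdot> \<beta> u)"
  unfolding free_pairs_lift_def
proof (rule add.finprod_mono_neutral_cong_left[OF assms(1,2)])
  show "[Poly_Mapping.lookup f u] \<cdot> \<beta> u = \<zero>" if "u \<in> T - Poly_Mapping.keys f" for u
    using that by (simp add: in_keys_iff add_pow_def)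
  show "(\<lambda>u. [Poly_Mapping.lookup f u] \<cdot> \<beta> u) \<in> T \<rightarrow> carrier G"
    using assms(3) by auto
qed simp

context abelian_group
begin

lemma free_pairs_lift_closed:
  assumes "\<beta> \<in> S \<rightarrow> carrier G" "Poly_Mapping.keys f \<subseteq> S"
  shows "free_pairs_lift G \<beta> f \<in> carrier G"
  unfolding free_pairs_lift_def
  using assms by (intro finsum_closed Pi_I add.int_pow_closed) blast

lemma free_pairs_lift_0 [simp]: "free_pairs_lift G \<beta> 0 = \<zero>"
  by (simp add: free_pairs_lift_def)

lemma free_pairs_lift_of [simp]: "\<beta> u \<in> carrier G \<Longrightarrow> free_pairs_lift G \<beta> (frag_of u) = \<beta> u"
  using free_pairs_lift_superset[of "{u}" "frag_of u" \<beta>] by simp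

lemma free_pairs_lift_add:
  assumes "\<beta> \<in> S \<rightarrow> carrier G" "Poly_Mapping.keys f \<subseteq> S" "Poly_Mapping.keys g \<subseteq> S"
  shows "free_pairs_lift G \<beta> (f + g) = free_pairs_lift G \<beta> f \<oplus> free_pairs_lift G \<beta> g"
proof -
  let ?T = "Poly_Mapping.keys f \<union> Poly_Mapping.keys g"
  have \<beta>: "\<beta> \<in> ?T \<rightarrow> carrier G" using assms by blast
  have "free_pairs_lift G \<beta> (f + g) = (\<Oplus>u\<in>?T. [Poly_Mapping.lookup (f + g) u] \<cdot> \<beta> u)"
    by (rule free_pairs_lift_superset) (use \<beta> keys_add[of f g] in auto)
  also have "\<dots> = (\<Oplus>u\<in>?T. [Poly_Mapping.lookup f u] \<cdot> \<beta> u \<oplus> [Poly_Mapping.lookup g u] \<cdot> \<beta> u)"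
    by (rule add.finprod_cong') (use \<beta> in \<open>auto simp: lookup_add add.int_pow_mult Pi_iff\<close>)
  also have "\<dots> = (\<Oplus>u\<in>?T. [Poly_Mapping.lookup f u] \<cdot> \<beta> u) \<oplus> (\<Oplus>u\<in>?T. [Poly_Mapping.lookup g u] \<cdot> \<beta> u)"
    by (rule finsum_addf) (use \<beta> in auto)
  also have "\<dots> = free_pairs_lift G \<beta> f \<oplus> free_pairs_lift G \<beta> g"
    using \<beta> by (simp add: free_pairs_lift_superset[of ?T])
  finally show ?thesis .
qed

lemma free_pairs_lift_minus:
  assumes "\<beta> \<in> S \<rightarrow> carrier G" "Poly_Mapping.keys f \<subseteq> S"
  shows "free_pairs_lift G \<beta> (- f) = \<ominus> free_pairs_lift G \<beta> f"
proof -
  have "free_pairs_lift G \<beta> (- f) \<oplus> free_pairs_lift G \<beta> f = \<zero>"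
    using free_pairs_lift_add[OF assms(1), of "- f" f] assms(2) by simp
  then show ?thesis
    using free_pairs_lift_closed[OF assms(1)] assms(2) by (intro minus_equality[symmetric]) auto
qed

lemma free_pairs_lift_diff:
  assumes "\<beta> \<in> S \<rightarrow> carrier G" "Poly_Mapping.keys f \<subseteq> S" "Poly_Mapping.keys g \<subseteq> S"
  shows "free_pairs_lift G \<beta> (f - g) = free_pairs_lift G \<beta> f \<ominus> free_pairs_lift G \<beta> g"
  using free_pairs_lift_add[OF assms(1,2), of "- g"] free_pairs_lift_minus[OF assms(1,3)] assms(3)
  by (simp add: a_minus_def)

end

lemma tensor_lift_coset:
  assumes "abelian_group M" "abelian_group N" "abelian_group L"
    and \<beta>: "\<beta> \<in> carrier M \<times> carrier N \<rightarrow> carrier L"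
    and l: "\<And>x x' y. \<lbrakk>x \<in> carrier M; x' \<in> carrier M; y \<in> carrier N\<rbrakk> \<Longrightarrow>
      \<beta> (x \<oplus>\<^bsub>M\<^esub> x', y) = \<beta> (x, y) \<oplus>\<^bsub>L\<^esub> \<beta> (x', y)"
    and r: "\<And>x y y'. \<lbrakk>x \<in> carrier M; y \<in> carrier N; y' \<in> carrier N\<rbrakk> \<Longrightarrow>
      \<beta> (x, y \<oplus>\<^bsub>N\<^esub> y') = \<beta> (x, y) \<oplus>\<^bsub>L\<^esub> \<beta> (x, y')"
    and k: "\<And>k x y. \<lbrakk>k \<in> carrier K; x \<in> carrier M; y \<in> carrier N\<rbrakk> \<Longrightarrow>
      \<beta> (k \<odot>\<^bsub>M\<^esub> x, y) = \<beta> (x, k \<odot>\<^bsub>N\<^esub> y)"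
    and closed: "\<And>k x. \<lbrakk>k \<in> carrier K; x \<in> carrier M\<rbrakk> \<Longrightarrow> k \<odot>\<^bsub>M\<^esub> x \<in> carrier M"
      "\<And>k y. \<lbrakk>k \<in> carrier K; y \<in> carrier N\<rbrakk> \<Longrightarrow> k \<odot>\<^bsub>N\<^esub> y \<in> carrier N"
    and f: "f \<in> carrier (free_pairs M N)"
  shows "tensor_lift L \<beta> (tensor_kernel K M N +>\<^bsub>free_pairs M N\<^esub> f) = free_pairs_lift L \<beta> f"
proof -
  interpret M: abelian_group M by fact
  interpret N: abelian_group N by fact
  interpret L: abelian_group L by fact
  let ?S = "carrier M \<times> carrier N"
  have \<beta>_closed: "x \<in> carrier M \<Longrightarrow> y \<in> carrier N \<Longrightarrow> \<beta> (x, y) \<in> carrier L" for x y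
    using \<beta> by auto
  have f': "Poly_Mapping.keys f \<subseteq> ?S" using f by (simp add: free_pairs_def)
  have rel: "Poly_Mapping.keys g \<subseteq> ?S \<and> free_pairs_lift L \<beta> g = \<zero>\<^bsub>L\<^esub>"
    if "g \<in> tensor_relations K M N" for g
    using that unfolding tensor_relations_def
    by (elim UnE CollectE exE conjE)
      (simp_all add: L.free_pairs_lift_diff[OF \<beta>] L.free_pairs_lift_add[OF \<beta>] l r k \<beta>_closed closed
        keys_diff_subset keys_add_subset L.r_neg a_minus_def)
  have ker: "Poly_Mapping.keys g \<subseteq> ?S \<and> free_pairs_lift L \<beta> g = \<zero>\<^bsub>L\<^esub>"
    if "g \<in> tensor_kernel K M N" for g
    using that unfolding tensor_kernel_def
  proof (induction g rule: generate.induct)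
    case (inv h)
    then have "inv\<^bsub>add_monoid (free_pairs M N)\<^esub> h = - h"
      using a_inv_free_pairs[of h M N] rel[of h]
      by (auto simp: a_inv_def free_pairs_def)
    then show ?case
      using rel[OF inv] by (simp add: L.free_pairs_lift_minus[OF \<beta>])
  next
    case (eng g h)
    then show ?case
      by (simp add: free_pairs_def keys_add_subset L.free_pairs_lift_add[OF \<beta>])
  qed (auto simp: rel free_pairs_def)
  have "free_pairs_lift L \<beta> (g + f) = free_pairs_lift L \<beta> f" if "g \<in> tensor_kernel K M N" for g
    using ker[OF that] f' L.free_pairs_lift_closed[OF \<beta>] by (simp add: L.free_pairs_lift_add[OF \<beta>])
  moreover have "\<exists>g. g \<in> tensor_kernel K M N"
    using generate.one unfolding tensor_kernel_def by blast
  ultimately have "free_pairs_lift L \<beta> ` (tensor_kernel K M N +>\<^bsub>free_pairs M N\<^esub> f)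
      = {free_pairs_lift L \<beta> f}"
    by (auto simp: a_r_coset_def r_coset_def free_pairs_def image_iff)
  then show ?thesis by (simp add: tensor_lift_def)
qed

lemma opposite_simps [simp]:
  "carrier (opposite R) = carrier R" "x \<otimes>\<^bsub>opposite R\<^esub> y = y \<otimes>\<^bsub>R\<^esub> x"
  "one (opposite R) = one R" "zero (opposite R) = zero R" "add (opposite R) = add R"
  by (simp_all add: opposite_def)

lemma smult_opposite [simp]: "smult (opposite R) = smult R"
  by (simp add: opposite_def)

lemma abelian_group_cong:
  assumes "abelian_group R" "carrier S = carrier R" "zero S = zero R" "add S = add R"
  shows "abelian_group S"
proof -
  interpret abelian_group R by fact
  show ?thesis
    by (rule abelian_groupI)
      (use assms(2-) in \<open>auto simp: a_ac intro: l_neg bexI[OF _ a_inv_closed]\<close>)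
qed

lemma ring_opposite: "ring R \<Longrightarrow> ring (opposite R)"
proof -
  assume "ring R"
  then interpret ring R .
  show ?thesis
    by (rule ringI abelian_group_cong[OF is_abelian_group] monoidI | simp add: m_assoc l_distr r_distr)+
qed

context unital_algebra
begin

lemma unital_algebra_opposite: "unital_algebra K (opposite A)"
proof -
  interpret O: ring "opposite A" by (rule ring_opposite[OF A.ring_axioms])
  show ?thesis
    by (intro unital_algebra.intro moduleI unital_algebra_axioms.intro O.ring_axioms
        O.is_abelian_group R.is_cring)
      (auto simp: smult_l_distr smult_r_distr smult_assoc1 smult_assoc_l smult_assoc_r)
qed

lemma enveloping_module_smult:
  assumes f: "f \<in> carrier (free_pairs A (opposite A))" and x: "x \<in> carrier A"
  shows "(tensor_kernel K A (opposite A) +>\<^bsub>free_pairs A (opposite A)\<^esub> f) \<odot>\<^bsub>enveloping_module A\<^esub> x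
    = free_pairs_lift A (\<lambda>(a, b). a \<otimes>\<^bsub>A\<^esub> x \<otimes>\<^bsub>A\<^esub> b) f"
  unfolding enveloping_module_def
  using x
  by (simp, intro tensor_lift_coset A.is_abelian_group f abelian_group_cong[OF A.is_abelian_group])
    (auto simp: A.l_distr A.r_distr smult_assoc_l smult_assoc_r)

lemma lmodule_enveloping_module: "lmodule (enveloping_algebra K A) (enveloping_module A)"
proof -
  let ?F = "free_pairs A (opposite A)" and ?I = "tensor_kernel K A (opposite A)"
  let ?\<beta> = "\<lambda>x (a, b). a \<otimes>\<^bsub>A\<^esub> x \<otimes>\<^bsub>A\<^esub> b"
  interpret I: ideal ?I ?F
    by (rule ideal_tensor_kernel[OF unital_algebra_axioms unital_algebra_opposite])
  have E: "enveloping_algebra K A = ?F Quot ?I"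
    by (simp add: enveloping_algebra_def tensor_def)
  have carrE: "\<exists>f\<in>carrier ?F. X = ?I +>\<^bsub>?F\<^esub> f" if "X \<in> carrier (enveloping_algebra K A)" for X
    using that unfolding E by (auto simp: FactRing_def A_RCOSETS_def RCOSETS_def a_r_coset_def)
  have \<beta>: "?\<beta> x \<in> carrier A \<times> carrier A \<rightarrow> carrier A" if "x \<in> carrier A" for x
    using that by auto
  have carrF: "f \<in> carrier ?F \<longleftrightarrow> Poly_Mapping.keys f \<subseteq> carrier A \<times> carrier A" for f
    by (simp add: free_pairs_def)
  have F_diff: "f - g \<in> carrier ?F" and F_add: "f + g \<in> carrier ?F"
    if "f \<in> carrier ?F" "g \<in> carrier ?F" for f g
    using that by (simp_all add: carrF keys_diff_subset keys_add_subset)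
  have lift_closed: "free_pairs_lift A (?\<beta> x) f \<in> carrier A" if "x \<in> carrier A" "f \<in> carrier ?F" for x f
    by (rule M.free_pairs_lift_closed[OF \<beta>]) (use that in \<open>simp_all add: carrF\<close>)
  have lift_r: "free_pairs_lift A (?\<beta> (x \<oplus>\<^bsub>A\<^esub> y)) f
      = free_pairs_lift A (?\<beta> x) f \<oplus>\<^bsub>A\<^esub> free_pairs_lift A (?\<beta> y) f"
    if x: "x \<in> carrier A" and y: "y \<in> carrier A" and f: "f \<in> carrier ?F" for x y f
  proof -
    have "free_pairs_lift A (?\<beta> (x \<oplus>\<^bsub>A\<^esub> y)) f
        = free_pairs_lift A (?\<beta> x) f \<oplus>\<^bsub>A\<^esub> free_pairs_lift A (?\<beta> y) f \<and> f \<in> carrier ?F"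
      using f[unfolded carrF]
    proof (induction f rule: frag_induction)
      case zero
      show ?case by (simp add: carrF)
    next
      case (one u)
      then show ?case
        using x y by (cases u) (simp add: carrF A.l_distr A.r_distr)
    next
      case (diff f g)
      have fg: "f \<in> carrier ?F" "g \<in> carrier ?F" "f - g \<in> carrier ?F"
        using diff by (simp_all add: F_diff)
      have xy: "x \<oplus>\<^bsub>A\<^esub> y \<in> carrier A"
        using x y by simp
      have lift_diff: "free_pairs_lift A (?\<beta> z) (f - g) = free_pairs_lift A (?\<beta> z) f \<ominus>\<^bsub>A\<^esub> free_pairs_lift A (?\<beta> z) g"
        if "z \<in> carrier A" for z
        by (rule M.free_pairs_lift_diff[OF \<beta>[OF that]]) (use fg in \<open>simp_all add: carrF\<close>)
      have "(p \<oplus>\<^bsub>A\<^esub> q) \<ominus>\<^bsub>A\<^esub> (r \<oplus>\<^bsub>A\<^esub> s) = (p \<ominus>\<^bsub>A\<^esub> r) \<oplus>\<^bsub>A\<^esub> (q \<ominus>\<^bsub>A\<^esub> s)"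
        if "p \<in> carrier A" "q \<in> carrier A" "r \<in> carrier A" "s \<in> carrier A" for p q r s
        using that by (simp add: a_minus_def M.minus_add M.a_ac)
      from this[OF lift_closed[OF x fg(1)] lift_closed[OF y fg(1)] lift_closed[OF x fg(2)] lift_closed[OF y fg(2)]]
      show ?case
        unfolding lift_diff[OF x] lift_diff[OF y] lift_diff[OF xy]
          diff.IH(1)[THEN conjunct1] diff.IH(2)[THEN conjunct1]
        using fg(3) by (rule conjI)
    qed
    then show ?thesis ..
  qed
  have lift_mult: "free_pairs_lift A (?\<beta> x) (f \<otimes>\<^bsub>?F\<^esub> g) = free_pairs_lift A (?\<beta> (free_pairs_lift A (?\<beta> x) g)) f"
    if x: "x \<in> carrier A" and f: "f \<in> carrier ?F" and g: "g \<in> carrier ?F" for x f g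
  proof -
    have "free_pairs_lift A (?\<beta> x) (f \<otimes>\<^bsub>?F\<^esub> g)
        = free_pairs_lift A (?\<beta> (free_pairs_lift A (?\<beta> x) g)) f \<and> f \<in> carrier ?F"
      using f[unfolded carrF]
    proof (induction f rule: frag_induction)
      case zero
      show ?case by (simp add: free_pairs_def)
    next
      case (one u)
      then obtain a b where u: "u = (a, b)" "a \<in> carrier A" "b \<in> carrier A" by blast
      have [simp]: "frag_of u \<in> carrier ?F" using u by (simp add: carrF)
      have "free_pairs_lift A (?\<beta> x) (frag_of u \<otimes>\<^bsub>?F\<^esub> g)
          = a \<otimes>\<^bsub>A\<^esub> free_pairs_lift A (?\<beta> x) g \<otimes>\<^bsub>A\<^esub> b \<and> g \<in> carrier ?F"
        using g[unfolded carrF]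
      proof (induction g rule: frag_induction)
        case zero
        show ?case using u by (simp add: free_pairs_def)
      next
        case (one v)
        then show ?case
          using u x by (cases v) (simp add: free_pairs_def A.m_assoc)
      next
        case (diff g h)
        then have *: "frag_of u \<otimes>\<^bsub>?F\<^esub> (g - h) = frag_of u \<otimes>\<^bsub>?F\<^esub> g - frag_of u \<otimes>\<^bsub>?F\<^esub> h"
          by (simp add: free_pairs_def free_pairs_mult_diff)
        have "frag_of u \<otimes>\<^bsub>?F\<^esub> g \<in> carrier ?F" "frag_of u \<otimes>\<^bsub>?F\<^esub> h \<in> carrier ?F"
          using diff by auto
        moreover have "g - h \<in> carrier ?F"
          using diff by (simp add: F_diff)
        ultimately show ?case
          using diff u x lift_closed[of x g] lift_closed[of x h] unfolding *
          by (simp add: M.free_pairs_lift_diff[OF \<beta>] carrF a_minus_def A.l_distr A.r_distr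
              A.l_minus A.r_minus)
      qed
      then show ?case
        using u x lift_closed[OF x g] by (simp add: carrF)
    next
      case (diff f h)
      have *: "(f - h) \<otimes>\<^bsub>?F\<^esub> g = f \<otimes>\<^bsub>?F\<^esub> g - h \<otimes>\<^bsub>?F\<^esub> g"
        by (simp add: free_pairs_def free_pairs_mult_diff)
      have "f \<otimes>\<^bsub>?F\<^esub> g \<in> carrier ?F" "h \<otimes>\<^bsub>?F\<^esub> g \<in> carrier ?F"
        using diff g by auto
      moreover have "f - h \<in> carrier ?F"
        using diff by (simp add: F_diff)
      ultimately show ?case
        using diff x lift_closed[OF x g] unfolding *
        by (simp add: M.free_pairs_lift_diff[OF \<beta>] carrF)
    qed
    then show ?thesis ..
  qed
  have smult: "(?I +>\<^bsub>?F\<^esub> f) \<odot>\<^bsub>enveloping_module A\<^esub> x = free_pairs_lift A (?\<beta> x) f"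
    if "f \<in> carrier ?F" "x \<in> carrier A" for f x
    using enveloping_module_smult[OF that] .
  have [simp]: "carrier (enveloping_module A) = carrier A" "add (enveloping_module A) = add A"
    "zero (enveloping_module A) = zero A"
    by (simp_all add: enveloping_module_def)
  have one: "frag_of (\<one>\<^bsub>A\<^esub>, \<one>\<^bsub>A\<^esub>) \<in> carrier ?F" by (simp add: carrF)
  show ?thesis
  proof (intro lmodule.intro lmodule_axioms.intro)
    show "ring (enveloping_algebra K A)"
      unfolding E by (rule I.quotient_is_ring)
    show "abelian_group (enveloping_module A)"
      by (rule abelian_group_cong[OF A.is_abelian_group]) simp_all
  next
    fix X x assume "X \<in> carrier (enveloping_algebra K A)" "x \<in> carrier (enveloping_module A)"
    then show "X \<odot>\<^bsub>enveloping_module A\<^esub> x \<in> carrier (enveloping_module A)"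
      using carrE[of X] lift_closed by (auto simp: smult)
  next
    fix X Y x
    assume X: "X \<in> carrier (enveloping_algebra K A)" and Y: "Y \<in> carrier (enveloping_algebra K A)"
      and "x \<in> carrier (enveloping_module A)"
    then have x: "x \<in> carrier A" by simp
    obtain f g where f: "f \<in> carrier ?F" "X = ?I +>\<^bsub>?F\<^esub> f" and g: "g \<in> carrier ?F" "Y = ?I +>\<^bsub>?F\<^esub> g"
      using carrE X Y by blast
    have "X \<oplus>\<^bsub>enveloping_algebra K A\<^esub> Y = ?I +>\<^bsub>?F\<^esub> (f \<oplus>\<^bsub>?F\<^esub> g)"
      using f g by (simp add: E FactRing_def I.a_rcos_sum)
    moreover have "f \<oplus>\<^bsub>?F\<^esub> g = f + g"
      by (simp add: free_pairs_def)
    moreover have "f + g \<in> carrier ?F"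
      using f g by (simp add: F_add)
    ultimately show "(X \<oplus>\<^bsub>enveloping_algebra K A\<^esub> Y) \<odot>\<^bsub>enveloping_module A\<^esub> x
        = X \<odot>\<^bsub>enveloping_module A\<^esub> x \<oplus>\<^bsub>enveloping_module A\<^esub> Y \<odot>\<^bsub>enveloping_module A\<^esub> x"
      using f g x carrF by (simp add: smult M.free_pairs_lift_add[OF \<beta>])
    have "X \<otimes>\<^bsub>enveloping_algebra K A\<^esub> Y = ?I +>\<^bsub>?F\<^esub> (f \<otimes>\<^bsub>?F\<^esub> g)"
      using f g by (simp add: E FactRing_def I.rcoset_mult_add)
    then show "(X \<otimes>\<^bsub>enveloping_algebra K A\<^esub> Y) \<odot>\<^bsub>enveloping_module A\<^esub> x
        = X \<odot>\<^bsub>enveloping_module A\<^esub> (Y \<odot>\<^bsub>enveloping_module A\<^esub> x)"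
      using f g x lift_closed by (simp add: smult lift_mult)
  next
    fix X x y
    assume "X \<in> carrier (enveloping_algebra K A)" "x \<in> carrier (enveloping_module A)"
      "y \<in> carrier (enveloping_module A)"
    then show "X \<odot>\<^bsub>enveloping_module A\<^esub> (x \<oplus>\<^bsub>enveloping_module A\<^esub> y)
        = X \<odot>\<^bsub>enveloping_module A\<^esub> x \<oplus>\<^bsub>enveloping_module A\<^esub> X \<odot>\<^bsub>enveloping_module A\<^esub> y"
      using carrE[of X] by (auto simp: smult lift_r)
  next
    fix x assume "x \<in> carrier (enveloping_module A)"
    moreover have "\<one>\<^bsub>enveloping_algebra K A\<^esub> = ?I +>\<^bsub>?F\<^esub> frag_of (\<one>\<^bsub>A\<^esub>, \<one>\<^bsub>A\<^esub>)"
      by (simp add: E FactRing_def) (simp add: free_pairs_def)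
    ultimately show "\<one>\<^bsub>enveloping_algebra K A\<^esub> \<odot>\<^bsub>enveloping_module A\<^esub> x = x"
      by (simp add: smult one)
  qed
qed

lemma unital_algebra_unital_homotope:
  assumes \<Delta>: "\<Delta> \<in> carrier A"
  shows "unital_algebra K (unital_homotope K A \<Delta>)"
proof -
  let ?B = "unital_homotope K A \<Delta>"
  note B = unital_homotope_def adjoin_unit_def
  have grp: "abelian_group ?B"
  proof (rule abelian_groupI)
    fix x assume "x \<in> carrier ?B"
    then show "\<exists>y\<in>carrier ?B. y \<oplus>\<^bsub>?B\<^esub> x = \<zero>\<^bsub>?B\<^esub>"
      by (intro bexI[of _ "(\<ominus>\<^bsub>K\<^esub> fst x, \<ominus>\<^bsub>A\<^esub> snd x)"]) (auto simp: B R.l_neg M.l_neg)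
  qed (auto simp: B R.a_ac M.a_ac)
  have "monoid ?B"
    by (rule monoidI)
      (use \<Delta> in \<open>auto simp: B R.m_assoc A.m_assoc A.l_distr A.r_distr smult_assoc_l smult_assoc_r
        smult_assoc1[symmetric] smult_r_distr smult_l_distr R.m_comm R.m_lcomm M.a_ac\<close>)
  then have "ring ?B"
    by (intro ringI grp)
      (use \<Delta> in \<open>auto simp: B R.l_distr R.r_distr A.l_distr A.r_distr smult_r_distr smult_l_distr M.a_ac\<close>)
  then show ?thesis
    by (intro unital_algebra.intro moduleI unital_algebra_axioms.intro R.is_cring grp)
      (use \<Delta> in \<open>auto simp: B R.l_distr R.r_distr R.m_assoc smult_r_distr smult_l_distr smult_assoc1[symmetric]
        smult_assoc_l smult_assoc_r R.m_lcomm R.m_comm A.m_assoc\<close>)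
qed

lemma ideal_homotope_ideal:
  assumes \<Delta>: "\<Delta> \<in> carrier A"
  shows "ideal (homotope_ideal K A) (unital_homotope K A \<Delta>)"
proof -
  let ?B = "unital_homotope K A \<Delta>"
  interpret B: unital_algebra K ?B by (rule unital_algebra_unital_homotope[OF \<Delta>])
  note B = unital_homotope_def adjoin_unit_def homotope_ideal_def
  have "subgroup (homotope_ideal K A) (add_monoid ?B)"
  proof (rule B.M.add.subgroupI)
    fix x assume "x \<in> homotope_ideal K A"
    then obtain a where a: "x = (\<zero>\<^bsub>K\<^esub>, a)" "a \<in> carrier A" by (auto simp: B)
    then have "\<ominus>\<^bsub>?B\<^esub> x = (\<zero>\<^bsub>K\<^esub>, \<ominus>\<^bsub>A\<^esub> a)"
      by (intro B.M.minus_equality) (auto simp: B M.l_neg)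
    then show "\<ominus>\<^bsub>?B\<^esub> x \<in> homotope_ideal K A" using a by (simp add: homotope_ideal_def)
  qed (auto simp: B)
  then show ?thesis
    by (rule idealI[OF B.A.ring_axioms]) (use \<Delta> in \<open>auto simp: B\<close>)
qed

end

lemma ideal_opposite: "ideal I R \<Longrightarrow> ideal I (opposite R)"
proof -
  assume "ideal I R"
  then interpret ideal I R .
  have "subgroup I (add_monoid (opposite R))"
    using a_subgroup by simp
  then show ?thesis
    by (rule idealI[OF ring_opposite[OF ring_axioms]]) (simp_all add: I_l_closed I_r_closed)
qed

lemma lmodule_ideal_lmodule:
  fixes R :: "('a, 'p) ring_scheme" (structure)
  assumes "ideal I R"
  shows "lmodule R (ideal_lmodule R I)"
proof -
  interpret ideal I R by fact
  have grp: "abelian_group (ideal_lmodule R I)"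
  proof (rule abelian_groupI)
    fix x assume "x \<in> carrier (ideal_lmodule R I)"
    then show "\<exists>y\<in>carrier (ideal_lmodule R I). y \<oplus>\<^bsub>ideal_lmodule R I\<^esub> x = \<zero>\<^bsub>ideal_lmodule R I\<^esub>"
      by (intro bexI[of _ "\<ominus> x"]) (auto simp: ideal_lmodule_def l_neg a_Hcarr)
  qed (auto simp: ideal_lmodule_def a_ac a_Hcarr)
  show ?thesis
    by (intro lmodule.intro lmodule_axioms.intro grp ring_axioms)
      (auto simp: ideal_lmodule_def I_l_closed l_distr r_distr m_assoc a_Hcarr)
qed

lemma lmodule_free_lmodule:
  fixes R :: "('r, 'p) ring_scheme" (structure) and S :: "'x set"
  assumes "ring R"
  shows "lmodule R (free_lmodule R S)"
proof -
  interpret ring R by fact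
  have range: "range f \<subseteq> carrier R \<longleftrightarrow> (\<forall>x. f x \<in> carrier R)" for f :: "'x \<Rightarrow> 'r" by auto
  have grp: "abelian_group (free_lmodule R S)"
  proof (rule abelian_groupI)
    fix f g assume "f \<in> carrier (free_lmodule R S)" "g \<in> carrier (free_lmodule R S)"
    moreover from this have "{x. f x \<oplus> g x \<noteq> \<zero>} \<subseteq> {x. f x \<noteq> \<zero>} \<union> {x. g x \<noteq> \<zero>}"
      by auto
    ultimately show "f \<oplus>\<^bsub>free_lmodule R S\<^esub> g \<in> carrier (free_lmodule R S)"
      unfolding free_lmodule_def range by (auto intro: finite_subset)
  next
    fix f assume "f \<in> carrier (free_lmodule R S)"
    moreover from this have "{x. \<ominus> f x \<noteq> \<zero>} \<subseteq> {x. f x \<noteq> \<zero>}"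
      by auto
    ultimately show "\<exists>g\<in>carrier (free_lmodule R S). g \<oplus>\<^bsub>free_lmodule R S\<^esub> f = \<zero>\<^bsub>free_lmodule R S\<^esub>"
      by (intro bexI[of _ "\<lambda>x. \<ominus> f x"])
        (auto simp: free_lmodule_def range l_neg intro: finite_subset)
  qed (auto simp: free_lmodule_def range a_ac)
  show ?thesis
  proof (intro lmodule.intro lmodule_axioms.intro grp ring_axioms)
    fix a f assume "a \<in> carrier R" "f \<in> carrier (free_lmodule R S)"
    moreover from this have "{x. a \<otimes> f x \<noteq> \<zero>} \<subseteq> {x. f x \<noteq> \<zero>}"
      by auto
    ultimately show "a \<odot>\<^bsub>free_lmodule R S\<^esub> f \<in> carrier (free_lmodule R S)"
      unfolding free_lmodule_def range by (auto intro: finite_subset)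
  qed (auto simp: free_lmodule_def range l_distr r_distr m_assoc)
qed

end

theory Submission
  imports Defs
begin

text \<open>Why \<open>E\<^sub>A\<close> is projective over \<open>E\<^sub>B\<close>: restricted to
  \<open>E\<^sub>B\<close> it is \<open>A\<^sub>\<Delta> \<otimes> A\<^sub>\<Delta>\<close>, with
  the left action on the first factor and the right action on the second, and the products of a left
  and a right dual basis of \<open>A\<^sub>\<Delta>\<close> form a dual basis of it. The locale
  \<open>tensor_product\<close> treats unital algebras only, so a tensor product of two ideals
  appears as the set of tensors in \<open>E\<^sub>B\<close> fixed by an idempotent
  \<open>\<rho> \<otimes> \<sigma>\<close>, where \<open>\<rho>\<close> and \<open>\<sigma>\<close>
  are K-linear projections of \<open>B\<close>. Intersections and kernels are then computed from
  commuting idempotents, and flatness never enters. A second obstacle is the notion of length, which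
  refers to resolutions over one fixed element type, while the horseshoe lemma produces modules over
  a product type. Two facts bridge this gap: a resolution over the fixed type always exists, as
  finite linear combinations can be encoded as terms, and any resolution with a zero term in degree
  n + 1, over whatever type, makes every other resolution split in degree n.\<close>

text \<open>Write \<open>E\<^sub>A\<close>, \<open>E\<^sub>B\<close> for the enveloping algebras. The ideal \<open>A\<^sub>\<Delta>\<close> of \<open>B\<close> is the bimodule \<open>A\<close>,
  restricted along two homomorphisms \<open>B \<rightarrow> A\<close>, \<open>(k, a) \<mapsto> k + a \<Delta>\<close> on the left and
  \<open>(k, a) \<mapsto> k + \<Delta> a\<close> on the right. As \<open>A\<^sub>\<Delta>\<close> is projective on both sides, \<open>E\<^sub>A\<close> is projective over \<open>E\<^sub>B\<close>,
  so a projective resolution of \<open>A\<close> over \<open>E\<^sub>A\<close> restricts to one of \<open>A\<^sub>\<Delta>\<close> over \<open>E\<^sub>B\<close> of the same length.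
  The quotient \<open>K = B / A\<^sub>\<Delta>\<close> has the one-sided resolutions \<open>A\<^sub>\<Delta> \<rightarrow> B\<close>, whose tensor product is a
  projective resolution of \<open>K\<close> over \<open>E\<^sub>B\<close> of length 2. The horseshoe lemma combines the two.
  Exactness of the tensor product comes from the \<open>K\<close>-linear splitting \<open>B = K \<oplus> A\<^sub>\<Delta>\<close>.\<close>

section \<open>Homomorphisms\<close>


lemma (in abelian_group)
  assumes "x \<in> carrier G"
  shows a_minus_self [simp]: "x \<ominus> x = \<zero>"
    and a_minus_zero [simp]: "x \<ominus> \<zero> = x"
    and eq_of_a_minus_eq_zero: "\<lbrakk>y \<in> carrier G; x \<ominus> y = \<zero>\<rbrakk> \<Longrightarrow> x = y"
  using assms by (auto simp: a_minus_def a_assoc l_neg r_neg dest: minus_equality)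

lemma (in abelian_group) a_inv_zero [simp]: "\<ominus> \<zero> = \<zero>"
  by (rule minus_equality) simp_all

lemma abelian_group_homI':
  assumes "abelian_group G" "abelian_group H"
    and "\<And>x. x \<in> carrier G \<Longrightarrow> h x \<in> carrier H"
    and "\<And>x y. \<lbrakk>x \<in> carrier G; y \<in> carrier G\<rbrakk> \<Longrightarrow> h (x \<oplus>\<^bsub>G\<^esub> y) = h x \<oplus>\<^bsub>H\<^esub> h y"
  shows "abelian_group_hom G H h"
  by (intro abelian_group_homI assms group_hom.intro group_hom_axioms.intro abelian_group.a_group)
    (use assms in \<open>auto intro!: homI\<close>)

lemma (in abelian_group_hom) hom_minus [simp]:
  "\<lbrakk>x \<in> carrier G; y \<in> carrier G\<rbrakk> \<Longrightarrow> h (x \<ominus>\<^bsub>G\<^esub> y) = h x \<ominus>\<^bsub>H\<^esub> h y"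
  by (simp add: a_minus_def)

lemma (in abelian_group_hom) hom_finsum:
  "f \<in> S \<rightarrow> carrier G \<Longrightarrow> h (\<Oplus>\<^bsub>G\<^esub>x\<in>S. f x) = (\<Oplus>\<^bsub>H\<^esub>x\<in>S. h (f x))"
proof (induction S rule: infinite_finite_induct)
  case (insert x S)
  then have "f x \<in> carrier G" "f \<in> S \<rightarrow> carrier G" by auto
  moreover from this have "(\<lambda>x. h (f x)) \<in> S \<rightarrow> carrier H" by (auto simp: Pi_iff)
  ultimately show ?case using insert by (simp add: G.finsum_closed)
qed simp_all

lemma lmodule_homI:
  assumes "\<And>x. x \<in> carrier M \<Longrightarrow> h x \<in> carrier N"
    and "\<And>x y. \<lbrakk>x \<in> carrier M; y \<in> carrier M\<rbrakk> \<Longrightarrow> h (x \<oplus>\<^bsub>M\<^esub> y) = h x \<oplus>\<^bsub>N\<^esub> h y"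
    and "\<And>a x. \<lbrakk>a \<in> carrier R; x \<in> carrier M\<rbrakk> \<Longrightarrow> h (a \<odot>\<^bsub>M\<^esub> x) = a \<odot>\<^bsub>N\<^esub> h x"
  shows "h \<in> lmodule_hom R M N"
  using assms by (auto simp: lmodule_hom_def)

lemma lmodule_homD:
  assumes "h \<in> lmodule_hom R M N"
  shows lmodule_hom_closed: "x \<in> carrier M \<Longrightarrow> h x \<in> carrier N"
    and lmodule_hom_add: "\<lbrakk>x \<in> carrier M; y \<in> carrier M\<rbrakk> \<Longrightarrow> h (x \<oplus>\<^bsub>M\<^esub> y) = h x \<oplus>\<^bsub>N\<^esub> h y"
    and lmodule_hom_smult: "\<lbrakk>a \<in> carrier R; x \<in> carrier M\<rbrakk> \<Longrightarrow> h (a \<odot>\<^bsub>M\<^esub> x) = a \<odot>\<^bsub>N\<^esub> h x"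
  using assms by (auto simp: lmodule_hom_def)

lemma lmodule_abelian_group: "lmodule R M \<Longrightarrow> abelian_group M"
  by (simp add: lmodule_def)

lemma lmodule_ring: "lmodule R M \<Longrightarrow> ring R"
  by (simp add: lmodule_def)

lemma lmodule_hom_abelian_group_hom:
  assumes "lmodule R M" "lmodule R N" "h \<in> lmodule_hom R M N"
  shows "abelian_group_hom M N h"
  by (rule abelian_group_homI') (use assms in \<open>auto simp: lmodule_abelian_group lmodule_homD\<close>)

lemma lmodule_hom_group:
  assumes "lmodule R M" "lmodule R N" "h \<in> lmodule_hom R M N"
  shows lmodule_hom_zero: "h \<zero>\<^bsub>M\<^esub> = \<zero>\<^bsub>N\<^esub>"
    and lmodule_hom_minus: "\<lbrakk>x \<in> carrier M; y \<in> carrier M\<rbrakk> \<Longrightarrow> h (x \<ominus>\<^bsub>M\<^esub> y) = h x \<ominus>\<^bsub>N\<^esub> h y"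
    and lmodule_hom_a_inv: "x \<in> carrier M \<Longrightarrow> h (\<ominus>\<^bsub>M\<^esub> x) = \<ominus>\<^bsub>N\<^esub> h x"
    and lmodule_hom_finsum: "f \<in> S \<rightarrow> carrier M \<Longrightarrow> h (\<Oplus>\<^bsub>M\<^esub>x\<in>S. f x) = (\<Oplus>\<^bsub>N\<^esub>x\<in>S. h (f x))"
proof -
  interpret abelian_group_hom M N h by (rule lmodule_hom_abelian_group_hom[OF assms])
  show "h \<zero>\<^bsub>M\<^esub> = \<zero>\<^bsub>N\<^esub>" by simp
  show "\<lbrakk>x \<in> carrier M; y \<in> carrier M\<rbrakk> \<Longrightarrow> h (x \<ominus>\<^bsub>M\<^esub> y) = h x \<ominus>\<^bsub>N\<^esub> h y" by simp
  show "x \<in> carrier M \<Longrightarrow> h (\<ominus>\<^bsub>M\<^esub> x) = \<ominus>\<^bsub>N\<^esub> h x" by simp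
  show "f \<in> S \<rightarrow> carrier M \<Longrightarrow> h (\<Oplus>\<^bsub>M\<^esub>x\<in>S. f x) = (\<Oplus>\<^bsub>N\<^esub>x\<in>S. h (f x))"
    by (rule hom_finsum)
qed

lemma lmodule_hom_id: "(\<lambda>x. x) \<in> lmodule_hom R M M"
  by (rule lmodule_homI) simp_all

lemma lmodule_hom_comp:
  "\<lbrakk>h \<in> lmodule_hom R M N; k \<in> lmodule_hom R N L\<rbrakk> \<Longrightarrow> (\<lambda>x. k (h x)) \<in> lmodule_hom R M L"
  by (auto simp: lmodule_hom_def Pi_iff)

lemma (in lmodule) smult_abelian_group_hom: "a \<in> carrier R \<Longrightarrow> abelian_group_hom M M ((\<odot>\<^bsub>M\<^esub>) a)"
  by (rule abelian_group_homI') (auto simp: smult_r_distr M.abelian_group_axioms)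

lemma (in lmodule) smult_right_group:
  assumes "a \<in> carrier R"
  shows smult_r_null [simp]: "a \<odot>\<^bsub>M\<^esub> \<zero>\<^bsub>M\<^esub> = \<zero>\<^bsub>M\<^esub>"
    and smult_r_minus: "x \<in> carrier M \<Longrightarrow> a \<odot>\<^bsub>M\<^esub> (\<ominus>\<^bsub>M\<^esub> x) = \<ominus>\<^bsub>M\<^esub> (a \<odot>\<^bsub>M\<^esub> x)"
    and finsum_smult_r: "f \<in> S \<rightarrow> carrier M \<Longrightarrow> a \<odot>\<^bsub>M\<^esub> (\<Oplus>\<^bsub>M\<^esub>x\<in>S. f x) = (\<Oplus>\<^bsub>M\<^esub>x\<in>S. a \<odot>\<^bsub>M\<^esub> f x)"
proof -
  interpret h: abelian_group_hom M M "(\<odot>\<^bsub>M\<^esub>) a" by (rule smult_abelian_group_hom[OF assms])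
  show "a \<odot>\<^bsub>M\<^esub> \<zero>\<^bsub>M\<^esub> = \<zero>\<^bsub>M\<^esub>" by simp
  show "x \<in> carrier M \<Longrightarrow> a \<odot>\<^bsub>M\<^esub> (\<ominus>\<^bsub>M\<^esub> x) = \<ominus>\<^bsub>M\<^esub> (a \<odot>\<^bsub>M\<^esub> x)" by simp
  show "f \<in> S \<rightarrow> carrier M \<Longrightarrow> a \<odot>\<^bsub>M\<^esub> (\<Oplus>\<^bsub>M\<^esub>x\<in>S. f x) = (\<Oplus>\<^bsub>M\<^esub>x\<in>S. a \<odot>\<^bsub>M\<^esub> f x)"
    by (rule h.hom_finsum)
qed

lemma (in lmodule) smult_abelian_group_hom_left:
  "x \<in> carrier M \<Longrightarrow> abelian_group_hom R M (\<lambda>a. a \<odot>\<^bsub>M\<^esub> x)"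
  by (rule abelian_group_homI') (auto simp: smult_l_distr R.is_abelian_group M.abelian_group_axioms)

lemma (in lmodule) smult_left_group:
  assumes "x \<in> carrier M"
  shows smult_l_null [simp]: "\<zero> \<odot>\<^bsub>M\<^esub> x = \<zero>\<^bsub>M\<^esub>"
    and smult_l_minus: "a \<in> carrier R \<Longrightarrow> (\<ominus> a) \<odot>\<^bsub>M\<^esub> x = \<ominus>\<^bsub>M\<^esub> (a \<odot>\<^bsub>M\<^esub> x)"
    and finsum_smult_l: "f \<in> S \<rightarrow> carrier R \<Longrightarrow> (\<Oplus>s\<in>S. f s) \<odot>\<^bsub>M\<^esub> x = (\<Oplus>\<^bsub>M\<^esub>s\<in>S. f s \<odot>\<^bsub>M\<^esub> x)"
proof -
  interpret h: abelian_group_hom R M "\<lambda>a. a \<odot>\<^bsub>M\<^esub> x" by (rule smult_abelian_group_hom_left[OF assms])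
  show "\<zero> \<odot>\<^bsub>M\<^esub> x = \<zero>\<^bsub>M\<^esub>" by simp
  show "a \<in> carrier R \<Longrightarrow> (\<ominus> a) \<odot>\<^bsub>M\<^esub> x = \<ominus>\<^bsub>M\<^esub> (a \<odot>\<^bsub>M\<^esub> x)" by simp
  show "f \<in> S \<rightarrow> carrier R \<Longrightarrow> (\<Oplus>s\<in>S. f s) \<odot>\<^bsub>M\<^esub> x = (\<Oplus>\<^bsub>M\<^esub>s\<in>S. f s \<odot>\<^bsub>M\<^esub> x)"
    by (rule h.hom_finsum)
qed

lemma lmodule_hom_combine:
  assumes "lmodule R N" "h \<in> lmodule_hom R M N" "k \<in> lmodule_hom R M N"
  shows lmodule_hom_plus: "(\<lambda>x. h x \<oplus>\<^bsub>N\<^esub> k x) \<in> lmodule_hom R M N"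
    and lmodule_hom_diff: "(\<lambda>x. h x \<ominus>\<^bsub>N\<^esub> k x) \<in> lmodule_hom R M N"
proof -
  interpret N: lmodule R N by fact
  note [simp] = lmodule_homD[OF assms(2)] lmodule_homD[OF assms(3)]
  show "(\<lambda>x. h x \<oplus>\<^bsub>N\<^esub> k x) \<in> lmodule_hom R M N"
    by (rule lmodule_homI) (auto simp: N.smult_r_distr N.M.a_ac)
  show "(\<lambda>x. h x \<ominus>\<^bsub>N\<^esub> k x) \<in> lmodule_hom R M N"
    by (rule lmodule_homI)
      (auto simp: a_minus_def N.smult_r_distr N.smult_r_minus N.M.a_ac N.M.minus_add)
qed

lemma lmodule_hom_uminus:
  assumes "lmodule R N" "h \<in> lmodule_hom R M N"
  shows "(\<lambda>x. \<ominus>\<^bsub>N\<^esub> h x) \<in> lmodule_hom R M N"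
proof -
  interpret N: lmodule R N by fact
  show ?thesis
    by (rule lmodule_homI)
      (auto simp: lmodule_homD[OF assms(2)] N.smult_r_minus N.M.minus_add N.M.a_ac)
qed

lemma lmodule_hom_0: "lmodule R N \<Longrightarrow> (\<lambda>x. \<zero>\<^bsub>N\<^esub>) \<in> lmodule_hom R M N"
proof -
  assume "lmodule R N"
  then interpret N: lmodule R N .
  show ?thesis by (rule lmodule_homI) auto
qed


section \<open>Submodules and direct sums\<close>

lemma ideal_lmodule_simps [simp]:
  "carrier (ideal_lmodule R I) = I" "zero (ideal_lmodule R I) = zero R" "add (ideal_lmodule R I) = add R"
  "smult (ideal_lmodule R I) = mult R"
  by (simp_all add: ideal_lmodule_def)

text \<open>Closure under negation comes from the scalars, as -x = (-1) x.\<close>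

lemma lmodule_submodule:
  fixes M :: "('r, 'm, 'q) module_scheme"
  assumes M: "lmodule R M"
    and S: "S \<subseteq> carrier M" "\<zero>\<^bsub>M\<^esub> \<in> S"
      "\<And>x y. \<lbrakk>x \<in> S; y \<in> S\<rbrakk> \<Longrightarrow> x \<oplus>\<^bsub>M\<^esub> y \<in> S"
      "\<And>a x. \<lbrakk>a \<in> carrier R; x \<in> S\<rbrakk> \<Longrightarrow> a \<odot>\<^bsub>M\<^esub> x \<in> S"
  shows "lmodule R (M\<lparr>carrier := S\<rparr>)"
proof -
  interpret lmodule R M by (rule M)
  have [simp]: "x \<in> S \<Longrightarrow> x \<in> carrier M" for x using S by auto
  have "abelian_group (M\<lparr>carrier := S\<rparr>)"
  proof (rule abelian_groupI)
    fix x assume "x \<in> carrier (M\<lparr>carrier := S\<rparr>)"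
    then show "\<exists>y\<in>carrier (M\<lparr>carrier := S\<rparr>). y \<oplus>\<^bsub>M\<lparr>carrier := S\<rparr>\<^esub> x = \<zero>\<^bsub>M\<lparr>carrier := S\<rparr>\<^esub>"
      using S(4)[of "\<ominus>\<^bsub>R\<^esub> \<one>\<^bsub>R\<^esub>" x]
      by (intro bexI[of _ "\<ominus>\<^bsub>M\<^esub> x"]) (auto simp: smult_l_minus M.l_neg)
  qed (use S in \<open>auto simp: M.a_ac\<close>)
  then show ?thesis
    by (intro lmodule.intro lmodule_axioms.intro R.ring_axioms)
      (use S in \<open>auto simp: smult_l_distr smult_r_distr smult_assoc1\<close>)
qed

definition direct_sum :: "('r, 'm, 'q) module_scheme \<Rightarrow> ('r, 'n, 's) module_scheme \<Rightarrow> ('r, 'm \<times> 'n) module"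
  where "direct_sum M N =
    \<lparr>carrier = carrier M \<times> carrier N, mult = undefined, one = undefined,
     zero = (\<zero>\<^bsub>M\<^esub>, \<zero>\<^bsub>N\<^esub>), add = (\<lambda>x y. (fst x \<oplus>\<^bsub>M\<^esub> fst y, snd x \<oplus>\<^bsub>N\<^esub> snd y)),
     smult = (\<lambda>a x. (a \<odot>\<^bsub>M\<^esub> fst x, a \<odot>\<^bsub>N\<^esub> snd x))\<rparr>"

lemma direct_sum_simps [simp]:
  "carrier (direct_sum M N) = carrier M \<times> carrier N"
  "zero (direct_sum M N) = (\<zero>\<^bsub>M\<^esub>, \<zero>\<^bsub>N\<^esub>)"
  "x \<oplus>\<^bsub>direct_sum M N\<^esub> y = (fst x \<oplus>\<^bsub>M\<^esub> fst y, snd x \<oplus>\<^bsub>N\<^esub> snd y)"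
  "a \<odot>\<^bsub>direct_sum M N\<^esub> x = (a \<odot>\<^bsub>M\<^esub> fst x, a \<odot>\<^bsub>N\<^esub> snd x)"
  by (simp_all add: direct_sum_def)

lemma lmodule_direct_sum:
  assumes "lmodule R M" "lmodule R N"
  shows "lmodule R (direct_sum M N)"
proof -
  interpret M: lmodule R M by fact
  interpret N: lmodule R N by fact
  have "abelian_group (direct_sum M N)"
  proof (rule abelian_groupI)
    fix x assume "x \<in> carrier (direct_sum M N)"
    then show "\<exists>y\<in>carrier (direct_sum M N). y \<oplus>\<^bsub>direct_sum M N\<^esub> x = \<zero>\<^bsub>direct_sum M N\<^esub>"
      by (intro bexI[of _ "(\<ominus>\<^bsub>M\<^esub> fst x, \<ominus>\<^bsub>N\<^esub> snd x)"]) (auto simp: M.M.l_neg N.M.l_neg)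
  qed (auto simp: M.M.a_ac N.M.a_ac)
  then show ?thesis
    by (intro lmodule.intro lmodule_axioms.intro M.R.ring_axioms)
      (auto simp: M.smult_l_distr M.smult_r_distr M.smult_assoc1 N.smult_l_distr N.smult_r_distr N.smult_assoc1)
qed

lemma direct_sum_homs:
  assumes "lmodule R M" "lmodule R N"
  shows direct_sum_hom_fst: "fst \<in> lmodule_hom R (direct_sum M N) M"
    and direct_sum_hom_snd: "snd \<in> lmodule_hom R (direct_sum M N) N"
    and direct_sum_hom_inl: "(\<lambda>x. (x, \<zero>\<^bsub>N\<^esub>)) \<in> lmodule_hom R M (direct_sum M N)"
    and direct_sum_hom_inr: "(\<lambda>y. (\<zero>\<^bsub>M\<^esub>, y)) \<in> lmodule_hom R N (direct_sum M N)"
proof -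
  interpret M: lmodule R M by fact
  interpret N: lmodule R N by fact
  show "fst \<in> lmodule_hom R (direct_sum M N) M" "snd \<in> lmodule_hom R (direct_sum M N) N"
    "(\<lambda>x. (x, \<zero>\<^bsub>N\<^esub>)) \<in> lmodule_hom R M (direct_sum M N)"
    "(\<lambda>y. (\<zero>\<^bsub>M\<^esub>, y)) \<in> lmodule_hom R N (direct_sum M N)"
    by (auto intro!: lmodule_homI)
qed

lemma direct_sum_hom_Pair:
  "\<lbrakk>h \<in> lmodule_hom R L M; k \<in> lmodule_hom R L N\<rbrakk> \<Longrightarrow> (\<lambda>x. (h x, k x)) \<in> lmodule_hom R L (direct_sum M N)"
  by (rule lmodule_homI) (auto simp: lmodule_homD)


section \<open>Free modules\<close>

lemma carrier_free_lmodule: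
  "f \<in> carrier (free_lmodule R X) \<longleftrightarrow>
    (\<forall>x. f x \<in> carrier R) \<and> finite {x. f x \<noteq> \<zero>\<^bsub>R\<^esub>} \<and> (\<forall>x. x \<notin> X \<longrightarrow> f x = \<zero>\<^bsub>R\<^esub>)"
  by (auto simp: free_lmodule_def)

lemma free_lmodule_simps [simp]:
  "zero (free_lmodule R X) = (\<lambda>x. \<zero>\<^bsub>R\<^esub>)"
  "f \<oplus>\<^bsub>free_lmodule R X\<^esub> g = (\<lambda>x. f x \<oplus>\<^bsub>R\<^esub> g x)"
  "a \<odot>\<^bsub>free_lmodule R X\<^esub> f = (\<lambda>x. a \<otimes>\<^bsub>R\<^esub> f x)"
  by (simp_all add: free_lmodule_def)

definition free_unit :: "('r, 'p) ring_scheme \<Rightarrow> 'x \<Rightarrow> 'x \<Rightarrow> 'r"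
  where "free_unit R x = (\<lambda>y. if y = x then \<one>\<^bsub>R\<^esub> else \<zero>\<^bsub>R\<^esub>)"

text \<open>The linear map that sends the basis element \<open>free_unit R x\<close> to
  \<open>b x\<close>. Since the sum runs over the support of \<open>f\<close>, no index set has to
  be mentioned and \<open>b\<close> matters only on that support.\<close>

definition free_lift ::
    "('r, 'p) ring_scheme \<Rightarrow> ('r, 'm, 'q) module_scheme \<Rightarrow> ('x \<Rightarrow> 'm) \<Rightarrow> ('x \<Rightarrow> 'r) \<Rightarrow> 'm"
  where "free_lift R M b f = (\<Oplus>\<^bsub>M\<^esub>x\<in>{x. f x \<noteq> \<zero>\<^bsub>R\<^esub>}. f x \<odot>\<^bsub>M\<^esub> b x)"

lemma free_unit_closed: "\<lbrakk>ring R; x \<in> X\<rbrakk> \<Longrightarrow> free_unit R x \<in> carrier (free_lmodule R X)"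
proof -
  assume "ring R" "x \<in> X"
  interpret ring R by fact
  have "finite {y. free_unit R x y \<noteq> \<zero>\<^bsub>R\<^esub>}"
    by (rule finite_subset[of _ "{x}"]) (auto simp: free_unit_def)
  then show ?thesis using \<open>x \<in> X\<close> by (auto simp: carrier_free_lmodule free_unit_def)
qed

context lmodule
begin

text \<open>The supports of \<open>f\<close>, \<open>g\<close> and their sum differ; identities
  between lifts are proved over a common finite set.\<close>

lemma free_lift_superset:
  assumes "finite T" "\<And>x. x \<notin> T \<Longrightarrow> f x = \<zero>" "\<And>x. x \<in> T \<Longrightarrow> f x \<in> carrier R"
    "\<And>x. x \<in> T \<Longrightarrow> b x \<in> carrier M"
  shows "free_lift R M b f = (\<Oplus>\<^bsub>M\<^esub>x\<in>T. f x \<odot>\<^bsub>M\<^esub> b x)"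
  unfolding free_lift_def
  by (rule M.add.finprod_mono_neutral_cong_left) (use assms in auto)

lemma free_lift_closed:
  assumes "b \<in> X \<rightarrow> carrier M" "f \<in> carrier (free_lmodule R X)"
  shows "free_lift R M b f \<in> carrier M"
  unfolding free_lift_def using assms by (intro M.finsum_closed) (auto simp: carrier_free_lmodule)

lemma free_lift_hom:
  assumes b: "b \<in> X \<rightarrow> carrier M"
  shows "free_lift R M b \<in> lmodule_hom R (free_lmodule R X) M"
proof (rule lmodule_homI)
  fix f g assume f: "f \<in> carrier (free_lmodule R X)" and g: "g \<in> carrier (free_lmodule R X)"
  let ?T = "{x. f x \<noteq> \<zero>} \<union> {x. g x \<noteq> \<zero>}"
  have T: "finite ?T" "x \<in> ?T \<Longrightarrow> b x \<in> carrier M" for x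
    using f g b by (auto simp: carrier_free_lmodule)
  have fg: "f x \<in> carrier R" "g x \<in> carrier R" for x
    using f g by (auto simp: carrier_free_lmodule)
  have "free_lift R M b (f \<oplus>\<^bsub>free_lmodule R X\<^esub> g) = (\<Oplus>\<^bsub>M\<^esub>x\<in>?T. (f x \<oplus> g x) \<odot>\<^bsub>M\<^esub> b x)"
    using free_lift_superset[of ?T "\<lambda>x. f x \<oplus> g x" b] T fg by auto
  also have "\<dots> = (\<Oplus>\<^bsub>M\<^esub>x\<in>?T. f x \<odot>\<^bsub>M\<^esub> b x \<oplus>\<^bsub>M\<^esub> g x \<odot>\<^bsub>M\<^esub> b x)"
    by (rule M.finsum_cong') (use T fg in \<open>auto simp: smult_l_distr\<close>)
  also have "\<dots> = (\<Oplus>\<^bsub>M\<^esub>x\<in>?T. f x \<odot>\<^bsub>M\<^esub> b x) \<oplus>\<^bsub>M\<^esub> (\<Oplus>\<^bsub>M\<^esub>x\<in>?T. g x \<odot>\<^bsub>M\<^esub> b x)"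
    by (rule M.finsum_addf) (use T fg in auto)
  also have "(\<Oplus>\<^bsub>M\<^esub>x\<in>?T. f x \<odot>\<^bsub>M\<^esub> b x) = free_lift R M b f"
    by (rule free_lift_superset[symmetric]) (use T fg in auto)
  also have "(\<Oplus>\<^bsub>M\<^esub>x\<in>?T. g x \<odot>\<^bsub>M\<^esub> b x) = free_lift R M b g"
    by (rule free_lift_superset[symmetric]) (use T fg in auto)
  finally show "free_lift R M b (f \<oplus>\<^bsub>free_lmodule R X\<^esub> g) = free_lift R M b f \<oplus>\<^bsub>M\<^esub> free_lift R M b g" .
next
  fix a f assume a: "a \<in> carrier R" and f: "f \<in> carrier (free_lmodule R X)"
  let ?T = "{x. f x \<noteq> \<zero>}"
  have T: "finite ?T" "x \<in> ?T \<Longrightarrow> b x \<in> carrier M" "f x \<in> carrier R" for x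
    using f b by (auto simp: carrier_free_lmodule)
  have "free_lift R M b (a \<odot>\<^bsub>free_lmodule R X\<^esub> f) = (\<Oplus>\<^bsub>M\<^esub>x\<in>?T. (a \<otimes> f x) \<odot>\<^bsub>M\<^esub> b x)"
    using free_lift_superset[of ?T "\<lambda>x. a \<otimes> f x" b] T a by auto
  also have "\<dots> = (\<Oplus>\<^bsub>M\<^esub>x\<in>?T. a \<odot>\<^bsub>M\<^esub> (f x \<odot>\<^bsub>M\<^esub> b x))"
    by (rule M.finsum_cong') (use T a in \<open>auto simp: smult_assoc1\<close>)
  also have "\<dots> = a \<odot>\<^bsub>M\<^esub> free_lift R M b f"
    unfolding free_lift_def by (rule finsum_smult_r[symmetric]) (use T a in auto)
  finally show "free_lift R M b (a \<odot>\<^bsub>free_lmodule R X\<^esub> f) = a \<odot>\<^bsub>M\<^esub> free_lift R M b f" .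
qed (rule free_lift_closed[OF b])

lemma free_lift_unit:
  assumes "b x \<in> carrier M"
  shows "free_lift R M b (free_unit R x) = b x"
  using free_lift_superset[of "{x}" "free_unit R x" b] assms by (auto simp: free_unit_def)

lemma free_lift_cong:
  assumes "f \<in> carrier (free_lmodule R X)" "b \<in> X \<rightarrow> carrier M" "\<And>x. x \<in> X \<Longrightarrow> c x = b x"
  shows "free_lift R M c f = free_lift R M b f"
proof -
  have "x \<in> X" "f x \<in> carrier R" if "f x \<noteq> \<zero>" for x
    using assms(1) that by (auto simp: carrier_free_lmodule)
  then show ?thesis
    unfolding free_lift_def by (intro M.finsum_cong') (use assms in \<open>auto simp: Pi_iff\<close>)
qed

lemma hom_free_lift:
  assumes N: "lmodule R N" and h: "h \<in> lmodule_hom R M N"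
    and b: "b \<in> X \<rightarrow> carrier M" and f: "f \<in> carrier (free_lmodule R X)"
  shows "h (free_lift R M b f) = free_lift R N (\<lambda>x. h (b x)) f"
proof -
  interpret N: lmodule R N by fact
  have fb: "f x \<noteq> \<zero> \<Longrightarrow> b x \<in> carrier M" "f x \<in> carrier R" for x
    using f b by (auto simp: carrier_free_lmodule)
  have "h (free_lift R M b f) = (\<Oplus>\<^bsub>N\<^esub>x\<in>{x. f x \<noteq> \<zero>}. h (f x \<odot>\<^bsub>M\<^esub> b x))"
    unfolding free_lift_def
    by (rule lmodule_hom_finsum[OF lmodule_axioms N h]) (use fb in auto)
  also have "\<dots> = free_lift R N (\<lambda>x. h (b x)) f"
    unfolding free_lift_def
    by (rule N.M.finsum_cong') (use fb in \<open>auto simp: lmodule_homD[OF h]\<close>)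
  finally show ?thesis .
qed

end

lemma free_lift_free_unit:
  assumes R: "ring R" and f: "f \<in> carrier (free_lmodule R X)"
  shows "free_lift R (free_lmodule R X) (free_unit R) f = f"
proof
  fix y
  interpret R: ring R by fact
  interpret F: lmodule R "free_lmodule R X" by (rule lmodule_free_lmodule[OF R])
  \<comment> \<open>Evaluation at \<open>y\<close> is additive, so it turns a finite sum of
    functions into a finite sum in the ring.\<close>
  interpret ev: abelian_group_hom "free_lmodule R X" R "\<lambda>f. f y"
    by (rule abelian_group_homI') (auto simp: F.abelian_group_axioms R.is_abelian_group carrier_free_lmodule)
  let ?T = "{x. f x \<noteq> \<zero>\<^bsub>R\<^esub>}"
  have T: "finite ?T" "f x \<in> carrier R" "x \<in> ?T \<Longrightarrow> x \<in> X" for x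
    using f by (auto simp: carrier_free_lmodule)
  have "free_lift R (free_lmodule R X) (free_unit R) f y
      = (\<Oplus>\<^bsub>R\<^esub>x\<in>?T. (f x \<odot>\<^bsub>free_lmodule R X\<^esub> free_unit R x) y)"
    unfolding free_lift_def
    by (rule ev.hom_finsum, rule Pi_I, rule F.smult_closed)
      (use T free_unit_closed[OF R, of _ X] in auto)
  also have "\<dots> = (\<Oplus>\<^bsub>R\<^esub>x\<in>?T. if y = x then f x else \<zero>\<^bsub>R\<^esub>)"
    by (rule R.finsum_cong') (use T in \<open>auto simp: free_unit_def\<close>)
  also have "\<dots> = f y"
  proof (cases "f y = \<zero>\<^bsub>R\<^esub>")
    case True
    have "(\<Oplus>\<^bsub>R\<^esub>x\<in>?T. if y = x then f x else \<zero>\<^bsub>R\<^esub>) = (\<Oplus>\<^bsub>R\<^esub>x\<in>?T. \<zero>\<^bsub>R\<^esub>)"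
      by (rule R.finsum_cong') (use True in auto)
    then show ?thesis by (simp add: True)
  next
    case False
    then show ?thesis using T by (intro R.finsum_singleton) auto
  qed
  finally show "free_lift R (free_lmodule R X) (free_unit R) f y = f y" .
qed

lemma hom_free_eq_free_lift:
  assumes N: "lmodule R N" and h: "h \<in> lmodule_hom R (free_lmodule R X) N"
    and f: "f \<in> carrier (free_lmodule R X)"
  shows "h f = free_lift R N (\<lambda>x. h (free_unit R x)) f"
  using lmodule.hom_free_lift[OF lmodule_free_lmodule[OF lmodule_ring[OF N]] N h _ f, of "free_unit R"]
    free_lift_free_unit[OF lmodule_ring[OF N] f] free_unit_closed[OF lmodule_ring[OF N], of _ X]
  by (simp add: Pi_iff)


section \<open>Projective modules\<close>

lemma projective_lmoduleD: "projective_lmodule R P \<Longrightarrow> lmodule R P"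
  by (simp add: projective_lmodule_def)

text \<open>The dual basis form of projectivity: the projection from the free module is replaced by
  the images \<open>b\<close> of the basis elements, and \<open>i\<close> gives the coordinates.
  Later constructions combine such bases instead of splittings.\<close>

lemma projective_lmoduleE:
  fixes P :: "('r, 'm, 'q) module_scheme"
  assumes "projective_lmodule R P"
  obtains X :: "'m set" and i b where "i \<in> lmodule_hom R P (free_lmodule R X)" "b \<in> X \<rightarrow> carrier P"
    "\<And>x. x \<in> carrier P \<Longrightarrow> free_lift R P b (i x) = x"
proof -
  obtain X :: "'m set" and i p where i: "i \<in> lmodule_hom R P (free_lmodule R X)"
    and p: "p \<in> lmodule_hom R (free_lmodule R X) P" and ip: "\<forall>x\<in>carrier P. p (i x) = x"
    using assms by (auto simp: projective_lmodule_def)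
  have P: "lmodule R P" using assms by (rule projective_lmoduleD)
  show ?thesis
  proof (rule that[of i X "\<lambda>x. p (free_unit R x)"])
    show "i \<in> lmodule_hom R P (free_lmodule R X)" by (rule i)
    show "(\<lambda>x. p (free_unit R x)) \<in> X \<rightarrow> carrier P"
      by (intro Pi_I lmodule_hom_closed[OF p] free_unit_closed[OF lmodule_ring[OF P]])
    fix x assume x: "x \<in> carrier P"
    show "free_lift R P (\<lambda>x. p (free_unit R x)) (i x) = x"
      using hom_free_eq_free_lift[OF P p lmodule_hom_closed[OF i x]] ip x by simp
  qed
qed

text \<open>The index set \<open>X\<close> of a dual basis may have any type: it is moved into \<open>P\<close> along \<open>b\<close>.\<close>

lemma projective_lmoduleI:
  assumes P: "lmodule R P" and i: "i \<in> lmodule_hom R P (free_lmodule R X)" and b: "b \<in> X \<rightarrow> carrier P"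
    and ib: "\<And>x. x \<in> carrier P \<Longrightarrow> free_lift R P b (i x) = x"
  shows "projective_lmodule R P"
proof -
  interpret P: lmodule R P by fact
  let ?F = "free_lmodule R (carrier P)"
  interpret F: lmodule R ?F by (rule lmodule_free_lmodule[OF P.R.ring_axioms])
  let ?s = "free_lift R ?F (\<lambda>x. free_unit R (b x))" and ?c = "free_lift R P (\<lambda>x. x)"
  have ub: "(\<lambda>x. free_unit R (b x)) \<in> X \<rightarrow> carrier ?F"
    by (intro Pi_I free_unit_closed[OF P.R.ring_axioms]) (use b in auto)
  have c: "?c \<in> lmodule_hom R ?F P"
    by (rule P.free_lift_hom) auto
  have "?c (?s (i x)) = x" if x: "x \<in> carrier P" for x
  proof -
    have ix: "i x \<in> carrier (free_lmodule R X)" by (rule lmodule_hom_closed[OF i x])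
    have "?c (?s (i x)) = free_lift R P (\<lambda>x. ?c (free_unit R (b x))) (i x)"
      by (rule F.hom_free_lift[OF P c ub ix])
    also have "\<dots> = free_lift R P b (i x)"
      by (rule P.free_lift_cong[OF ix b]) (use b in \<open>auto simp: P.free_lift_unit Pi_iff\<close>)
    finally show ?thesis using ib[OF x] by simp
  qed
  then show ?thesis
    unfolding projective_lmodule_def
    using P c lmodule_hom_comp[OF i F.free_lift_hom[OF ub]] by blast
qed

text \<open>Surjectivity of \<open>\<psi>\<close> is weakened to a condition on images. Thus
  \<open>\<psi>\<close> may be a differential and \<open>\<alpha>\<close> a map into its image, and
  no kernel has to be turned into a module first. It is enough to lift the images of the dual
  basis.\<close>

lemma projective_lmodule_lift:
  fixes P :: "('r, 'm, 'q) module_scheme"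
  assumes P: "projective_lmodule R P" and N: "lmodule R N" and Q: "lmodule R Q"
    and \<alpha>: "\<alpha> \<in> lmodule_hom R P N" and \<psi>: "\<psi> \<in> lmodule_hom R Q N"
    and im: "\<And>x. x \<in> carrier P \<Longrightarrow> \<alpha> x \<in> \<psi> ` carrier Q"
  shows "\<exists>\<chi>\<in>lmodule_hom R P Q. \<forall>x\<in>carrier P. \<psi> (\<chi> x) = \<alpha> x"
proof -
  interpret P: lmodule R P by (rule projective_lmoduleD[OF P])
  interpret Q: lmodule R Q by fact
  interpret N: lmodule R N by fact
  obtain X :: "'m set" and i b where i: "i \<in> lmodule_hom R P (free_lmodule R X)" and b: "b \<in> X \<rightarrow> carrier P"
    and ib: "\<And>x. x \<in> carrier P \<Longrightarrow> free_lift R P b (i x) = x"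
    by (rule projective_lmoduleE[OF P]) (rule that)
  have "\<forall>x\<in>X. \<exists>q\<in>carrier Q. \<psi> q = \<alpha> (b x)"
  proof
    fix x assume "x \<in> X"
    then have "\<alpha> (b x) \<in> \<psi> ` carrier Q" using im b by blast
    then show "\<exists>q\<in>carrier Q. \<psi> q = \<alpha> (b x)" by auto
  qed
  then obtain q where q: "\<And>x. x \<in> X \<Longrightarrow> q x \<in> carrier Q \<and> \<psi> (q x) = \<alpha> (b x)"
    by metis
  have q': "q \<in> X \<rightarrow> carrier Q" using q by auto
  show ?thesis
  proof (intro bexI ballI)
    show "(\<lambda>x. free_lift R Q q (i x)) \<in> lmodule_hom R P Q"
      by (rule lmodule_hom_comp[OF i Q.free_lift_hom[OF q']])
    fix x assume x: "x \<in> carrier P"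
    have ix: "i x \<in> carrier (free_lmodule R X)" by (rule lmodule_hom_closed[OF i x])
    have "\<psi> (free_lift R Q q (i x)) = free_lift R N (\<lambda>x. \<psi> (q x)) (i x)"
      by (rule Q.hom_free_lift[OF N \<psi> q' ix])
    also have "\<dots> = free_lift R N (\<lambda>x. \<alpha> (b x)) (i x)"
      by (rule N.free_lift_cong[OF ix]) (use b q in \<open>auto simp: lmodule_homD[OF \<alpha>] Pi_iff\<close>)
    also have "\<dots> = \<alpha> (free_lift R P b (i x))"
      by (rule P.hom_free_lift[OF N \<alpha> b ix, symmetric])
    finally show "\<psi> (free_lift R Q q (i x)) = \<alpha> x" using ib[OF x] by simp
  qed
qed

lemma projective_lmodule_retract:
  fixes N :: "('r, 'n, 's) module_scheme"
  assumes M: "lmodule R M" and N: "projective_lmodule R N"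
    and u: "u \<in> lmodule_hom R M N" and v: "v \<in> lmodule_hom R N M"
    and vu: "\<And>x. x \<in> carrier M \<Longrightarrow> v (u x) = x"
  shows "projective_lmodule R M"
proof -
  interpret N: lmodule R N by (rule projective_lmoduleD[OF N])
  obtain X :: "'n set" and i b where i: "i \<in> lmodule_hom R N (free_lmodule R X)" and b: "b \<in> X \<rightarrow> carrier N"
    and ib: "\<And>x. x \<in> carrier N \<Longrightarrow> free_lift R N b (i x) = x"
    by (rule projective_lmoduleE[OF N]) (rule that)
  show ?thesis
  proof (rule projective_lmoduleI[OF M lmodule_hom_comp[OF u i]])
    show "(\<lambda>x. v (b x)) \<in> X \<rightarrow> carrier M" 
      by (intro Pi_I lmodule_hom_closed[OF v]) (use b in auto)
    fix x assume x: "x \<in> carrier M"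
    then have "free_lift R M (\<lambda>x. v (b x)) (i (u x)) = v (free_lift R N b (i (u x)))"
      using u i by (intro N.hom_free_lift[OF M v b, symmetric]) (auto dest: lmodule_hom_closed)
    then show "free_lift R M (\<lambda>x. v (b x)) (i (u x)) = x"
      using ib vu x lmodule_hom_closed[OF u x] by simp
  qed
qed

lemma projective_free_lmodule:
  assumes R: "ring R"
  shows "projective_lmodule R (free_lmodule R X)"
  by (rule projective_lmoduleI[OF lmodule_free_lmodule[OF R] lmodule_hom_id, of "free_unit R"])
    (auto simp: free_unit_closed[OF R] free_lift_free_unit[OF R])

lemma projective_regular_lmodule:
  assumes R: "ring R"
  shows "projective_lmodule R (ideal_lmodule R (carrier R))"
proof (rule projective_lmodule_retract[OF _ projective_free_lmodule[OF R, of "{()}"]])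
  interpret ring R by fact
  show "lmodule R (ideal_lmodule R (carrier R))"
    by (rule lmodule_ideal_lmodule) (rule oneideal)
  show "(\<lambda>r _. r) \<in> lmodule_hom R (ideal_lmodule R (carrier R)) (free_lmodule R {()})"
    by (rule lmodule_homI) (auto simp: carrier_free_lmodule ideal_lmodule_def)
  show "(\<lambda>f. f ()) \<in> lmodule_hom R (free_lmodule R {()}) (ideal_lmodule R (carrier R))"
    by (rule lmodule_homI) (auto simp: carrier_free_lmodule ideal_lmodule_def)
qed simp

text \<open>The free module on all elements of the sum covers it. The inclusions of the two
  projective summands lift along this cover, and the sum of the lifts is a section.\<close>

lemma projective_direct_sum:
  fixes M :: "('r, 'm, 'q) module_scheme" and N :: "('r, 'n, 's) module_scheme"
  assumes M: "projective_lmodule R M" and N: "projective_lmodule R N"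
  shows "projective_lmodule R (direct_sum M N)"
proof -
  let ?D = "direct_sum M N" and ?F = "free_lmodule R (carrier M \<times> carrier N)"
  let ?c = "free_lift R ?D (\<lambda>x. x)"
  have lM: "lmodule R M" and lN: "lmodule R N"
    using M N by (auto dest: projective_lmoduleD)
  then interpret D: lmodule R ?D by (rule lmodule_direct_sum)
  interpret M: lmodule R M by (rule lM)
  interpret N: lmodule R N by (rule lN)
  interpret F: lmodule R ?F by (rule lmodule_free_lmodule[OF D.R.ring_axioms])
  have c: "?c \<in> lmodule_hom R ?F ?D"
    by (rule D.free_lift_hom) auto
  have surj: "x \<in> ?c ` carrier ?F" if "x \<in> carrier ?D" for x
    using that free_unit_closed[OF D.R.ring_axioms, of x "carrier M \<times> carrier N"] D.free_lift_unit[of "\<lambda>x. x" x]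
    by (metis direct_sum_simps(1) image_eqI)
  obtain s where s: "s \<in> lmodule_hom R M ?F" "\<forall>x\<in>carrier M. ?c (s x) = (x, \<zero>\<^bsub>N\<^esub>)"
    using projective_lmodule_lift[OF M D.lmodule_axioms F.lmodule_axioms direct_sum_hom_inl[OF lM lN] c] surj
    by auto
  obtain t where t: "t \<in> lmodule_hom R N ?F" "\<forall>x\<in>carrier N. ?c (t x) = (\<zero>\<^bsub>M\<^esub>, x)"
    using projective_lmodule_lift[OF N D.lmodule_axioms F.lmodule_axioms direct_sum_hom_inr[OF lM lN] c] surj
    by auto
  show ?thesis
  proof (rule projective_lmodule_retract[OF D.lmodule_axioms projective_free_lmodule[OF D.R.ring_axioms] _ c])
    show "(\<lambda>x. s (fst x) \<oplus>\<^bsub>?F\<^esub> t (snd x)) \<in> lmodule_hom R ?D ?F"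
      using lmodule_hom_plus[OF F.lmodule_axioms lmodule_hom_comp[OF direct_sum_hom_fst[OF lM lN] s(1)]
          lmodule_hom_comp[OF direct_sum_hom_snd[OF lM lN] t(1)]] .
    fix x assume x: "x \<in> carrier ?D"
    then show "?c (s (fst x) \<oplus>\<^bsub>?F\<^esub> t (snd x)) = x"
      using s t lmodule_hom_add[OF c lmodule_hom_closed[OF s(1)] lmodule_hom_closed[OF t(1)]]
      by (auto simp del: free_lmodule_simps)
  qed
qed

lemma projective_zero_lmodule:
  assumes M: "lmodule R M" and zero: "carrier M = {\<zero>\<^bsub>M\<^esub>}"
  shows "projective_lmodule R M"
proof -
  interpret lmodule R M by (rule M)
  have F: "lmodule R (free_lmodule R ({} :: unit set))"
    by (rule lmodule_free_lmodule[OF R.ring_axioms])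
  show ?thesis
    by (rule projective_lmodule_retract[OF M projective_free_lmodule[OF R.ring_axioms] lmodule_hom_0[OF F] lmodule_hom_0[OF M]])
      (use zero in auto)
qed


section \<open>Projective resolutions\<close>

lemma projective_resolutionD:
  assumes "projective_resolution R M P d e"
  shows projective_resolution_projective: "projective_lmodule R (P i)"
    and projective_resolution_lmodule: "lmodule R (P i)"
    and projective_resolution_augmentation: "e \<in> lmodule_hom R (P 0) M"
    and projective_resolution_differential: "d i \<in> lmodule_hom R (P (Suc i)) (P i)"
    and projective_resolution_surj: "e ` carrier (P 0) = carrier M"
    and projective_resolution_exact_0: "d 0 ` carrier (P (Suc 0)) = {x \<in> carrier (P 0). e x = \<zero>\<^bsub>M\<^esub>}"
    and projective_resolution_exact_Suc:
      "d (Suc i) ` carrier (P (Suc (Suc i))) = {x \<in> carrier (P (Suc i)). d i x = \<zero>\<^bsub>P i\<^esub>}"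
  using assms by (auto simp: projective_resolution_def dest: projective_lmoduleD)

lemma projective_resolution_comp_zero:
  assumes "projective_resolution R M P d e"
  shows projective_resolution_comp_zero_0: "x \<in> carrier (P (Suc 0)) \<Longrightarrow> e (d 0 x) = \<zero>\<^bsub>M\<^esub>"
    and projective_resolution_comp_zero_Suc:
      "x \<in> carrier (P (Suc (Suc i))) \<Longrightarrow> d i (d (Suc i) x) = \<zero>\<^bsub>P i\<^esub>"
  using projective_resolution_exact_0[OF assms] projective_resolution_exact_Suc[OF assms, of i] by blast+

section \<open>Comparison maps and homotopies\<close>

text \<open>The comparison theorem. Of \<open>X\<close> only a complex of projectives is required,
  neither exact nor with \<open>\<phi>\<close> onto; the horseshoe lemma applies it to a shifted
  complex of this kind.\<close>

lemma chain_map_lift: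
  fixes X :: "nat \<Rightarrow> ('r, 'x) module" and Y :: "nat \<Rightarrow> ('r, 'y) module"
  assumes M: "lmodule R M"
    and X: "\<And>i. projective_lmodule R (X i)"
    and dX: "\<And>i. dX i \<in> lmodule_hom R (X (Suc i)) (X i)"
    and dX2: "\<And>i x. x \<in> carrier (X (Suc (Suc i))) \<Longrightarrow> dX i (dX (Suc i) x) = \<zero>\<^bsub>X i\<^esub>"
    and \<phi>: "\<phi> \<in> lmodule_hom R (X 0) M"
    and \<phi>dX: "\<And>x. x \<in> carrier (X (Suc 0)) \<Longrightarrow> \<phi> (dX 0 x) = \<zero>\<^bsub>M\<^esub>"
    and Y: "projective_resolution R M Y dY eY"
  obtains f where "\<And>i. f i \<in> lmodule_hom R (X i) (Y i)"
    "\<And>x. x \<in> carrier (X 0) \<Longrightarrow> eY (f 0 x) = \<phi> x"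
    "\<And>i x. x \<in> carrier (X (Suc i)) \<Longrightarrow> dY i (f (Suc i) x) = f i (dX i x)"
proof -
  note lX = projective_lmoduleD[OF X]
  note lY = projective_resolution_lmodule[OF Y]
  \<comment> \<open>The last conjunct prepares the next degree: it is the image condition under
    which \<open>f\<close> composed with \<open>dX n\<close> lifts along
    \<open>dY n\<close>.\<close>
  let ?P = "\<lambda>n f. f \<in> lmodule_hom R (X n) (Y n) \<and> (n = 0 \<longrightarrow> (\<forall>x\<in>carrier (X 0). eY (f x) = \<phi> x)) \<and>
    (\<forall>x\<in>carrier (X (Suc n)). f (dX n x) \<in> dY n ` carrier (Y (Suc n)))"
  let ?Q = "\<lambda>n f f'. \<forall>x\<in>carrier (X (Suc n)). dY n (f' x) = f (dX n x)"
  have "\<exists>f. \<forall>n. ?P n (f n) \<and> ?Q n (f n) (f (Suc n))"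
  proof (rule dependent_nat_choice[of ?P ?Q])
    obtain f where f: "f \<in> lmodule_hom R (X 0) (Y 0)" "\<forall>x\<in>carrier (X 0). eY (f x) = \<phi> x"
      using projective_lmodule_lift[OF X M lY \<phi> projective_resolution_augmentation[OF Y]]
        lmodule_hom_closed[OF \<phi>] projective_resolution_surj[OF Y] by blast
    have "f (dX 0 x) \<in> dY 0 ` carrier (Y (Suc 0))" if x: "x \<in> carrier (X (Suc 0))" for x
      using f \<phi>dX[OF x] lmodule_hom_closed[OF dX x] lmodule_hom_closed[OF f(1)]
      by (simp add: projective_resolution_exact_0[OF Y])
    then show "\<exists>f. ?P 0 f" using f by blast
  next
    fix f n assume f: "?P n f"
    have "(\<lambda>x. f (dX n x)) \<in> lmodule_hom R (X (Suc n)) (Y n)"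
      using f dX by (blast intro: lmodule_hom_comp)
    then obtain f' where f': "f' \<in> lmodule_hom R (X (Suc n)) (Y (Suc n))" "?Q n f f'"
      using projective_lmodule_lift[OF X lY lY _ projective_resolution_differential[OF Y]] f by blast
    have "f' (dX (Suc n) x) \<in> dY (Suc n) ` carrier (Y (Suc (Suc n)))"
      if x: "x \<in> carrier (X (Suc (Suc n)))" for x
    proof -
      have x': "dX (Suc n) x \<in> carrier (X (Suc n))" by (rule lmodule_hom_closed[OF dX x])
      then have "dY n (f' (dX (Suc n) x)) = f \<zero>\<^bsub>X n\<^esub>" using f'(2) dX2[OF x] by simp
      also have "\<dots> = \<zero>\<^bsub>Y n\<^esub>" using f lmodule_hom_zero[OF lX lY] by blast
      finally show ?thesis
        using lmodule_hom_closed[OF f'(1) x'] by (simp add: projective_resolution_exact_Suc[OF Y])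
    qed
    then show "\<exists>f'. ?P (Suc n) f' \<and> ?Q n f f'" using f' by blast
  qed
  then obtain f where f: "\<And>n. ?P n (f n) \<and> ?Q n (f n) (f (Suc n))" by blast
  show ?thesis by (rule that[of f]) (use f in auto)
qed

text \<open>A chain endomorphism over the zero map of \<open>M\<close> is null homotopic: by the
  homotopy equation one degree below, u - h d takes values in cycles, hence in boundaries, and the
  next \<open>h\<close> is a lift of it along \<open>d\<close>.\<close>

lemma null_homotopy:
  fixes F :: "nat \<Rightarrow> ('r, 'u) module"
  assumes M: "lmodule R M" and F: "projective_resolution R M F d e"
    and u: "\<And>i. u i \<in> lmodule_hom R (F i) (F i)"
    and eu: "\<And>x. x \<in> carrier (F 0) \<Longrightarrow> e (u 0 x) = \<zero>\<^bsub>M\<^esub>"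
    and du: "\<And>i x. x \<in> carrier (F (Suc i)) \<Longrightarrow> d i (u (Suc i) x) = u i (d i x)"
  obtains h where "\<And>i. h i \<in> lmodule_hom R (F i) (F (Suc i))"
    "\<And>i x. x \<in> carrier (F (Suc i)) \<Longrightarrow> d (Suc i) (h (Suc i) x) = u (Suc i) x \<ominus>\<^bsub>F (Suc i)\<^esub> h i (d i x)"
proof -
  note lF = projective_resolution_lmodule[OF F]
  note pF = projective_resolution_projective[OF F]
  note d = projective_resolution_differential[OF F]
  \<comment> \<open>The homotopy equation in degree n, evaluated on boundaries, where its term h d
    vanishes. In this form it reads the same in degree 0, where there is no earlier
    \<open>h\<close>.\<close>
  let ?P = "\<lambda>n h. h \<in> lmodule_hom R (F n) (F (Suc n)) \<and>
    (\<forall>x\<in>carrier (F (Suc n)). d n (h (d n x)) = u n (d n x))"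
  let ?Q = "\<lambda>n h h'. \<forall>x\<in>carrier (F (Suc n)). d (Suc n) (h' x) = u (Suc n) x \<ominus>\<^bsub>F (Suc n)\<^esub> h (d n x)"
  have "\<exists>h. \<forall>n. ?P n (h n) \<and> ?Q n (h n) (h (Suc n))"
  proof (rule dependent_nat_choice[of ?P ?Q])
    have "u 0 x \<in> d 0 ` carrier (F (Suc 0))" if "x \<in> carrier (F 0)" for x
      using eu[OF that] lmodule_hom_closed[OF u that] by (simp add: projective_resolution_exact_0[OF F])
    then obtain h where h: "h \<in> lmodule_hom R (F 0) (F (Suc 0))" "\<forall>x\<in>carrier (F 0). d 0 (h x) = u 0 x"
      using projective_lmodule_lift[OF pF lF lF u d] by blast
    then show "\<exists>h. ?P 0 h" using lmodule_hom_closed[OF d] by blast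
  next
    fix h n assume h: "?P n h"
    interpret N: lmodule R "F n" by (rule lF)
    interpret S: lmodule R "F (Suc n)" by (rule lF)
    have hd: "(\<lambda>x. h (d n x)) \<in> lmodule_hom R (F (Suc n)) (F (Suc n))"
      using h d by (blast intro: lmodule_hom_comp)
    have diff: "(\<lambda>x. u (Suc n) x \<ominus>\<^bsub>F (Suc n)\<^esub> h (d n x)) \<in> lmodule_hom R (F (Suc n)) (F (Suc n))"
      by (rule lmodule_hom_diff[OF lF u hd])
    have "u (Suc n) x \<ominus>\<^bsub>F (Suc n)\<^esub> h (d n x) \<in> d (Suc n) ` carrier (F (Suc (Suc n)))"
      if x: "x \<in> carrier (F (Suc n))" for x
    proof -
      have "d n (u (Suc n) x \<ominus>\<^bsub>F (Suc n)\<^esub> h (d n x)) = d n (u (Suc n) x) \<ominus>\<^bsub>F n\<^esub> d n (h (d n x))"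
        by (rule lmodule_hom_minus[OF lF lF d lmodule_hom_closed[OF u x] lmodule_hom_closed[OF hd x]])
      also have "\<dots> = \<zero>\<^bsub>F n\<^esub>"
        using h x lmodule_hom_closed[OF u lmodule_hom_closed[OF d x]] by (simp add: du[OF x] a_minus_def N.M.r_neg)
      finally show ?thesis
        using lmodule_hom_closed[OF diff x] by (simp add: projective_resolution_exact_Suc[OF F])
    qed
    then obtain h' where h': "h' \<in> lmodule_hom R (F (Suc n)) (F (Suc (Suc n)))" "?Q n h h'"
      using projective_lmodule_lift[OF pF lF lF diff d] by blast
    have "d (Suc n) (h' (d (Suc n) x)) = u (Suc n) (d (Suc n) x)"
      if x: "x \<in> carrier (F (Suc (Suc n)))" for x
    proof -
      have x': "d (Suc n) x \<in> carrier (F (Suc n))" by (rule lmodule_hom_closed[OF d x])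
      have "h (d n (d (Suc n) x)) = \<zero>\<^bsub>F (Suc n)\<^esub>"
        using h lmodule_hom_zero[OF lF lF] by (simp add: projective_resolution_comp_zero_Suc[OF F x])
      then show ?thesis
        using h'(2) x' lmodule_hom_closed[OF u x'] by (simp add: a_minus_def)
    qed
    then show "\<exists>h'. ?P (Suc n) h' \<and> ?Q n h h'" using h' by blast
  qed
  then obtain h where h: "\<And>n. ?P n (h n) \<and> ?Q n (h n) (h (Suc n))" by blast
  show ?thesis by (rule that[of h]) (use h in auto)
qed

text \<open>If \<open>h\<close> splits \<open>d n\<close>, then \<open>d n \<circ> h\<close> is an idempotent endomorphism of \<open>F n\<close>, and its kernel is
  a complement of the image of \<open>d n\<close>; it replaces \<open>F n\<close>.\<close>

lemma projective_resolution_truncate: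
  fixes F :: "nat \<Rightarrow> ('r, 'u) module"
  assumes M: "lmodule R M" and F: "projective_resolution R M F d e"
    and h: "h \<in> lmodule_hom R (F n) (F (Suc n))"
    and split: "\<And>x. x \<in> carrier (F (Suc n)) \<Longrightarrow> d n (h (d n x)) = d n x"
  shows "\<exists>P. projective_resolution R M P d e \<and> (\<forall>i>n. carrier (P i) = {\<zero>\<^bsub>P i\<^esub>})"
proof -
  note lF = projective_resolution_lmodule[OF F]
  note d = projective_resolution_differential[OF F]
  note e = projective_resolution_augmentation[OF F]
  define S where "S i = (if i < n then carrier (F i)
    else if i = n then {x \<in> carrier (F n). d n (h x) = \<zero>\<^bsub>F n\<^esub>} else {\<zero>\<^bsub>F i\<^esub>})" for i
  define P where "P i = (F i)\<lparr>carrier := S i\<rparr>" for i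
  have [simp]: "carrier (P i) = S i" "zero (P i) = zero (F i)" "add (P i) = add (F i)"
    "smult (P i) = smult (F i)" for i by (simp_all add: P_def)
  interpret N: lmodule R "F n" by (rule lF)
  have dh: "(\<lambda>x. d n (h x)) \<in> lmodule_hom R (F n) (F n)" by (rule lmodule_hom_comp[OF h d])
  note dh_simps = lmodule_homD[OF dh] lmodule_hom_zero[OF lF lF dh] lmodule_hom_minus[OF lF lF dh]
  have S_sub: "S i \<subseteq> carrier (F i)" for i
    using lmodule.axioms(2)[OF lF, of i] by (auto simp: S_def abelian_group_def abelian_monoid.zero_closed)
  have lP: "lmodule R (P i)" for i
  proof -
    interpret I: lmodule R "F i" by (rule lF)
    show ?thesis
      unfolding P_def by (rule lmodule_submodule[OF lF S_sub]) (auto simp: S_def dh_simps)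
  qed
  \<comment> \<open>By \<open>split\<close>, d h is idempotent; \<open>?r\<close> is the
    complementary idempotent, which projects \<open>F n\<close> onto the new module in degree
    n.\<close>
  let ?r = "\<lambda>x. x \<ominus>\<^bsub>F n\<^esub> d n (h x)"
  have r: "?r \<in> lmodule_hom R (F n) (F n)"
    by (rule lmodule_hom_diff[OF lF lmodule_hom_id dh])
  have r_S: "?r x \<in> S n" if x: "x \<in> carrier (F n)" for x
  proof -
    have "d n (h (?r x)) = d n (h x) \<ominus>\<^bsub>F n\<^esub> d n (h (d n (h x)))"
      using x lmodule_hom_closed[OF dh x] by (rule lmodule_hom_minus[OF lF lF dh])
    then show ?thesis
      using lmodule_hom_closed[OF dh x] lmodule_hom_closed[OF r x] split[OF lmodule_hom_closed[OF h x]]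
      by (simp add: S_def a_minus_def N.M.r_neg)
  qed
  have r_id: "?r x = x" if "x \<in> S n" for x
    using that by (auto simp: S_def a_minus_def)
  have zero_S: "\<zero>\<^bsub>F i\<^esub> \<in> S i" for i
    using abelian_monoid.zero_closed[OF abelian_group.axioms(1)[OF lmodule_abelian_group[OF lP]], of i] by simp
  have proj: "projective_lmodule R (P i)" for i
  proof -
    consider "i < n" | "i = n" | "i > n" by linarith
    then show ?thesis
    proof cases
      case 1
      then have "P i = F i" by (simp add: P_def S_def)
      then show ?thesis using projective_resolution_projective[OF F] by simp
    next
      case 2
      show ?thesis
        unfolding 2
        by (rule projective_lmodule_retract[OF lP projective_resolution_projective[OF F, of n], of "\<lambda>x. x" _ ?r])
          (use subsetD[OF S_sub] r_S r_id lmodule_homD[OF r] in \<open>auto intro!: lmodule_homI\<close>)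
    next
      case 3
      interpret I: lmodule R "F i" by (rule lF)
      show ?thesis
        by (rule projective_lmodule_retract[OF lP projective_resolution_projective[OF F, of i], of "\<lambda>x. x" _ "\<lambda>x. \<zero>\<^bsub>F i\<^esub>"])
          (use 3 in \<open>auto simp: S_def intro!: lmodule_homI\<close>)
    qed
  qed
  have dS: "d i x \<in> S i" if x: "x \<in> S (Suc i)" for i x
  proof -
    have x': "x \<in> carrier (F (Suc i))" using x S_sub by blast
    show ?thesis
      using x lmodule_hom_closed[OF d x'] lmodule_hom_zero[OF lF lF d] zero_S[of i]
      by (cases "i < n") (auto simp: S_def)
  qed
  \<comment> \<open>This carries exactness over to the smaller modules. One degree below n nothing
    is lost, because \<open>x\<close> and \<open>?r x\<close> differ by a boundary. In degree n only
    zero survives, because d h is the identity on boundaries and zero on \<open>S n\<close>.\<close>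
  have image: "d i ` S (Suc i) = d i ` carrier (F (Suc i)) \<inter> S i" for i
  proof -
    consider "Suc i < n" | "Suc i = n" | "i = n" | "i > n" by linarith
    then show ?thesis
    proof cases
      case 1
      then show ?thesis by (auto simp: S_def lmodule_hom_closed[OF d])
    next
      case 2
      have "d i x \<in> d i ` S n" if x: "x \<in> carrier (F n)" for x
      proof (rule image_eqI[OF _ r_S[OF x]])
        interpret I: lmodule R "F i" by (rule lF)
        have d': "d i \<in> lmodule_hom R (F n) (F i)" using d[of i] 2 by simp
        have "d i (d n (h x)) = \<zero>\<^bsub>F i\<^esub>"
          using projective_resolution_comp_zero_Suc[OF F, of "h x" i] lmodule_hom_closed[OF h x] 2 by simp
        then show "d i x = d i (?r x)"
          using x lmodule_hom_closed[OF d' x] lmodule_hom_closed[OF dh x]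
          by (simp add: lmodule_hom_minus[OF lF lF d'])
      qed
      moreover have "S i = carrier (F i)" using 2 by (simp add: S_def)
      ultimately show ?thesis using 2 S_sub[of n] lmodule_hom_closed[OF d[of i]] by auto
    next
      case 3
      have "d n x = \<zero>\<^bsub>F n\<^esub>" if "x \<in> carrier (F (Suc n))" "d n x \<in> S n" for x
        using that split[of x] by (simp add: S_def)
      moreover have "\<zero>\<^bsub>F n\<^esub> \<in> d n ` carrier (F (Suc n))"
        using lmodule_hom_zero[OF lF lF d, of n] S_sub[of "Suc n"] zero_S[of "Suc n"]
        by (intro image_eqI[of _ _ "\<zero>\<^bsub>F (Suc n)\<^esub>"]) auto
      ultimately have "d n ` carrier (F (Suc n)) \<inter> S n = {\<zero>\<^bsub>F n\<^esub>}"
        using zero_S[of n] by blast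
      then show ?thesis using 3 lmodule_hom_zero[OF lF lF d, of n] by (simp add: S_def[of "Suc n"])
    next
      case 4
      have "\<zero>\<^bsub>F i\<^esub> \<in> d i ` carrier (F (Suc i))"
        using lmodule_hom_zero[OF lF lF d, of i] S_sub[of "Suc i"] zero_S[of "Suc i"]
        by (intro image_eqI[of _ _ "\<zero>\<^bsub>F (Suc i)\<^esub>"]) auto
      then show ?thesis using 4 lmodule_hom_zero[OF lF lF d, of i] by (simp add: S_def)
    qed
  qed
  have surj: "e ` S 0 = carrier M"
  proof (cases "n = 0")
    case False
    then show ?thesis using projective_resolution_surj[OF F] by (simp add: S_def)
  next
    case True
    interpret M: lmodule R M by (rule M)
    have e': "e \<in> lmodule_hom R (F n) M" using e True by simp
    have "e x \<in> e ` S 0" if x: "x \<in> carrier (F n)" for x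
    proof (rule image_eqI[OF _ r_S[OF x, unfolded True]])
      have "e (d n (h x)) = \<zero>\<^bsub>M\<^esub>"
        using projective_resolution_comp_zero_0[OF F] lmodule_hom_closed[OF h x] True by simp
      then show "e x = e (x \<ominus>\<^bsub>F 0\<^esub> d 0 (h x))"
        using x lmodule_hom_closed[OF e' x] lmodule_hom_closed[OF dh x] lmodule_hom_minus[OF lF M e'] True
        by simp
    qed
    then have "e ` carrier (F 0) \<subseteq> e ` S 0"
      using True by auto
    then show ?thesis
      using S_sub[of 0] projective_resolution_surj[OF F] by blast
  qed
  have "projective_resolution R M P d e"
    unfolding projective_resolution_def One_nat_def
  proof (intro conjI allI proj)
    show "e \<in> lmodule_hom R (P 0) M"
      using S_sub[of 0] by (intro lmodule_homI) (auto simp: lmodule_homD[OF e] subset_iff)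
    show "d i \<in> lmodule_hom R (P (Suc i)) (P i)" for i
      using S_sub[of "Suc i"] dS by (intro lmodule_homI) (auto simp: lmodule_homD[OF d] subset_iff)
    show "e ` carrier (P 0) = carrier M" using surj by simp
    show "d 0 ` carrier (P (Suc 0)) = {x \<in> carrier (P 0). e x = \<zero>\<^bsub>M\<^esub>}"
      using S_sub[of 0] by (auto simp: image projective_resolution_exact_0[OF F])
    show "d (Suc i) ` carrier (P (Suc (Suc i))) = {x \<in> carrier (P (Suc i)). d i x = \<zero>\<^bsub>P i\<^esub>}" for i
      using S_sub[of "Suc i"] by (auto simp: image projective_resolution_exact_Suc[OF F])
  qed
  moreover have "\<forall>i>n. carrier (P i) = {\<zero>\<^bsub>P i\<^esub>}"
    by (auto simp: S_def)
  ultimately show ?thesis by blast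
qed

text \<open>The chain maps \<open>F \<rightarrow> T \<rightarrow> F\<close> over the identity of \<open>M\<close> compose to a map that is homotopic to
  the identity and vanishes in degree \<open>n + 1\<close>, so the homotopy splits \<open>d n\<close>.\<close>

lemma projective_resolution_shorten:
  fixes F :: "nat \<Rightarrow> ('r, 'u) module" and T :: "nat \<Rightarrow> ('r, 'v) module"
  assumes M: "lmodule R M" and F: "projective_resolution R M F d e"
    and T: "projective_resolution R M T dT eT" and T0: "carrier (T (Suc n)) = {\<zero>\<^bsub>T (Suc n)\<^esub>}"
  shows "\<exists>P. projective_resolution R M P d e \<and> (\<forall>i>n. carrier (P i) = {\<zero>\<^bsub>P i\<^esub>})"
proof -
  note lF = projective_resolution_lmodule[OF F]
  note lT = projective_resolution_lmodule[OF T]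
  note d = projective_resolution_differential[OF F]
  interpret M: lmodule R M by (rule M)
  obtain g where g: "\<And>i. g i \<in> lmodule_hom R (F i) (T i)" "\<And>x. x \<in> carrier (F 0) \<Longrightarrow> eT (g 0 x) = e x"
    "\<And>i x. x \<in> carrier (F (Suc i)) \<Longrightarrow> dT i (g (Suc i) x) = g i (d i x)"
    by (rule chain_map_lift[OF M projective_resolution_projective[OF F] d
          projective_resolution_comp_zero_Suc[OF F] projective_resolution_augmentation[OF F]
          projective_resolution_comp_zero_0[OF F] T]) (assumption, assumption, rule that)
  obtain f where f: "\<And>i. f i \<in> lmodule_hom R (T i) (F i)" "\<And>x. x \<in> carrier (T 0) \<Longrightarrow> e (f 0 x) = eT x"
    "\<And>i x. x \<in> carrier (T (Suc i)) \<Longrightarrow> d i (f (Suc i) x) = f i (dT i x)"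
    by (rule chain_map_lift[OF M projective_resolution_projective[OF T] projective_resolution_differential[OF T]
          projective_resolution_comp_zero_Suc[OF T] projective_resolution_augmentation[OF T]
          projective_resolution_comp_zero_0[OF T] F]) (assumption, assumption, rule that)
  have fg: "(\<lambda>x. f i (g i x)) \<in> lmodule_hom R (F i) (F i)" for i
    by (rule lmodule_hom_comp[OF g(1) f(1)])
  obtain h where h: "\<And>i. h i \<in> lmodule_hom R (F i) (F (Suc i))"
    "\<And>i x. x \<in> carrier (F (Suc i)) \<Longrightarrow>
      d (Suc i) (h (Suc i) x) = (x \<ominus>\<^bsub>F (Suc i)\<^esub> f (Suc i) (g (Suc i) x)) \<ominus>\<^bsub>F (Suc i)\<^esub> h i (d i x)"
  proof (rule null_homotopy[OF M F])
    show "(\<lambda>x. x \<ominus>\<^bsub>F i\<^esub> f i (g i x)) \<in> lmodule_hom R (F i) (F i)" for i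
      by (rule lmodule_hom_diff[OF lF lmodule_hom_id fg])
    show "e (x \<ominus>\<^bsub>F 0\<^esub> f 0 (g 0 x)) = \<zero>\<^bsub>M\<^esub>" if x: "x \<in> carrier (F 0)" for x
      using x lmodule_hom_closed[OF fg x] f(2) g(2) lmodule_hom_closed[OF g(1) x]
        lmodule_hom_closed[OF projective_resolution_augmentation[OF F] x]
      by (simp add: lmodule_hom_minus[OF lF M projective_resolution_augmentation[OF F]])
    show "d i (x \<ominus>\<^bsub>F (Suc i)\<^esub> f (Suc i) (g (Suc i) x)) = d i x \<ominus>\<^bsub>F i\<^esub> f i (g i (d i x))"
      if x: "x \<in> carrier (F (Suc i))" for i x
      using x lmodule_hom_closed[OF fg x] f(3) g(3) lmodule_hom_closed[OF g(1) x]
      by (simp add: lmodule_hom_minus[OF lF lF d])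
  qed (rule that)
  have "d n (h n (d n x)) = d n x" if x: "x \<in> carrier (F (Suc n))" for x
  proof -
    interpret N: lmodule R "F n" by (rule lF)
    interpret S: lmodule R "F (Suc n)" by (rule lF)
    have "g (Suc n) x = \<zero>\<^bsub>T (Suc n)\<^esub>" using lmodule_hom_closed[OF g(1) x] T0 by simp
    then have "d (Suc n) (h (Suc n) x) = x \<ominus>\<^bsub>F (Suc n)\<^esub> h n (d n x)"
      using h(2)[OF x] x lmodule_hom_zero[OF lT lF f(1)] by simp
    then have "\<zero>\<^bsub>F n\<^esub> = d n (x \<ominus>\<^bsub>F (Suc n)\<^esub> h n (d n x))"
      using projective_resolution_comp_zero_Suc[OF F, of "h (Suc n) x" n] lmodule_hom_closed[OF h(1) x] by simp
    also have "\<dots> = d n x \<ominus>\<^bsub>F n\<^esub> d n (h n (d n x))"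
      using x by (intro lmodule_hom_minus[OF lF lF d] lmodule_hom_closed[OF h(1)] lmodule_hom_closed[OF d])
    finally show ?thesis
      using lmodule_hom_closed[OF d x] lmodule_hom_closed[OF d lmodule_hom_closed[OF h(1) lmodule_hom_closed[OF d x]]]
      by (metis N.M.eq_of_a_minus_eq_zero)
  qed
  then show ?thesis by (rule projective_resolution_truncate[OF M F h(1)])
qed

subsection \<open>Resolutions by formal linear combinations\<close>

text \<open>Serves to move modules into the type \<open>formal_lincomb\<close>, over which the
  length of resolutions is defined.\<close>

definition transport :: "('m \<Rightarrow> 'n) \<Rightarrow> ('r, 'm, 'q) module_scheme \<Rightarrow> ('r, 'n) module"
  where "transport g M =
    \<lparr>carrier = g ` carrier M, mult = undefined, one = undefined, zero = g \<zero>\<^bsub>M\<^esub>,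
     add = (\<lambda>x y. g (inv_into (carrier M) g x \<oplus>\<^bsub>M\<^esub> inv_into (carrier M) g y)),
     smult = (\<lambda>a x. g (a \<odot>\<^bsub>M\<^esub> inv_into (carrier M) g x))\<rparr>"

lemma transport_iso:
  assumes M: "lmodule R M" and g: "inj_on g (carrier M)"
  shows lmodule_transport: "lmodule R (transport g M)"
    and transport_hom: "g \<in> lmodule_hom R M (transport g M)"
    and transport_inv_hom: "inv_into (carrier M) g \<in> lmodule_hom R (transport g M) M"
proof -
  interpret lmodule R M by (rule M)
  have [simp]: "inv_into (carrier M) g (g x) = x" if "x \<in> carrier M" for x
    using g that by simp
  have "abelian_group (transport g M)"
  proof (rule abelian_groupI)
    fix x assume "x \<in> carrier (transport g M)"
    then obtain y where "x = g y" "y \<in> carrier M" by (auto simp: transport_def)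
    then show "\<exists>y\<in>carrier (transport g M). y \<oplus>\<^bsub>transport g M\<^esub> x = \<zero>\<^bsub>transport g M\<^esub>"
      by (intro bexI[of _ "g (\<ominus>\<^bsub>M\<^esub> y)"]) (auto simp: transport_def M.l_neg)
  qed (auto simp: transport_def M.a_ac)
  then show "lmodule R (transport g M)"
    by (intro lmodule.intro lmodule_axioms.intro R.ring_axioms)
      (auto simp: transport_def smult_l_distr smult_r_distr smult_assoc1)
  show "g \<in> lmodule_hom R M (transport g M)" "inv_into (carrier M) g \<in> lmodule_hom R (transport g M) M"
    by (auto intro!: lmodule_homI simp: transport_def)
qed

text \<open>A finitely supported function becomes a term by listing its graph over the support. The
  order in the list is arbitrary, but the choice depends on the graph alone and the graph determines
  the function, so the encoding is injective on a free module.\<close>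

definition encode_lincomb ::
    "('r, 'p) ring_scheme \<Rightarrow> (('r, 'm) formal_lincomb \<Rightarrow> 'r) \<Rightarrow> ('r, 'm) formal_lincomb"
  where "encode_lincomb R f = Combination (SOME l. set l = {(f x, x) |x. f x \<noteq> \<zero>\<^bsub>R\<^esub>})"

lemma inj_on_encode_lincomb: "inj_on (encode_lincomb R) (carrier (free_lmodule R X))"
proof (rule inj_onI)
  fix f g assume f: "f \<in> carrier (free_lmodule R X)" and g: "g \<in> carrier (free_lmodule R X)"
    and eq: "encode_lincomb R f = encode_lincomb R g"
  define G where "G k = {(k x, x) |x. k x \<noteq> \<zero>\<^bsub>R\<^esub>}" for k :: "('a, 'b) formal_lincomb \<Rightarrow> 'a"
  have set: "set (SOME l. set l = G k) = G k" if "k \<in> carrier (free_lmodule R X)" for k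
  proof -
    have "finite (G k)" using that by (simp add: G_def carrier_free_lmodule)
    then show ?thesis by (rule someI_ex[OF finite_list])
  qed
  have "(SOME l. set l = G f) = (SOME l. set l = G g)"
    using eq by (simp only: encode_lincomb_def G_def formal_lincomb.inject)
  then have "G f = G g" using set[OF f] set[OF g] by (metis (no_types))
  then have "f x \<noteq> \<zero>\<^bsub>R\<^esub> \<Longrightarrow> f x = g x" "g x \<noteq> \<zero>\<^bsub>R\<^esub> \<Longrightarrow> f x = g x" for x
    by (auto simp: G_def set_eq_iff)
  then show "f = g" by (intro ext) metis
qed

text \<open>The cover is the free module on all elements of \<open>N\<close>, encoded back into the
  element type of \<open>N\<close>. As the type does not grow, the construction can be
  iterated.\<close>

lemma projective_cover_by_lincombs:
  fixes N :: "('r, ('r, 'm) formal_lincomb) module"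
  assumes N: "lmodule R N"
  shows "\<exists>(F :: ('r, ('r, 'm) formal_lincomb) module) c.
    projective_lmodule R F \<and> c \<in> lmodule_hom R F N \<and> c ` carrier F = carrier N"
proof -
  interpret N: lmodule R N by (rule N)
  let ?L = "free_lmodule R (carrier N)" and ?c = "free_lift R N (\<lambda>x. x)"
  let ?F = "transport (encode_lincomb R) ?L" and ?i = "inv_into (carrier ?L) (encode_lincomb R)"
  have L: "lmodule R ?L" by (rule lmodule_free_lmodule[OF N.R.ring_axioms])
  note iso = transport_iso[OF L inj_on_encode_lincomb]
  have c: "?c \<in> lmodule_hom R ?L N" by (rule N.free_lift_hom) auto
  have i: "?i (encode_lincomb R f) = f" if "f \<in> carrier ?L" for f
    using that inj_on_encode_lincomb by (rule inv_into_f_f[rotated])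
  show ?thesis
  proof (intro exI conjI)
    show "projective_lmodule R ?F"
      by (rule projective_lmodule_retract[OF iso(1) projective_free_lmodule[OF N.R.ring_axioms] iso(3) iso(2)])
        (auto simp: transport_def i)
    show "(\<lambda>x. ?c (?i x)) \<in> lmodule_hom R ?F N"
      by (rule lmodule_hom_comp[OF iso(3) c])
    have "x \<in> (\<lambda>x. ?c (?i x)) ` carrier ?F" if x: "x \<in> carrier N" for x
    proof
      have u: "free_unit R x \<in> carrier ?L" by (rule free_unit_closed[OF N.R.ring_axioms x])
      then show "x = ?c (?i (encode_lincomb R (free_unit R x)))"
        using i N.free_lift_unit[of "\<lambda>x. x" x] x by simp
      show "encode_lincomb R (free_unit R x) \<in> carrier ?F"
        using u by (rule lmodule_hom_closed[OF iso(2)])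
    qed
    then show "(\<lambda>x. ?c (?i x)) ` carrier ?F = carrier N"
      using lmodule_hom_closed[OF lmodule_hom_comp[OF iso(3) c]] by auto
  qed
qed

lemma projective_resolution_exists:
  fixes M :: "('r, 'm, 'q) module_scheme"
  assumes M: "lmodule R M"
  shows "\<exists>(F :: nat \<Rightarrow> ('r, ('r, 'm) formal_lincomb) module) d e. projective_resolution R M F d e"
proof -
  have "inj_on Generator (carrier M)" by (simp add: inj_on_def)
  note gen = transport_iso[OF M this]
  \<comment> \<open>The cover has to be a function of the module, since the recursion below applies
    it to kernels that arise only during the recursion.\<close>
  obtain F :: "('r, ('r, 'm) formal_lincomb) module \<Rightarrow> ('r, ('r, 'm) formal_lincomb) module" and c
    where F: "\<And>N. lmodule R N \<Longrightarrow> projective_lmodule R (F N)"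
      and c: "\<And>N. lmodule R N \<Longrightarrow> c N \<in> lmodule_hom R (F N) N"
      and surj: "\<And>N. lmodule R N \<Longrightarrow> c N ` carrier (F N) = carrier N"
  proof -
    have "\<forall>N. \<exists>Fc :: ('r, ('r, 'm) formal_lincomb) module \<times> _. lmodule R N \<longrightarrow> projective_lmodule R (fst Fc) \<and> snd Fc \<in> lmodule_hom R (fst Fc) N \<and>
        snd Fc ` carrier (fst Fc) = carrier (N :: ('r, ('r, 'm) formal_lincomb) module)"
      using projective_cover_by_lincombs[where R = R and 'm = 'm] by fastforce
    then obtain Fc :: "_ \<Rightarrow> ('r, ('r, 'm) formal_lincomb) module \<times> _" where "\<forall>N. lmodule R N \<longrightarrow> projective_lmodule R (fst (Fc N)) \<and>
        snd (Fc N) \<in> lmodule_hom R (fst (Fc N)) N \<and>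
        snd (Fc N) ` carrier (fst (Fc N)) = carrier (N :: ('r, ('r, 'm) formal_lincomb) module)"
      by (rule exE[OF choice]) (rule that)
    then show thesis by (intro that[of "\<lambda>N. fst (Fc N)" "\<lambda>N. snd (Fc N)"]) auto
  qed
  \<comment> \<open>\<open>N i\<close> is the i-th syzygy: first the copy of \<open>M\<close> by
    generators, then the kernel of the chosen cover of the preceding syzygy.\<close>
  define N where "N = rec_nat (transport Generator M)
    (\<lambda>_ N. (F N)\<lparr>carrier := {x \<in> carrier (F N). c N x = \<zero>\<^bsub>N\<^esub>}\<rparr>)"
  have N_0: "N 0 = transport Generator M"
    and N_Suc: "N (Suc i) = (F (N i))\<lparr>carrier := {x \<in> carrier (F (N i)). c (N i) x = \<zero>\<^bsub>N i\<^esub>}\<rparr>" for i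
    by (simp_all add: N_def)
  have lN: "lmodule R (N i)" for i
  proof (induction i)
    case 0
    show ?case unfolding N_0 by (rule gen(1))
  next
    case (Suc i)
    interpret N: lmodule R "N i" by (rule Suc)
    interpret F: lmodule R "F (N i)" by (rule projective_lmoduleD[OF F[OF Suc]])
    show ?case
      unfolding N_Suc
      by (rule lmodule_submodule[OF F.lmodule_axioms])
        (auto simp: lmodule_homD[OF c[OF Suc]] lmodule_hom_zero[OF F.lmodule_axioms Suc c[OF Suc]])
  qed
  let ?g = "inv_into (carrier M) Generator"
  have g_0: "?g x = \<zero>\<^bsub>M\<^esub> \<longleftrightarrow> x = \<zero>\<^bsub>N 0\<^esub>" if "x \<in> carrier (N 0)" for x
  proof -
    interpret M: lmodule R M by (rule M)
    show ?thesis
      using that M.M.zero_closed by (auto simp: N_0 transport_def inv_into_f_f inj_on_def)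
  qed
  have g_surj: "?g ` carrier (N 0) = carrier M"
    by (force simp: N_0 transport_def inv_into_f_f inj_on_def)
  \<comment> \<open>The cover of the syzygy \<open>N (Suc i)\<close> is at the same time a map into
    \<open>F (N i)\<close>, because that syzygy is a subset of it; this is the differential. Its
    image is all of the syzygy, which is exactness.\<close>
  have "projective_resolution R M (\<lambda>i. F (N i)) (\<lambda>i. c (N (Suc i))) (\<lambda>x. ?g (c (N 0) x))"
    unfolding projective_resolution_def One_nat_def
  proof (intro conjI allI)
    show "projective_lmodule R (F (N i))" for i by (rule F[OF lN])
    show "(\<lambda>x. ?g (c (N 0) x)) \<in> lmodule_hom R (F (N 0)) M"
      using lmodule_hom_comp[OF c[OF lN, of 0]] gen(3) by (simp add: N_0)
    show "c (N (Suc i)) \<in> lmodule_hom R (F (N (Suc i))) (F (N i))" for i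
      by (rule lmodule_homI)
        (use lmodule_homD[OF c[OF lN[of "Suc i"]]] in \<open>auto simp: N_Suc\<close>)
    show "(\<lambda>x. ?g (c (N 0) x)) ` carrier (F (N 0)) = carrier M"
      using surj[OF lN, of 0] g_surj by (simp add: image_image[symmetric])
    show "c (N (Suc 0)) ` carrier (F (N (Suc 0))) = {x \<in> carrier (F (N 0)). ?g (c (N 0) x) = \<zero>\<^bsub>M\<^esub>}"
      unfolding surj[OF lN] using g_0 lmodule_hom_closed[OF c[OF lN], of _ 0] by (auto simp: N_Suc)
    show "c (N (Suc (Suc i))) ` carrier (F (N (Suc (Suc i)))) =
        {x \<in> carrier (F (N (Suc i))). c (N (Suc i)) x = \<zero>\<^bsub>F (N i)\<^esub>}" for i
      unfolding surj[OF lN] by (simp add: N_Suc[of "Suc i"]) (simp add: N_Suc)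
  qed
  then show ?thesis by blast
qed

text \<open>Frees the length from the prescribed element type: the terms of \<open>T\<close> may be
  modules over any type, and a single zero term in degree n + 1 already lets the resolution by
  formal linear combinations be cut off after degree n.\<close>

lemma has_projective_resolution_of_lengthI:
  fixes T :: "nat \<Rightarrow> ('r, 'v) module"
  assumes "lmodule R M" "projective_resolution R M T d e" "carrier (T (Suc n)) = {\<zero>\<^bsub>T (Suc n)\<^esub>}"
  shows "has_projective_resolution_of_length R M n"
  unfolding has_projective_resolution_of_length_def
  using projective_resolution_exists[OF assms(1)] projective_resolution_shorten[OF assms(1) _ assms(2,3)]
  by blast

section \<open>The horseshoe lemma\<close>

text \<open>\<open>Q\<close> is a resolution of the quotient of \<open>M\<close> by \<open>S\<close>; its augmentation is given by a lift \<open>s\<close> to \<open>M\<close>.\<close>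

lemma horseshoe:
  fixes P :: "nat \<Rightarrow> ('r, 'u) module" and Q :: "nat \<Rightarrow> ('r, 'v) module" and M :: "('r, 'm) module"
  assumes M: "lmodule R M" and S: "S \<subseteq> carrier M" "lmodule R (M\<lparr>carrier := S\<rparr>)"
    and P: "projective_resolution R (M\<lparr>carrier := S\<rparr>) P dP eP"
    and Q: "\<And>i. projective_lmodule R (Q i)"
    and dQ: "\<And>i. dQ i \<in> lmodule_hom R (Q (Suc i)) (Q i)"
    and s: "s \<in> lmodule_hom R (Q 0) M"
    and surj: "\<And>x. x \<in> carrier M \<Longrightarrow> \<exists>q\<in>carrier (Q 0). x \<ominus>\<^bsub>M\<^esub> s q \<in> S"
    and exact_0: "dQ 0 ` carrier (Q (Suc 0)) = {x \<in> carrier (Q 0). s x \<in> S}"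
    and exact_Suc: "\<And>i. dQ (Suc i) ` carrier (Q (Suc (Suc i))) = {x \<in> carrier (Q (Suc i)). dQ i x = \<zero>\<^bsub>Q i\<^esub>}"
  shows "\<exists>d e. projective_resolution R M (\<lambda>i. direct_sum (P i) (Q i)) d e"
proof -
  let ?N = "M\<lparr>carrier := S\<rparr>"
  note lP = projective_resolution_lmodule[OF P]
  note lQ = projective_lmoduleD[OF Q]
  note dP = projective_resolution_differential[OF P]
  note eP = projective_resolution_augmentation[OF P]
  interpret M: lmodule R M by (rule M)
  have eP': "eP \<in> lmodule_hom R (P 0) M"
    using S(1) lmodule_homD[OF eP] by (intro lmodule_homI) auto
  have dQ2: "dQ i (dQ (Suc i) x) = \<zero>\<^bsub>Q i\<^esub>" if "x \<in> carrier (Q (Suc (Suc i)))" for i x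
    using exact_Suc[of i] that by blast
  have mdQ: "(\<lambda>x. \<ominus>\<^bsub>Q i\<^esub> dQ i x) \<in> lmodule_hom R (Q (Suc i)) (Q i)" for i
    by (rule lmodule_hom_uminus[OF lQ dQ])
  have sdQ: "(\<lambda>x. s (dQ 0 x)) \<in> lmodule_hom R (Q (Suc 0)) ?N"
    using lmodule_homD[OF lmodule_hom_comp[OF dQ s]] exact_0 by (intro lmodule_homI) auto
  \<comment> \<open>The off-diagonal entries of the new differential: a chain map to
    \<open>P\<close> from \<open>Q\<close> shifted by one degree, over the map given by
    \<open>s\<close> after \<open>dQ 0\<close>. The sign on the shifted differential makes the mixed
    terms of d d cancel.\<close>
  obtain \<sigma> where \<sigma>: "\<And>i. \<sigma> i \<in> lmodule_hom R (Q (Suc i)) (P i)"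
    and e\<sigma>: "\<And>x. x \<in> carrier (Q (Suc 0)) \<Longrightarrow> eP (\<sigma> 0 x) = s (dQ 0 x)"
    and d\<sigma>: "\<And>i x. x \<in> carrier (Q (Suc (Suc i))) \<Longrightarrow> dP i (\<sigma> (Suc i) x) = \<sigma> i (\<ominus>\<^bsub>Q (Suc i)\<^esub> dQ (Suc i) x)"
  proof (rule chain_map_lift[OF S(2) Q mdQ _ sdQ _ P])
    fix i x assume x: "x \<in> carrier (Q (Suc (Suc (Suc i))))"
    interpret N: lmodule R "Q (Suc i)" by (rule lQ)
    show "\<ominus>\<^bsub>Q (Suc i)\<^esub> dQ (Suc i) (\<ominus>\<^bsub>Q (Suc (Suc i))\<^esub> dQ (Suc (Suc i)) x) = \<zero>\<^bsub>Q (Suc i)\<^esub>"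
      using dQ2[OF x] lmodule_hom_closed[OF dQ x] by (simp add: lmodule_hom_a_inv[OF lQ lQ dQ])
  next
    fix x assume x: "x \<in> carrier (Q (Suc (Suc 0)))"
    interpret N: lmodule R "Q 0" by (rule lQ)
    show "s (dQ 0 (\<ominus>\<^bsub>Q (Suc 0)\<^esub> dQ (Suc 0) x)) = \<zero>\<^bsub>?N\<^esub>"
      using dQ2[OF x] lmodule_hom_closed[OF dQ x] lmodule_hom_zero[OF lQ M s]
      by (simp add: lmodule_hom_a_inv[OF lQ lQ dQ])
  qed (rule that)
  have d\<sigma>': "dP i (\<sigma> (Suc i) x) = \<ominus>\<^bsub>P i\<^esub> \<sigma> i (dQ (Suc i) x)" if "x \<in> carrier (Q (Suc (Suc i)))" for i x
    using d\<sigma>[OF that] lmodule_hom_a_inv[OF lQ lP \<sigma> lmodule_hom_closed[OF dQ that]] by simp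
  let ?T = "\<lambda>i. direct_sum (P i) (Q i)"
  define d where "d i x = (dP i (fst x) \<ominus>\<^bsub>P i\<^esub> \<sigma> i (snd x), dQ i (snd x))" for i x
  define e where "e x = eP (fst x) \<oplus>\<^bsub>M\<^esub> s (snd x)" for x
  note hom_fst = lmodule_hom_comp[OF direct_sum_hom_fst[OF lP lQ]]
  note hom_snd = lmodule_hom_comp[OF direct_sum_hom_snd[OF lP lQ]]
  have dT: "d i \<in> lmodule_hom R (?T (Suc i)) (?T i)" for i
    unfolding d_def
    by (intro direct_sum_hom_Pair lmodule_hom_diff lP hom_fst[OF dP] hom_snd[OF \<sigma>] hom_snd[OF dQ])
  have eT: "e \<in> lmodule_hom R (?T 0) M"
    unfolding e_def by (intro lmodule_hom_plus M hom_fst[OF eP'] hom_snd[OF s])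
  \<comment> \<open>Exactness of the glued complex: the second component of a cycle has a preimage
    \<open>q'\<close> by exactness of \<open>Q\<close>. Then \<open>p\<close> corrected by
    \<open>\<sigma>\<close> of \<open>q'\<close> is a cycle of \<open>P\<close>, hence a boundary,
    and \<open>preimage\<close> joins the two preimages.\<close>
  have ker_e: "p \<oplus>\<^bsub>P 0\<^esub> \<sigma> 0 q' \<in> dP 0 ` carrier (P (Suc 0))"
    if "p \<in> carrier (P 0)" "q' \<in> carrier (Q (Suc 0))" "eP p \<oplus>\<^bsub>M\<^esub> s (dQ 0 q') = \<zero>\<^bsub>M\<^esub>" for p q'
  proof -
    interpret P0: lmodule R "P 0" by (rule lP)
    show ?thesis
      using that lmodule_hom_closed[OF \<sigma> that(2)] e\<sigma>[OF that(2)]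
      by (simp add: projective_resolution_exact_0[OF P] lmodule_hom_add[OF eP'])
  qed
  have ker_d: "p \<oplus>\<^bsub>P (Suc i)\<^esub> \<sigma> (Suc i) q' \<in> dP (Suc i) ` carrier (P (Suc (Suc i)))"
    if p: "p \<in> carrier (P (Suc i))" and q': "q' \<in> carrier (Q (Suc (Suc i)))"
      and eq: "dP i p \<ominus>\<^bsub>P i\<^esub> \<sigma> i (dQ (Suc i) q') = \<zero>\<^bsub>P i\<^esub>" for i p q'
  proof -
    interpret P0: lmodule R "P i" by (rule lP)
    interpret P1: lmodule R "P (Suc i)" by (rule lP)
    show ?thesis
      using p eq lmodule_hom_closed[OF \<sigma> q'] d\<sigma>'[OF q']
      by (simp add: projective_resolution_exact_Suc[OF P] lmodule_hom_add[OF dP] a_minus_def)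
  qed
  have preimage: "\<exists>z\<in>carrier (?T (Suc i)). d i z = (p, dQ i q')"
    if p: "p \<in> carrier (P i)" and q': "q' \<in> carrier (Q (Suc i))"
      and im: "p \<oplus>\<^bsub>P i\<^esub> \<sigma> i q' \<in> dP i ` carrier (P (Suc i))" for i p q'
  proof -
    interpret P0: lmodule R "P i" by (rule lP)
    obtain p' where p': "p' \<in> carrier (P (Suc i))" "dP i p' = p \<oplus>\<^bsub>P i\<^esub> \<sigma> i q'"
      using im by auto
    then have "d i (p', q') = (p, dQ i q')"
      using p lmodule_hom_closed[OF \<sigma> q'] by (simp add: d_def a_minus_def P0.M.a_assoc P0.M.r_neg)
    then show ?thesis using p'(1) q' by (intro bexI[of _ "(p', q')"]) auto
  qed
  have "projective_resolution R M ?T d e"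
    unfolding projective_resolution_def One_nat_def
  proof (intro conjI allI dT eT)
    show "projective_lmodule R (?T i)" for i
      by (rule projective_direct_sum[OF projective_resolution_projective[OF P] Q])
    have "x \<in> e ` carrier (?T 0)" if x: "x \<in> carrier M" for x
    proof -
      obtain q where q: "q \<in> carrier (Q 0)" "x \<ominus>\<^bsub>M\<^esub> s q \<in> S" using surj[OF x] by blast
      then obtain p where p: "p \<in> carrier (P 0)" "eP p = x \<ominus>\<^bsub>M\<^esub> s q"
        using projective_resolution_surj[OF P] by (auto simp: image_iff)
      then have "e (p, q) = x"
        using x lmodule_hom_closed[OF s q(1)] by (simp add: e_def a_minus_def M.M.a_assoc M.M.l_neg)
      then show ?thesis using p(1) q(1) by (intro image_eqI[of _ _ "(p, q)"]) auto
    qed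
    then show "e ` carrier (?T 0) = carrier M" using lmodule_hom_closed[OF eT] by auto
    show "d 0 ` carrier (?T (Suc 0)) = {x \<in> carrier (?T 0). e x = \<zero>\<^bsub>M\<^esub>}"
    proof (intro equalityI subsetI)
      fix z assume "z \<in> d 0 ` carrier (?T (Suc 0))"
      then obtain p q where z: "z = d 0 (p, q)" and p: "p \<in> carrier (P (Suc 0))" and q: "q \<in> carrier (Q (Suc 0))"
        by auto
      have "e z = (eP (dP 0 p) \<ominus>\<^bsub>M\<^esub> eP (\<sigma> 0 q)) \<oplus>\<^bsub>M\<^esub> s (dQ 0 q)"
        using lmodule_hom_minus[OF lP M eP' lmodule_hom_closed[OF dP p] lmodule_hom_closed[OF \<sigma> q]]
        by (simp add: z e_def d_def)
      also have "\<dots> = \<zero>\<^bsub>M\<^esub>"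
        using projective_resolution_comp_zero_0[OF P p] e\<sigma>[OF q]
          lmodule_hom_closed[OF s lmodule_hom_closed[OF dQ q]] by (simp add: a_minus_def M.M.l_neg)
      finally show "z \<in> {x \<in> carrier (?T 0). e x = \<zero>\<^bsub>M\<^esub>}"
        using lmodule_hom_closed[OF dT, of "(p, q)" 0] p q z by simp
    next
      fix z assume "z \<in> {x \<in> carrier (?T 0). e x = \<zero>\<^bsub>M\<^esub>}"
      then obtain p q where z: "z = (p, q)" and p: "p \<in> carrier (P 0)" and q: "q \<in> carrier (Q 0)"
        and eq: "eP p \<oplus>\<^bsub>M\<^esub> s q = \<zero>\<^bsub>M\<^esub>" by (auto simp: e_def)
      interpret P0: lmodule R "P 0" by (rule lP)
      have "s q = \<ominus>\<^bsub>M\<^esub> eP p"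
        using eq lmodule_hom_closed[OF eP' p] lmodule_hom_closed[OF s q] by (metis M.M.add.m_comm M.M.minus_equality)
      also have "\<dots> = eP (\<ominus>\<^bsub>P 0\<^esub> p)" using lmodule_hom_a_inv[OF lP M eP' p] by simp
      also have "\<dots> \<in> S" using lmodule_hom_closed[OF eP, of "\<ominus>\<^bsub>P 0\<^esub> p"] p by simp
      finally obtain q' where q': "q' \<in> carrier (Q (Suc 0))" "dQ 0 q' = q"
        using exact_0 q by (auto simp: image_iff set_eq_iff) metis
      then show "z \<in> d 0 ` carrier (?T (Suc 0))"
        using preimage[OF p q'(1) ker_e[OF p q'(1)]] eq by (auto simp: z image_iff) metis
    qed
    show "d (Suc i) ` carrier (?T (Suc (Suc i))) = {x \<in> carrier (?T (Suc i)). d i x = \<zero>\<^bsub>?T i\<^esub>}" for i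
    proof (intro equalityI subsetI)
      interpret P0: lmodule R "P i" by (rule lP)
      fix z assume "z \<in> d (Suc i) ` carrier (?T (Suc (Suc i)))"
      then obtain p q where z: "z = d (Suc i) (p, q)" and p: "p \<in> carrier (P (Suc (Suc i)))"
        and q: "q \<in> carrier (Q (Suc (Suc i)))" by auto
      have "fst (d i z) = (dP i (dP (Suc i) p) \<ominus>\<^bsub>P i\<^esub> dP i (\<sigma> (Suc i) q)) \<ominus>\<^bsub>P i\<^esub> \<sigma> i (dQ (Suc i) q)"
        using lmodule_hom_minus[OF lP lP dP lmodule_hom_closed[OF dP p] lmodule_hom_closed[OF \<sigma> q]]
        by (simp add: z d_def)
      also have "\<dots> = \<zero>\<^bsub>P i\<^esub>"
        using projective_resolution_comp_zero_Suc[OF P p] d\<sigma>'[OF q]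
          lmodule_hom_closed[OF \<sigma> lmodule_hom_closed[OF dQ q]] by (simp add: a_minus_def P0.M.r_neg)
      finally have "d i z = \<zero>\<^bsub>?T i\<^esub>" using dQ2[OF q] by (simp add: z d_def)
      then show "z \<in> {x \<in> carrier (?T (Suc i)). d i x = \<zero>\<^bsub>?T i\<^esub>}"
        using lmodule_hom_closed[OF dT, of "(p, q)" "Suc i"] p q z by simp
    next
      fix z assume "z \<in> {x \<in> carrier (?T (Suc i)). d i x = \<zero>\<^bsub>?T i\<^esub>}"
      then obtain p q where z: "z = (p, q)" and p: "p \<in> carrier (P (Suc i))" and q: "q \<in> carrier (Q (Suc i))"
        and eq: "dP i p \<ominus>\<^bsub>P i\<^esub> \<sigma> i q = \<zero>\<^bsub>P i\<^esub>" "dQ i q = \<zero>\<^bsub>Q i\<^esub>" by (auto simp: d_def)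
      obtain q' where q': "q' \<in> carrier (Q (Suc (Suc i)))" "dQ (Suc i) q' = q"
        using exact_Suc[of i] q eq(2) by (auto simp: image_iff set_eq_iff) metis
      then show "z \<in> d (Suc i) ` carrier (?T (Suc (Suc i)))"
        using preimage[OF p q'(1) ker_d[OF p q'(1)]] eq(1) by (auto simp: z image_iff) metis
    qed
  qed
  then show ?thesis by blast
qed


section \<open>Restriction of scalars\<close>

lemma (in abelian_monoid) finsum_Times:
  assumes "finite S" "finite T" "g \<in> S \<times> T \<rightarrow> carrier G"
  shows "(\<Oplus>z\<in>S \<times> T. g z) = (\<Oplus>x\<in>S. \<Oplus>y\<in>T. g (x, y))"
  using assms(1,3)
proof (induction S rule: finite_induct)
  case (insert x S)
  have row: "(\<Oplus>z\<in>{x} \<times> T. g z) = (\<Oplus>y\<in>T. g (x, y))"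
  proof -
    have "{x} \<times> T = Pair x ` T" by auto
    then show ?thesis using insert.prems by (auto simp: Pi_iff inj_on_def intro: finsum_reindex)
  qed
  have "(\<Oplus>z\<in>insert x S \<times> T. g z) = (\<Oplus>z\<in>{x} \<times> T. g z) \<oplus> (\<Oplus>z\<in>S \<times> T. g z)"
    using insert assms(2) by (subst finsum_Un_disjoint[symmetric]) (auto simp: Pi_iff intro: arg_cong)
  also have "\<dots> = (\<Oplus>y\<in>T. g (x, y)) \<oplus> (\<Oplus>x\<in>S. \<Oplus>y\<in>T. g (x, y))"
    using row insert by (simp add: Pi_iff)
  also have "\<dots> = (\<Oplus>x\<in>insert x S. \<Oplus>y\<in>T. g (x, y))"
    using insert by (subst finsum_insert) (auto simp: Pi_iff intro!: finsum_closed)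
  finally show ?case .
qed simp

lemma (in lmodule) free_lift_Times:
  assumes "finite S" "finite T" "\<And>x y. \<not> (x \<in> S \<and> y \<in> T) \<Longrightarrow> f (x, y) = \<zero>"
    "\<And>x y. \<lbrakk>x \<in> S; y \<in> T\<rbrakk> \<Longrightarrow> f (x, y) \<in> carrier R"
    "\<And>x y. \<lbrakk>x \<in> S; y \<in> T\<rbrakk> \<Longrightarrow> b (x, y) \<in> carrier M"
  shows "free_lift R M b f = (\<Oplus>\<^bsub>M\<^esub>x\<in>S. \<Oplus>\<^bsub>M\<^esub>y\<in>T. f (x, y) \<odot>\<^bsub>M\<^esub> b (x, y))"
proof -
  have "free_lift R M b f = (\<Oplus>\<^bsub>M\<^esub>z\<in>S \<times> T. f z \<odot>\<^bsub>M\<^esub> b z)"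
    by (rule free_lift_superset) (use assms in auto)
  also have "\<dots> = (\<Oplus>\<^bsub>M\<^esub>x\<in>S. \<Oplus>\<^bsub>M\<^esub>y\<in>T. f (x, y) \<odot>\<^bsub>M\<^esub> b (x, y))"
    by (rule M.finsum_Times) (use assms in auto)
  finally show ?thesis .
qed

definition restrict_scalars :: "('s \<Rightarrow> 'r) \<Rightarrow> ('r, 'm, 'q) module_scheme \<Rightarrow> ('s, 'm) module"
  where "restrict_scalars \<phi> M =
    \<lparr>carrier = carrier M, mult = undefined, one = undefined, zero = zero M, add = add M,
     smult = (\<lambda>a x. \<phi> a \<odot>\<^bsub>M\<^esub> x)\<rparr>"

lemma restrict_scalars_simps [simp]:
  "carrier (restrict_scalars \<phi> M) = carrier M" "zero (restrict_scalars \<phi> M) = zero M"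
  "add (restrict_scalars \<phi> M) = add M" "a \<odot>\<^bsub>restrict_scalars \<phi> M\<^esub> x = \<phi> a \<odot>\<^bsub>M\<^esub> x"
  by (simp_all add: restrict_scalars_def)

lemma lmodule_restrict_scalars:
  assumes S: "ring S" and \<phi>: "\<phi> \<in> ring_hom S R" and M: "lmodule R M"
  shows "lmodule S (restrict_scalars \<phi> M)"
proof -
  interpret M: lmodule R M by (rule M)
  have "abelian_group (restrict_scalars \<phi> M)"
    by (rule abelian_group_cong[OF M.M.abelian_group_axioms]) simp_all
  then show ?thesis
    by (intro lmodule.intro lmodule_axioms.intro S)
      (auto simp: ring_hom_closed[OF \<phi>] ring_hom_mult[OF \<phi>] ring_hom_add[OF \<phi>] ring_hom_one[OF \<phi>]
        M.smult_l_distr M.smult_r_distr M.smult_assoc1)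
qed

lemma restrict_scalars_hom:
  "\<lbrakk>\<phi> \<in> ring_hom S R; h \<in> lmodule_hom R M N\<rbrakk> \<Longrightarrow>
    h \<in> lmodule_hom S (restrict_scalars \<phi> M) (restrict_scalars \<phi> N)"
  by (intro lmodule_homI) (auto simp: lmodule_homD ring_hom_closed)

text \<open>Dual bases multiply: if the \<open>b x\<close> form one of \<open>P\<close> over
  \<open>R\<close> and the \<open>c y\<close> one of \<open>R\<close> over \<open>S\<close>, then
  the products \<open>c y \<odot> b x\<close> form one of \<open>P\<close> over \<open>S\<close>.
  The coordinates over \<open>S\<close> are the \<open>j\<close>-coordinates of the
  \<open>i\<close>-coordinates.\<close>

lemma projective_restrict_scalars:
  fixes P :: "('r, 'm, 'q) module_scheme" and R :: "('r, 'p) ring_scheme"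
  assumes S: "ring S" and \<phi>: "\<phi> \<in> ring_hom S R"
    and R: "projective_lmodule S (restrict_scalars \<phi> (ideal_lmodule R (carrier R)))"
    and P: "projective_lmodule R P"
  shows "projective_lmodule S (restrict_scalars \<phi> P)"
proof -
  let ?R = "restrict_scalars \<phi> (ideal_lmodule R (carrier R))" and ?P = "restrict_scalars \<phi> P"
  interpret P: lmodule R P by (rule projective_lmoduleD[OF P])
  interpret S: ring S by (rule S)
  have lP: "lmodule S ?P" by (rule lmodule_restrict_scalars[OF S \<phi> P.lmodule_axioms])
  interpret P': lmodule S ?P by (rule lP)
  interpret R': lmodule S ?R by (rule projective_lmoduleD[OF R])
  \<comment> \<open>The restricted module and \<open>P\<close> are different records with the same
    addition. The identity is used as a homomorphism to carry finite sums from one to the other;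
    \<open>idR\<close> does the same for the ring.\<close>
  interpret id: abelian_group_hom ?P P "\<lambda>x. x"
    by (rule abelian_group_homI') (auto simp: P.M.abelian_group_axioms P'.M.abelian_group_axioms)
  interpret idR: abelian_group_hom ?R R "\<lambda>x. x"
    by (rule abelian_group_homI'[OF R'.M.abelian_group_axioms P.R.is_abelian_group])
      (auto simp: ideal_lmodule_def)
  have carrR: "carrier ?R = carrier R"
    and smultR: "a \<odot>\<^bsub>?R\<^esub> x = \<phi> a \<otimes>\<^bsub>R\<^esub> x" for a x
    by (simp_all add: ideal_lmodule_def)
  obtain X :: "'m set" and i b where i: "i \<in> lmodule_hom R P (free_lmodule R X)"
    and b: "b \<in> X \<rightarrow> carrier P" and ib: "\<And>x. x \<in> carrier P \<Longrightarrow> free_lift R P b (i x) = x"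
    by (rule projective_lmoduleE[OF P]) (rule that)
  obtain Y :: "'r set" and j c where j: "j \<in> lmodule_hom S ?R (free_lmodule S Y)"
    and c: "c \<in> Y \<rightarrow> carrier ?R" and jc: "\<And>r. r \<in> carrier ?R \<Longrightarrow> free_lift S ?R c (j r) = r"
    by (rule projective_lmoduleE[OF R]) (rule that)
  have F: "lmodule S (free_lmodule S Y)" by (rule lmodule_free_lmodule[OF S])
  have i_carr: "i m \<in> carrier (free_lmodule R X)" if "m \<in> carrier P" for m
    using lmodule_hom_closed[OF i that] .
  have j_carr: "j r \<in> carrier (free_lmodule S Y)" if "r \<in> carrier R" for r
    using lmodule_hom_closed[OF j, of r] that by (simp add: carrR del: restrict_scalars_simps)
  have j0: "j \<zero>\<^bsub>R\<^esub> = (\<lambda>_. \<zero>\<^bsub>S\<^esub>)"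
    using lmodule_hom_zero[OF R'.lmodule_axioms F j] by (simp add: ideal_lmodule_def)
  let ?I = "\<lambda>m (x, y). j (i m x) y" and ?b = "\<lambda>(x, y). c y \<odot>\<^bsub>P\<^esub> b x"
  \<comment> \<open>A finite rectangle that contains the support of the double coordinates: outside
    the finite support of \<open>i m\<close> the value is \<open>j\<close> of zero, which vanishes,
    and \<open>V\<close> is a finite union of supports.\<close>
  have supp: "\<exists>U V. finite U \<and> finite V \<and> U \<subseteq> X \<and> V \<subseteq> Y \<and> (\<forall>x. x \<notin> U \<longrightarrow> i m x = \<zero>\<^bsub>R\<^esub>) \<and>
      (\<forall>x y. y \<notin> V \<longrightarrow> j (i m x) y = \<zero>\<^bsub>S\<^esub>)" if m: "m \<in> carrier P" for m
  proof -
    let ?U = "{x. i m x \<noteq> \<zero>\<^bsub>R\<^esub>}" and ?V = "\<lambda>x. {y. j (i m x) y \<noteq> \<zero>\<^bsub>S\<^esub>}"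
    have im: "finite ?U" "?U \<subseteq> X" "i m x \<in> carrier R" for x
      using i_carr[OF m] by (auto simp: carrier_free_lmodule)
    then have V: "finite (?V x)" "?V x \<subseteq> Y" for x
      using j_carr[OF im(3), of x] by (auto simp: carrier_free_lmodule)
    have "j (i m x) y = \<zero>\<^bsub>S\<^esub>" if "y \<notin> (\<Union>x\<in>?U. ?V x)" for x y
      using that j0 by (cases "i m x = \<zero>\<^bsub>R\<^esub>") auto
    moreover have "finite (\<Union>x\<in>?U. ?V x)" "(\<Union>x\<in>?U. ?V x) \<subseteq> Y"
      using im(1) V by blast+
    ultimately show ?thesis
      using im(1,2) by (intro exI[of _ ?U] exI[of _ "\<Union>x\<in>?U. ?V x"]) simp
  qed
  have closed: "i m x \<in> carrier R" "j (i m x) y \<in> carrier S" if "m \<in> carrier P" for m x y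
    using i_carr[OF that] j_carr[of "i m x"] by (auto simp: carrier_free_lmodule)
  show ?thesis
  proof (rule projective_lmoduleI[OF lP])
    show "?I \<in> lmodule_hom S ?P (free_lmodule S (X \<times> Y))"
    proof (rule lmodule_homI)
      fix m assume "m \<in> carrier ?P"
      then have m: "m \<in> carrier P" by simp
      obtain U V where UV: "finite U" "finite V" "U \<subseteq> X" "V \<subseteq> Y" "\<And>x. x \<notin> U \<Longrightarrow> i m x = \<zero>\<^bsub>R\<^esub>"
          "\<And>x y. y \<notin> V \<Longrightarrow> j (i m x) y = \<zero>\<^bsub>S\<^esub>" using supp[OF m] by blast
      have *: "j (i m x) y = \<zero>\<^bsub>S\<^esub>" if "(x, y) \<notin> U \<times> V" for x y
        using that UV(5)[of x] UV(6)[of y x] j0 by auto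
      then have "{z. ?I m z \<noteq> \<zero>\<^bsub>S\<^esub>} \<subseteq> U \<times> V" by auto
      then have "finite {z. ?I m z \<noteq> \<zero>\<^bsub>S\<^esub>}" by (rule finite_subset) (simp add: UV)
      then show "?I m \<in> carrier (free_lmodule S (X \<times> Y))"
        using * UV(3,4) closed(2)[OF m] by (auto simp: carrier_free_lmodule split: prod.splits)
    next
      fix m n assume "m \<in> carrier ?P" "n \<in> carrier ?P"
      then have mn: "m \<in> carrier P" "n \<in> carrier P" by simp_all
      have "j (i (m \<oplus>\<^bsub>P\<^esub> n) x) = j (i m x) \<oplus>\<^bsub>free_lmodule S Y\<^esub> j (i n x)" for x
        using lmodule_hom_add[OF i mn] lmodule_hom_add[OF j, of "i m x" "i n x"] closed(1)[OF mn(1)] closed(1)[OF mn(2)]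
        by (simp add: ideal_lmodule_def)
      then show "?I (m \<oplus>\<^bsub>?P\<^esub> n) = ?I m \<oplus>\<^bsub>free_lmodule S (X \<times> Y)\<^esub> ?I n"
        by (simp add: fun_eq_iff)
    next
      fix a m assume a: "a \<in> carrier S" and "m \<in> carrier ?P"
      then have m: "m \<in> carrier P" by simp
      have "j (i (\<phi> a \<odot>\<^bsub>P\<^esub> m) x) = a \<odot>\<^bsub>free_lmodule S Y\<^esub> j (i m x)" for x
        using lmodule_hom_smult[OF i ring_hom_closed[OF \<phi> a] m] lmodule_hom_smult[OF j a, of "i m x"] closed(1)[OF m]
        by (simp add: ideal_lmodule_def)
      then show "?I (a \<odot>\<^bsub>?P\<^esub> m) = a \<odot>\<^bsub>free_lmodule S (X \<times> Y)\<^esub> ?I m"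
        by (simp add: fun_eq_iff)
    qed
    show b': "?b \<in> X \<times> Y \<rightarrow> carrier ?P"
      using b c by (auto simp: Pi_iff ideal_lmodule_def)
    fix m assume "m \<in> carrier ?P"
    then have m: "m \<in> carrier P" by simp
    obtain U V where UV: "finite U" "finite V" "U \<subseteq> X" "V \<subseteq> Y" "\<And>x. x \<notin> U \<Longrightarrow> i m x = \<zero>\<^bsub>R\<^esub>"
        "\<And>x y. y \<notin> V \<Longrightarrow> j (i m x) y = \<zero>\<^bsub>S\<^esub>" using supp[OF m] by blast
    have bU: "b x \<in> carrier P" if "x \<in> U" for x using b UV(3) that by auto
    have cV: "c y \<in> carrier R" if "y \<in> V" for y using c UV(4) that by (auto simp: ideal_lmodule_def)
    have \<phi>j: "\<phi> (j (i m x) y) \<in> carrier R" for x y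
      by (rule ring_hom_closed[OF \<phi> closed(2)[OF m]])
    have row: "(\<Oplus>\<^bsub>?P\<^esub>y\<in>V. ?I m (x, y) \<odot>\<^bsub>?P\<^esub> ?b (x, y)) = i m x \<odot>\<^bsub>P\<^esub> b x" if x: "x \<in> U" for x
    proof -
      have "(\<Oplus>\<^bsub>?P\<^esub>y\<in>V. ?I m (x, y) \<odot>\<^bsub>?P\<^esub> ?b (x, y)) = (\<Oplus>\<^bsub>P\<^esub>y\<in>V. ?I m (x, y) \<odot>\<^bsub>?P\<^esub> ?b (x, y))"
        by (rule id.hom_finsum) (use \<phi>j cV bU[OF x] in auto)
      also have "\<dots> = (\<Oplus>\<^bsub>P\<^esub>y\<in>V. (\<phi> (j (i m x) y) \<otimes>\<^bsub>R\<^esub> c y) \<odot>\<^bsub>P\<^esub> b x)"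
        by (rule P.M.finsum_cong') (use \<phi>j cV bU[OF x] in \<open>auto simp: P.smult_assoc1\<close>)
      also have "\<dots> = (\<Oplus>\<^bsub>R\<^esub>y\<in>V. \<phi> (j (i m x) y) \<otimes>\<^bsub>R\<^esub> c y) \<odot>\<^bsub>P\<^esub> b x"
        by (rule P.finsum_smult_l[symmetric]) (use \<phi>j cV bU[OF x] in auto)
      also have "(\<Oplus>\<^bsub>R\<^esub>y\<in>V. \<phi> (j (i m x) y) \<otimes>\<^bsub>R\<^esub> c y) = (\<Oplus>\<^bsub>?R\<^esub>y\<in>V. j (i m x) y \<odot>\<^bsub>?R\<^esub> c y)"
        unfolding smultR
        by (rule idR.hom_finsum[symmetric]) (use \<phi>j cV in \<open>auto simp: ideal_lmodule_def\<close>)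
      also have "\<dots> = free_lift S ?R c (j (i m x))"
        by (rule R'.free_lift_superset[symmetric]) (use UV closed(2)[OF m] cV in \<open>auto simp: ideal_lmodule_def\<close>)
      also have "\<dots> = i m x"
        by (rule jc) (use closed(1)[OF m] in \<open>simp add: ideal_lmodule_def\<close>)
      finally show ?thesis .
    qed
    have "free_lift S ?P ?b (?I m) = (\<Oplus>\<^bsub>?P\<^esub>x\<in>U. \<Oplus>\<^bsub>?P\<^esub>y\<in>V. ?I m (x, y) \<odot>\<^bsub>?P\<^esub> ?b (x, y))"
    proof (rule P'.free_lift_Times)
      show "?I m (x, y) = \<zero>\<^bsub>S\<^esub>" if "\<not> (x \<in> U \<and> y \<in> V)" for x y
        using that UV(5)[of x] UV(6)[of y x] j0 by auto
    qed (use UV closed(2)[OF m] cV bU in auto)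
    also have "\<dots> = (\<Oplus>\<^bsub>?P\<^esub>x\<in>U. i m x \<odot>\<^bsub>P\<^esub> b x)"
      by (rule P'.M.finsum_cong') (use row closed(1)[OF m] bU in auto)
    also have "\<dots> = (\<Oplus>\<^bsub>P\<^esub>x\<in>U. i m x \<odot>\<^bsub>P\<^esub> b x)"
      by (rule id.hom_finsum) (use closed(1)[OF m] bU in auto)
    also have "\<dots> = free_lift R P b (i m)"
      by (rule P.free_lift_superset[symmetric]) (use UV closed(1)[OF m] bU in auto)
    also have "\<dots> = m" by (rule ib[OF m])
    finally show "free_lift S ?P ?b (?I m) = m" .
  qed
qed


section \<open>Tensor products\<close>

locale tensor_product = M: unital_algebra K M + N: unital_algebra K N
  for K :: "('k, 'p) ring_scheme" and M :: "('k, 'a, 'q) module_scheme" and N :: "('k, 'b, 's) module_scheme"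
begin

abbreviation "T \<equiv> tensor K M N"

definition pure :: "'a \<Rightarrow> 'b \<Rightarrow> ('a \<times> 'b \<Rightarrow>\<^sub>0 int) set"
  where "pure x y = tensor_kernel K M N +>\<^bsub>free_pairs M N\<^esub> frag_of (x, y)"

sublocale T: ring T
  by (rule ring_tensor[OF M.unital_algebra_axioms N.unital_algebra_axioms])

lemma ideal_kernel: "ideal (tensor_kernel K M N) (free_pairs M N)"
  by (rule ideal_tensor_kernel[OF M.unital_algebra_axioms N.unital_algebra_axioms])

lemma coset_ring_hom: "ring_hom_ring (free_pairs M N) T ((+>\<^bsub>free_pairs M N\<^esub>) (tensor_kernel K M N))"
  unfolding tensor_def by (rule ideal.rcos_ring_hom_ring[OF ideal_kernel])

lemma frag_of_closed [simp]: "\<lbrakk>x \<in> carrier M; y \<in> carrier N\<rbrakk> \<Longrightarrow> frag_of (x, y) \<in> carrier (free_pairs M N)"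
  by (simp add: free_pairs_def)

lemma pure_closed [simp]: "\<lbrakk>x \<in> carrier M; y \<in> carrier N\<rbrakk> \<Longrightarrow> pure x y \<in> carrier T"
proof -
  interpret q: ring_hom_ring "free_pairs M N" T "(+>\<^bsub>free_pairs M N\<^esub>) (tensor_kernel K M N)"
    by (rule coset_ring_hom)
  show "\<lbrakk>x \<in> carrier M; y \<in> carrier N\<rbrakk> \<Longrightarrow> pure x y \<in> carrier T" by (simp add: pure_def)
qed

lemma tensor_carrierE:
  assumes "X \<in> carrier T"
  obtains f where "f \<in> carrier (free_pairs M N)" "X = tensor_kernel K M N +>\<^bsub>free_pairs M N\<^esub> f"
  using assms unfolding tensor_def FactRing_def A_RCOSETS_def RCOSETS_def by (auto simp: a_r_coset_def)

lemma coset_eqI: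
  assumes "f \<in> carrier (free_pairs M N)" "g \<in> carrier (free_pairs M N)" "f - g \<in> tensor_relations K M N"
  shows "tensor_kernel K M N +>\<^bsub>free_pairs M N\<^esub> f = tensor_kernel K M N +>\<^bsub>free_pairs M N\<^esub> g"
proof -
  interpret I: ideal "tensor_kernel K M N" "free_pairs M N" by (rule ideal_kernel)
  have "f \<ominus>\<^bsub>free_pairs M N\<^esub> g = f - g"
    using assms by (simp add: a_minus_def a_inv_free_pairs) (simp add: free_pairs_def)
  moreover have "f - g \<in> tensor_kernel K M N"
    using assms(3) by (simp add: tensor_kernel_def generate.incl)
  ultimately show ?thesis
    using I.quotient_eq_iff_same_a_r_cos[OF ideal_kernel assms(1,2)] by simp
qed

lemma pure_add_left:
  assumes "x \<in> carrier M" "x' \<in> carrier M" "y \<in> carrier N"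
  shows "pure (x \<oplus>\<^bsub>M\<^esub> x') y = pure x y \<oplus>\<^bsub>T\<^esub> pure x' y"
proof -
  interpret q: ring_hom_ring "free_pairs M N" T "(+>\<^bsub>free_pairs M N\<^esub>) (tensor_kernel K M N)"
    by (rule coset_ring_hom)
  have "pure (x \<oplus>\<^bsub>M\<^esub> x') y = tensor_kernel K M N +>\<^bsub>free_pairs M N\<^esub> (frag_of (x, y) \<oplus>\<^bsub>free_pairs M N\<^esub> frag_of (x', y))"
    unfolding pure_def
    by (rule coset_eqI) (use assms q.R.a_closed in \<open>auto simp: free_pairs_def tensor_relations_def\<close>)
  then show ?thesis using assms by (simp add: pure_def)
qed

lemma pure_add_right:
  assumes "x \<in> carrier M" "y \<in> carrier N" "y' \<in> carrier N"
  shows "pure x (y \<oplus>\<^bsub>N\<^esub> y') = pure x y \<oplus>\<^bsub>T\<^esub> pure x y'"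
proof -
  interpret q: ring_hom_ring "free_pairs M N" T "(+>\<^bsub>free_pairs M N\<^esub>) (tensor_kernel K M N)"
    by (rule coset_ring_hom)
  have "pure x (y \<oplus>\<^bsub>N\<^esub> y') = tensor_kernel K M N +>\<^bsub>free_pairs M N\<^esub> (frag_of (x, y) \<oplus>\<^bsub>free_pairs M N\<^esub> frag_of (x, y'))"
    unfolding pure_def
    by (rule coset_eqI) (use assms q.R.a_closed in \<open>auto simp: free_pairs_def tensor_relations_def\<close>)
  then show ?thesis using assms by (simp add: pure_def)
qed

lemma pure_smult:
  assumes "k \<in> carrier K" "x \<in> carrier M" "y \<in> carrier N"
  shows "pure (k \<odot>\<^bsub>M\<^esub> x) y = pure x (k \<odot>\<^bsub>N\<^esub> y)"
  unfolding pure_def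
  by (rule coset_eqI) (use assms in \<open>auto simp: free_pairs_def tensor_relations_def\<close>)

lemma pure_mult:
  assumes "x \<in> carrier M" "x' \<in> carrier M" "y \<in> carrier N" "y' \<in> carrier N"
  shows "pure x y \<otimes>\<^bsub>T\<^esub> pure x' y' = pure (x \<otimes>\<^bsub>M\<^esub> x') (y \<otimes>\<^bsub>N\<^esub> y')"
proof -
  interpret q: ring_hom_ring "free_pairs M N" T "(+>\<^bsub>free_pairs M N\<^esub>) (tensor_kernel K M N)"
    by (rule coset_ring_hom)
  have "frag_of (x, y) \<otimes>\<^bsub>free_pairs M N\<^esub> frag_of (x', y') = frag_of (x \<otimes>\<^bsub>M\<^esub> x', y \<otimes>\<^bsub>N\<^esub> y')"
    by (simp add: free_pairs_def)
  then show ?thesis using assms q.hom_mult[of "frag_of (x, y)" "frag_of (x', y')"] by (simp add: pure_def)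
qed

lemma tensor_one: "\<one>\<^bsub>T\<^esub> = pure \<one>\<^bsub>M\<^esub> \<one>\<^bsub>N\<^esub>"
  by (simp add: tensor_def FactRing_def pure_def) (simp add: free_pairs_def)

lemma pure_left_hom: "y \<in> carrier N \<Longrightarrow> abelian_group_hom M T (\<lambda>x. pure x y)"
  by (rule abelian_group_homI') (auto simp: pure_add_left M.M.abelian_group_axioms T.is_abelian_group)

lemma pure_right_hom: "x \<in> carrier M \<Longrightarrow> abelian_group_hom N T (pure x)"
  by (rule abelian_group_homI') (auto simp: pure_add_right N.M.abelian_group_axioms T.is_abelian_group)

lemma pure_zero [simp]:
  "y \<in> carrier N \<Longrightarrow> pure \<zero>\<^bsub>M\<^esub> y = \<zero>\<^bsub>T\<^esub>" "x \<in> carrier M \<Longrightarrow> pure x \<zero>\<^bsub>N\<^esub> = \<zero>\<^bsub>T\<^esub>"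
  using abelian_group_hom.hom_zero[OF pure_left_hom] abelian_group_hom.hom_zero[OF pure_right_hom] by auto

lemma pure_finsum:
  assumes "p \<in> S \<rightarrow> carrier M" "q \<in> U \<rightarrow> carrier N"
  shows "(\<Oplus>\<^bsub>T\<^esub>s\<in>S. \<Oplus>\<^bsub>T\<^esub>u\<in>U. pure (p s) (q u)) = pure (\<Oplus>\<^bsub>M\<^esub>s\<in>S. p s) (\<Oplus>\<^bsub>N\<^esub>u\<in>U. q u)"
proof -
  have q: "(\<Oplus>\<^bsub>N\<^esub>u\<in>U. q u) \<in> carrier N" by (rule N.M.finsum_closed[OF assms(2)])
  have row: "pure x (\<Oplus>\<^bsub>N\<^esub>u\<in>U. q u) = (\<Oplus>\<^bsub>T\<^esub>u\<in>U. pure x (q u))" if "x \<in> carrier M" for x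
    by (rule abelian_group_hom.hom_finsum[OF pure_right_hom[OF that] assms(2)])
  have "(\<Oplus>\<^bsub>T\<^esub>s\<in>S. \<Oplus>\<^bsub>T\<^esub>u\<in>U. pure (p s) (q u)) = (\<Oplus>\<^bsub>T\<^esub>s\<in>S. pure (p s) (\<Oplus>\<^bsub>N\<^esub>u\<in>U. q u))"
    by (rule T.finsum_cong') (use assms q row in \<open>auto simp: Pi_iff\<close>)
  then show ?thesis
    using abelian_group_hom.hom_finsum[OF pure_left_hom[OF q] assms(1)] by simp
qed

text \<open>Every tensor is a sum of pure tensors without signs, because -(x \<otimes> y) = (-x)
  \<otimes> y. Zero is pure as well, so there is no case for it.\<close>

lemma tensor_induct [consumes 1, case_names pure add]:
  assumes X: "X \<in> carrier T"
    and pure: "\<And>x y. \<lbrakk>x \<in> carrier M; y \<in> carrier N\<rbrakk> \<Longrightarrow> Q (pure x y)"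
    and add: "\<And>X Y. \<lbrakk>X \<in> carrier T; Y \<in> carrier T; Q X; Q Y\<rbrakk> \<Longrightarrow> Q (X \<oplus>\<^bsub>T\<^esub> Y)"
  shows "Q X"
proof -
  interpret q: ring_hom_ring "free_pairs M N" T "(+>\<^bsub>free_pairs M N\<^esub>) (tensor_kernel K M N)"
    by (rule coset_ring_hom)
  let ?q = "\<lambda>f. tensor_kernel K M N +>\<^bsub>free_pairs M N\<^esub> f"
  have carr: "f \<in> carrier (free_pairs M N) \<longleftrightarrow> Poly_Mapping.keys f \<subseteq> carrier M \<times> carrier N" for f
    by (simp add: free_pairs_def)
  obtain f where f: "f \<in> carrier (free_pairs M N)" "X = ?q f"
    using X by (rule tensor_carrierE)
  have zero: "?q 0 = \<zero>\<^bsub>T\<^esub>"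
    using q.hom_zero by (simp add: free_pairs_def)
  \<comment> \<open>The induction on formal sums proceeds by differences while \<open>add\<close>
    only handles sums, so the claim for the negative is carried along.\<close>
  have "f \<in> carrier (free_pairs M N) \<and> Q (?q f) \<and> Q (\<ominus>\<^bsub>T\<^esub> ?q f)"
    using f(1)[unfolded carr]
  proof (induction f rule: frag_induction)
    case zero
    show ?case using pure[of "\<zero>\<^bsub>M\<^esub>" "\<zero>\<^bsub>N\<^esub>"] by (simp add: \<open>?q 0 = \<zero>\<^bsub>T\<^esub>\<close> carr)
  next
    case (one u)
    then obtain x y where u: "u = (x, y)" "x \<in> carrier M" "y \<in> carrier N" by auto
    have "\<ominus>\<^bsub>T\<^esub> pure x y = pure (\<ominus>\<^bsub>M\<^esub> x) y"
      using abelian_group_hom.hom_a_inv[OF pure_left_hom[OF u(3)] u(2)] by simp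
    then show ?case
      using pure[OF u(2,3)] pure[OF M.M.a_inv_closed[OF u(2)] u(3)] u(2,3) by (simp add: u(1) pure_def)
  next
    case (diff f g)
    have fg: "f - g = f \<ominus>\<^bsub>free_pairs M N\<^esub> g"
      using diff by (simp add: a_minus_def a_inv_free_pairs) (simp add: free_pairs_def)
    have "?q (f - g) = ?q f \<oplus>\<^bsub>T\<^esub> \<ominus>\<^bsub>T\<^esub> ?q g" "\<ominus>\<^bsub>T\<^esub> ?q (f - g) = \<ominus>\<^bsub>T\<^esub> ?q f \<oplus>\<^bsub>T\<^esub> ?q g"
      using diff unfolding fg by (simp_all add: a_minus_def T.minus_add)
    then show ?case
      using diff by (auto simp: fg intro!: add)
  qed
  then show ?thesis using f(2) by blast
qed

lemma tensor_lift_hom: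
  assumes L: "abelian_group L" and \<beta>: "\<beta> \<in> carrier M \<times> carrier N \<rightarrow> carrier L"
    and l: "\<And>x x' y. \<lbrakk>x \<in> carrier M; x' \<in> carrier M; y \<in> carrier N\<rbrakk> \<Longrightarrow>
      \<beta> (x \<oplus>\<^bsub>M\<^esub> x', y) = \<beta> (x, y) \<oplus>\<^bsub>L\<^esub> \<beta> (x', y)"
    and r: "\<And>x y y'. \<lbrakk>x \<in> carrier M; y \<in> carrier N; y' \<in> carrier N\<rbrakk> \<Longrightarrow>
      \<beta> (x, y \<oplus>\<^bsub>N\<^esub> y') = \<beta> (x, y) \<oplus>\<^bsub>L\<^esub> \<beta> (x, y')"
    and k: "\<And>k x y. \<lbrakk>k \<in> carrier K; x \<in> carrier M; y \<in> carrier N\<rbrakk> \<Longrightarrow>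
      \<beta> (k \<odot>\<^bsub>M\<^esub> x, y) = \<beta> (x, k \<odot>\<^bsub>N\<^esub> y)"
  shows "abelian_group_hom T L (tensor_lift L \<beta>)"
    and tensor_lift_pure: "\<lbrakk>x \<in> carrier M; y \<in> carrier N\<rbrakk> \<Longrightarrow> tensor_lift L \<beta> (pure x y) = \<beta> (x, y)"
proof -
  interpret L: abelian_group L by (rule L)
  interpret q: ring_hom_ring "free_pairs M N" T "(+>\<^bsub>free_pairs M N\<^esub>) (tensor_kernel K M N)"
    by (rule coset_ring_hom)
  have coset: "tensor_lift L \<beta> (tensor_kernel K M N +>\<^bsub>free_pairs M N\<^esub> f) = free_pairs_lift L \<beta> f"
    if "f \<in> carrier (free_pairs M N)" for f
    by (rule tensor_lift_coset[OF M.M.abelian_group_axioms N.M.abelian_group_axioms L \<beta> l r k])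
      (use that in auto)
  show "abelian_group_hom T L (tensor_lift L \<beta>)"
  proof (rule abelian_group_homI'[OF T.is_abelian_group L])
    fix X assume "X \<in> carrier T"
    then obtain f where f: "f \<in> carrier (free_pairs M N)" "X = tensor_kernel K M N +>\<^bsub>free_pairs M N\<^esub> f"
      by (rule tensor_carrierE)
    then show "tensor_lift L \<beta> X \<in> carrier L"
      using L.free_pairs_lift_closed[OF \<beta>, of f] by (simp add: coset) (simp add: free_pairs_def)
  next
    fix X Y assume "X \<in> carrier T" "Y \<in> carrier T"
    then obtain f g where f: "f \<in> carrier (free_pairs M N)" "X = tensor_kernel K M N +>\<^bsub>free_pairs M N\<^esub> f"
      and g: "g \<in> carrier (free_pairs M N)" "Y = tensor_kernel K M N +>\<^bsub>free_pairs M N\<^esub> g"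
      by (metis tensor_carrierE)
    have "X \<oplus>\<^bsub>T\<^esub> Y = tensor_kernel K M N +>\<^bsub>free_pairs M N\<^esub> (f \<oplus>\<^bsub>free_pairs M N\<^esub> g)"
      using f g by simp
    then have "tensor_lift L \<beta> (X \<oplus>\<^bsub>T\<^esub> Y) = free_pairs_lift L \<beta> (f \<oplus>\<^bsub>free_pairs M N\<^esub> g)"
      using coset[OF q.R.a_closed[OF f(1) g(1)]] by simp
    also have "\<dots> = free_pairs_lift L \<beta> f \<oplus>\<^bsub>L\<^esub> free_pairs_lift L \<beta> g"
      using f(1) g(1) L.free_pairs_lift_add[OF \<beta>, of f g] by (simp add: free_pairs_def)
    finally show "tensor_lift L \<beta> (X \<oplus>\<^bsub>T\<^esub> Y) = tensor_lift L \<beta> X \<oplus>\<^bsub>L\<^esub> tensor_lift L \<beta> Y"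
      using f g coset by simp
  qed
  show "tensor_lift L \<beta> (pure x y) = \<beta> (x, y)" if "x \<in> carrier M" "y \<in> carrier N"
    using that coset[of "frag_of (x, y)"] \<beta> by (auto simp: pure_def intro!: L.free_pairs_lift_of)
qed

end

definition tensor_map ::
    "('k, 'p) ring_scheme \<Rightarrow> ('k, 'c, 'q) module_scheme \<Rightarrow> ('k, 'd, 's) module_scheme \<Rightarrow>
      ('a \<Rightarrow> 'c) \<Rightarrow> ('b \<Rightarrow> 'd) \<Rightarrow> ('a \<times> 'b \<Rightarrow>\<^sub>0 int) set \<Rightarrow> ('c \<times> 'd \<Rightarrow>\<^sub>0 int) set"
  where "tensor_map K M' N' \<alpha> \<beta> =
    tensor_lift (tensor K M' N') (\<lambda>(x, y). tensor_product.pure K M' N' (\<alpha> x) (\<beta> y))"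

lemma tensor_map:
  assumes MN: "tensor_product K M N" and MN': "tensor_product K M' N'"
    and \<alpha>: "\<alpha> \<in> lmodule_hom K M M'" and \<beta>: "\<beta> \<in> lmodule_hom K N N'"
  shows tensor_map_hom: "abelian_group_hom (tensor K M N) (tensor K M' N') (tensor_map K M' N' \<alpha> \<beta>)"
    and tensor_map_pure: "\<lbrakk>x \<in> carrier M; y \<in> carrier N\<rbrakk> \<Longrightarrow>
      tensor_map K M' N' \<alpha> \<beta> (tensor_product.pure K M N x y) = tensor_product.pure K M' N' (\<alpha> x) (\<beta> y)"
proof -
  interpret MN: tensor_product K M N by (rule MN)
  interpret MN': tensor_product K M' N' by (rule MN')
  note lift = MN.tensor_lift_hom[OF MN'.T.is_abelian_group, of "\<lambda>(x, y). MN'.pure (\<alpha> x) (\<beta> y)"]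
    MN.tensor_lift_pure[OF MN'.T.is_abelian_group, of "\<lambda>(x, y). MN'.pure (\<alpha> x) (\<beta> y)"]
  show "abelian_group_hom (tensor K M N) (tensor K M' N') (tensor_map K M' N' \<alpha> \<beta>)"
    unfolding tensor_map_def
    by (rule lift(1)) (auto simp: lmodule_homD[OF \<alpha>] lmodule_homD[OF \<beta>] MN'.pure_add_left MN'.pure_add_right MN'.pure_smult)
  show "tensor_map K M' N' \<alpha> \<beta> (MN.pure x y) = MN'.pure (\<alpha> x) (\<beta> y)"
    if "x \<in> carrier M" "y \<in> carrier N"
    unfolding tensor_map_def
    by (subst lift(2))
      (use that in \<open>auto simp: lmodule_homD[OF \<alpha>] lmodule_homD[OF \<beta>] MN'.pure_add_left MN'.pure_add_right MN'.pure_smult\<close>)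
qed


section \<open>Ideals of the enveloping algebra\<close>

lemma (in unital_algebra) tensor_product_opposite: "tensor_product K A (opposite A)"
  by (rule tensor_product.intro[OF unital_algebra_axioms unital_algebra_opposite])

lemma (in unital_algebra) enveloping_smult_pure:
  assumes "a \<in> carrier A" "b \<in> carrier A" "x \<in> carrier A"
  shows "tensor_product.pure K A (opposite A) a b \<odot>\<^bsub>enveloping_module A\<^esub> x = a \<otimes>\<^bsub>A\<^esub> x \<otimes>\<^bsub>A\<^esub> b"
proof -
  interpret E: tensor_product K A "opposite A" by (rule tensor_product_opposite)
  show ?thesis
    using enveloping_module_smult[of "frag_of (a, b)" x] assms
    by (simp add: E.pure_def)
qed

text \<open>A K-linear projection of \<open>B\<close> onto the ideal. It makes the tensor product of
  two such ideals a direct summand of the enveloping algebra, so that this product can be treated as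
  a subset.\<close>

definition ideal_retraction ::
    "('k, 'p) ring_scheme \<Rightarrow> ('k, 'b, 'q) module_scheme \<Rightarrow> 'b set \<Rightarrow> ('b \<Rightarrow> 'b) \<Rightarrow> bool"
  where "ideal_retraction K B I \<rho> \<longleftrightarrow> ideal I B \<and> \<rho> \<in> lmodule_hom K B B \<and>
    (\<forall>x\<in>carrier B. \<rho> x \<in> I) \<and> (\<forall>x\<in>I. \<rho> x = x)"

lemma ideal_retractionD:
  assumes "ideal_retraction K B I \<rho>"
  shows "ideal I B" "\<rho> \<in> lmodule_hom K B B" "x \<in> carrier B \<Longrightarrow> \<rho> x \<in> I" "x \<in> I \<Longrightarrow> \<rho> x = x"
  using assms by (auto simp: ideal_retraction_def)

lemma lmodule_hom_opposite [simp]: "lmodule_hom K (opposite B) (opposite C) = lmodule_hom K B C"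
  by (simp add: lmodule_hom_def)

lemma ideal_retraction_opposite: "ideal_retraction K B I \<rho> \<Longrightarrow> ideal_retraction K (opposite B) I \<rho>"
  by (simp add: ideal_retraction_def ideal_opposite)

text \<open>This is I \<otimes> J for the images I and J of the two retractions: the image of the
  idempotent \<open>\<rho> \<otimes> \<sigma>\<close>, written as its set of fixed tensors.\<close>

definition tensor_ideal ::
    "('k, 'p) ring_scheme \<Rightarrow> ('k, 'b, 'q) module_scheme \<Rightarrow> ('b \<Rightarrow> 'b) \<Rightarrow> ('b \<Rightarrow> 'b) \<Rightarrow> ('b \<times> 'b \<Rightarrow>\<^sub>0 int) set set"
  where "tensor_ideal K B \<rho> \<sigma> =
    {x \<in> carrier (enveloping_algebra K B). tensor_map K B (opposite B) \<rho> \<sigma> x = x}"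

context
  fixes K :: "('k, 'p) ring_scheme" and B :: "('k, 'b, 'q) module_scheme"
    and I J :: "'b set" and \<rho> \<sigma> :: "'b \<Rightarrow> 'b"
  assumes B: "unital_algebra K B"
    and \<rho>: "ideal_retraction K B I \<rho>" and \<sigma>: "ideal_retraction K B J \<sigma>"
begin

interpretation B: unital_algebra K B by (rule B)
interpretation E: tensor_product K B "opposite B" by (rule B.tensor_product_opposite)
interpretation I: ideal I B by (rule ideal_retractionD[OF \<rho>])
interpretation J: ideal J B by (rule ideal_retractionD[OF \<sigma>])

lemma retraction_closed:
  "x \<in> carrier B \<Longrightarrow> \<rho> x \<in> carrier B" "x \<in> carrier B \<Longrightarrow> \<sigma> x \<in> carrier B"
  using lmodule_homD(1) ideal_retractionD(2)[OF \<rho>] ideal_retractionD(2)[OF \<sigma>] by metis+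

lemma tensor_retraction_hom:
  "abelian_group_hom E.T E.T (tensor_map K B (opposite B) \<rho> \<sigma>)"
  by (rule tensor_map_hom[OF E.tensor_product_axioms E.tensor_product_axioms])
    (simp_all add: ideal_retractionD(2)[OF \<rho>] ideal_retractionD(2)[OF \<sigma>])

lemma tensor_retraction_pure:
  "\<lbrakk>x \<in> carrier B; y \<in> carrier B\<rbrakk> \<Longrightarrow> tensor_map K B (opposite B) \<rho> \<sigma> (E.pure x y) = E.pure (\<rho> x) (\<sigma> y)"
  by (rule tensor_map_pure[OF E.tensor_product_axioms E.tensor_product_axioms])
    (simp_all add: ideal_retractionD(2)[OF \<rho>] ideal_retractionD(2)[OF \<sigma>])

interpretation r: abelian_group_hom E.T E.T "tensor_map K B (opposite B) \<rho> \<sigma>"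
  by (rule tensor_retraction_hom)

text \<open>The enveloping algebra multiplies the first factor from the left and, through the
  opposite multiplication, the second factor from the right. The ideals absorb these factors, so the
  fixed tensors form a left ideal.\<close>

lemma tensor_retraction_smult:
  assumes e: "e \<in> carrier E.T" and t: "t \<in> carrier E.T"
  shows "tensor_map K B (opposite B) \<rho> \<sigma> (e \<otimes>\<^bsub>E.T\<^esub> tensor_map K B (opposite B) \<rho> \<sigma> t)
    = e \<otimes>\<^bsub>E.T\<^esub> tensor_map K B (opposite B) \<rho> \<sigma> t"
  using e
proof (induction e rule: E.tensor_induct)
  case (pure c c')
  show ?case
    using t
  proof (induction t rule: E.tensor_induct)
    case (pure b b')
    note [simp] = ideal_retractionD(3,4)[OF \<rho>] ideal_retractionD(3,4)[OF \<sigma>] retraction_closed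
    from pure \<open>c \<in> carrier B\<close> \<open>c' \<in> carrier (opposite B)\<close> show ?case
      by (simp add: tensor_retraction_pure E.pure_mult I.I_l_closed J.I_r_closed)
  next
    case (add X Y)
    then show ?case using pure by (simp add: E.T.r_distr)
  qed
next
  case (add X Y)
  then show ?case using t by (simp add: E.T.l_distr)
qed

lemma lmodule_tensor_ideal:
  "lmodule (enveloping_algebra K B) (ideal_lmodule (enveloping_algebra K B) (tensor_ideal K B \<rho> \<sigma>))"
proof -
  have reg: "lmodule E.T (ideal_lmodule E.T (carrier E.T))"
    by (rule lmodule_ideal_lmodule[OF E.T.oneideal])
  have "lmodule E.T ((ideal_lmodule E.T (carrier E.T))\<lparr>carrier := tensor_ideal K B \<rho> \<sigma>\<rparr>)"
  proof (rule lmodule_submodule[OF reg])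
    fix a x assume "a \<in> carrier E.T" "x \<in> tensor_ideal K B \<rho> \<sigma>"
    then show "a \<odot>\<^bsub>ideal_lmodule E.T (carrier E.T)\<^esub> x \<in> tensor_ideal K B \<rho> \<sigma>"
      using tensor_retraction_smult[of a x] by (auto simp: tensor_ideal_def enveloping_algebra_def)
  qed (auto simp: tensor_ideal_def enveloping_algebra_def)
  then show ?thesis by (simp add: ideal_lmodule_def enveloping_algebra_def)
qed

end

text \<open>Coordinate functions on an ideal are linear over the algebra, and \<open>k\<close> acts
  like the ring element \<open>k\<close> times one; hence they are K-linear. Composed with the
  retraction they are defined on the whole algebra, so that \<open>tensor_map\<close> applies to
  them.\<close>

lemma (in unital_algebra) ideal_coordinate_hom:
  assumes \<rho>: "ideal_retraction K A I \<rho>" and i: "i \<in> lmodule_hom A (ideal_lmodule A I) (free_lmodule A X)"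
  shows "(\<lambda>b. i (\<rho> b) x) \<in> lmodule_hom K A A"
proof (rule lmodule_homI)
  interpret I: ideal I A by (rule ideal_retractionD[OF \<rho>])
  note \<rho>_hom = lmodule_homD[OF ideal_retractionD(2)[OF \<rho>]]
  note \<rho>_I = ideal_retractionD(3)[OF \<rho>]
  have i_carr: "i v y \<in> carrier A" if "v \<in> I" for v y
    using lmodule_hom_closed[OF i, of v] that by (simp add: carrier_free_lmodule)
  show "i (\<rho> b) x \<in> carrier A" if "b \<in> carrier A" for b using i_carr \<rho>_I that by simp
  show "i (\<rho> (b \<oplus>\<^bsub>A\<^esub> c)) x = i (\<rho> b) x \<oplus>\<^bsub>A\<^esub> i (\<rho> c) x" if "b \<in> carrier A" "c \<in> carrier A" for b c
    using lmodule_hom_add[OF i, of "\<rho> b" "\<rho> c"] \<rho>_I that by (simp add: \<rho>_hom)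
  show "i (\<rho> (k \<odot>\<^bsub>A\<^esub> b)) x = k \<odot>\<^bsub>A\<^esub> i (\<rho> b) x" if k: "k \<in> carrier K" and b: "b \<in> carrier A" for k b
  proof -
    have "\<rho> (k \<odot>\<^bsub>A\<^esub> b) = (k \<odot>\<^bsub>A\<^esub> \<one>\<^bsub>A\<^esub>) \<otimes>\<^bsub>A\<^esub> \<rho> b"
      using k b by (simp add: \<rho>_hom smult_assoc_l)
    then show ?thesis
      using lmodule_hom_smult[OF i, of "k \<odot>\<^bsub>A\<^esub> \<one>\<^bsub>A\<^esub>" "\<rho> b"] k b \<rho>_I[OF b] i_carr
      by (simp add: smult_assoc_l)
  qed
qed

text \<open>The tensors \<open>b x \<otimes> c y\<close> of two dual bases form a dual basis of the
  tensor product. Its coordinate functions \<open>\<Phi>\<close> are the tensor products of the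
  coordinate functions of the factors, extended by the retractions.\<close>

lemma projective_tensor_ideal:
  fixes K :: "('k, 'p) ring_scheme" and B :: "('k, 'b, 'q) module_scheme"
  assumes B: "unital_algebra K B"
    and \<rho>: "ideal_retraction K B I \<rho>" and \<sigma>: "ideal_retraction K B J \<sigma>"
    and PI: "projective_lmodule B (ideal_lmodule B I)"
    and PJ: "projective_lmodule (opposite B) (ideal_lmodule (opposite B) J)"
  shows "projective_lmodule (enveloping_algebra K B)
    (ideal_lmodule (enveloping_algebra K B) (tensor_ideal K B \<rho> \<sigma>))"
proof -
  interpret B: unital_algebra K B by (rule B)
  interpret O: unital_algebra K "opposite B" by (rule B.unital_algebra_opposite)
  interpret E: tensor_product K B "opposite B" by (rule B.tensor_product_opposite)
  interpret I: ideal I B by (rule ideal_retractionD[OF \<rho>])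
  interpret J: ideal J B by (rule ideal_retractionD[OF \<sigma>])
  let ?E = "enveloping_algebra K B" and ?T = "tensor_ideal K B \<rho> \<sigma>" and ?r = "tensor_map K B (opposite B) \<rho> \<sigma>"
  have E: "?E = E.T" by (simp add: enveloping_algebra_def)
  interpret r: abelian_group_hom E.T E.T ?r by (rule tensor_retraction_hom[OF B \<rho> \<sigma>])
  note r_pure = tensor_retraction_pure[OF B \<rho> \<sigma>]
  note retr [simp] = ideal_retractionD(3,4)[OF \<rho>] ideal_retractionD(3,4)[OF \<sigma>]
  note retr_closed [simp] = retraction_closed[OF B \<rho> \<sigma>]
  interpret T: lmodule E.T "ideal_lmodule E.T ?T"
    using lmodule_tensor_ideal[OF B \<rho> \<sigma>] by (simp add: E)
  obtain X :: "'b set" and i b where i: "i \<in> lmodule_hom B (ideal_lmodule B I) (free_lmodule B X)"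
    and b: "b \<in> X \<rightarrow> carrier (ideal_lmodule B I)"
    and ib: "\<And>x. x \<in> carrier (ideal_lmodule B I) \<Longrightarrow> free_lift B (ideal_lmodule B I) b (i x) = x"
    by (rule projective_lmoduleE[OF PI]) (rule that)
  obtain Y :: "'b set" and j c where j: "j \<in> lmodule_hom (opposite B) (ideal_lmodule (opposite B) J) (free_lmodule (opposite B) Y)"
    and c: "c \<in> Y \<rightarrow> carrier (ideal_lmodule (opposite B) J)"
    and jc: "\<And>x. x \<in> carrier (ideal_lmodule (opposite B) J) \<Longrightarrow> free_lift (opposite B) (ideal_lmodule (opposite B) J) c (j x) = x"
    by (rule projective_lmoduleE[OF PJ]) (rule that)
  have i_carr: "i v \<in> carrier (free_lmodule B X)" if "v \<in> I" for v
    using lmodule_hom_closed[OF i, of v] that by simp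
  have j_carr: "j v \<in> carrier (free_lmodule (opposite B) Y)" if "v \<in> J" for v
    using lmodule_hom_closed[OF j, of v] that by simp
  have ij_closed: "v \<in> I \<Longrightarrow> i v x \<in> carrier B" "w \<in> J \<Longrightarrow> j w y \<in> carrier B" for v w x y
    using i_carr[of v] j_carr[of w] by (auto simp: carrier_free_lmodule)
  have i_smult: "i (d \<otimes>\<^bsub>B\<^esub> v) x = d \<otimes>\<^bsub>B\<^esub> i v x" if "d \<in> carrier B" "v \<in> I" for d v x
    using lmodule_hom_smult[OF i, of d v] that by simp
  have j_smult: "j (w \<otimes>\<^bsub>B\<^esub> d) y = j w y \<otimes>\<^bsub>B\<^esub> d" if "d \<in> carrier B" "w \<in> J" for d w y
    using lmodule_hom_smult[OF j, of d w] that by simp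
  \<comment> \<open>The expansions along the two dual bases hold in the module records of the
    ideals; they are restated as sums in \<open>B\<close> and its opposite, the form in which
    \<open>pure_finsum\<close> can multiply them out.\<close>
  have sums: "(\<Oplus>\<^bsub>B\<^esub>x\<in>{x. i v x \<noteq> \<zero>\<^bsub>B\<^esub>}. i v x \<otimes>\<^bsub>B\<^esub> b x) = v"
      "(\<Oplus>\<^bsub>opposite B\<^esub>y\<in>{y. j w y \<noteq> \<zero>\<^bsub>B\<^esub>}. c y \<otimes>\<^bsub>B\<^esub> j w y) = w" if v: "v \<in> I" and w: "w \<in> J" for v w
  proof -
    interpret h: abelian_group_hom "ideal_lmodule B I" B "\<lambda>x. x"
      by (rule abelian_group_homI'[OF lmodule_abelian_group[OF lmodule_ideal_lmodule[OF I.ideal_axioms]] B.A.is_abelian_group])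
        (auto simp: I.a_Hcarr)
    interpret k: abelian_group_hom "ideal_lmodule (opposite B) J" "opposite B" "\<lambda>x. x"
      by (rule abelian_group_homI'[OF lmodule_abelian_group[OF lmodule_ideal_lmodule[OF ideal_opposite[OF J.ideal_axioms]]] O.A.is_abelian_group])
        (auto simp: J.a_Hcarr)
    have "b x \<in> I" if "i v x \<noteq> \<zero>\<^bsub>B\<^esub>" for x
      using i_carr[OF v] b that by (auto simp: carrier_free_lmodule Pi_iff)
    then show "(\<Oplus>\<^bsub>B\<^esub>x\<in>{x. i v x \<noteq> \<zero>\<^bsub>B\<^esub>}. i v x \<otimes>\<^bsub>B\<^esub> b x) = v"
      using h.hom_finsum[of "\<lambda>x. i v x \<otimes>\<^bsub>B\<^esub> b x" "{x. i v x \<noteq> \<zero>\<^bsub>B\<^esub>}"] ib[of v] v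
      by (simp add: free_lift_def Pi_iff I.I_l_closed ij_closed)
    have "c y \<in> J" if "j w y \<noteq> \<zero>\<^bsub>B\<^esub>" for y
      using j_carr[OF w] c that by (auto simp: carrier_free_lmodule Pi_iff)
    then show "(\<Oplus>\<^bsub>opposite B\<^esub>y\<in>{y. j w y \<noteq> \<zero>\<^bsub>B\<^esub>}. c y \<otimes>\<^bsub>B\<^esub> j w y) = w"
      using k.hom_finsum[of "\<lambda>y. c y \<otimes>\<^bsub>B\<^esub> j w y" "{y. j w y \<noteq> \<zero>\<^bsub>B\<^esub>}"] jc[of w] w
      by (simp add: free_lift_def Pi_iff J.I_r_closed ij_closed)
  qed
  define \<Phi> where "\<Phi> z = tensor_map K B (opposite B) (\<lambda>b. i (\<rho> b) (fst z)) (\<lambda>b. j (\<sigma> b) (snd z))" for z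
  have coord: "(\<lambda>b. i (\<rho> b) x) \<in> lmodule_hom K B B"
      "(\<lambda>b. j (\<sigma> b) y) \<in> lmodule_hom K (opposite B) (opposite B)" for x y
    by (rule B.ideal_coordinate_hom[OF \<rho> i] O.ideal_coordinate_hom[OF ideal_retraction_opposite[OF \<sigma>] j])+
  have \<Phi>_hom: "abelian_group_hom E.T E.T (\<Phi> z)" for z
    unfolding \<Phi>_def by (rule tensor_map_hom[OF E.tensor_product_axioms E.tensor_product_axioms coord])
  have \<Phi>_pure: "\<Phi> z (E.pure x y) = E.pure (i (\<rho> x) (fst z)) (j (\<sigma> y) (snd z))"
    if "x \<in> carrier B" "y \<in> carrier B" for x y z
    unfolding \<Phi>_def by (rule tensor_map_pure[OF E.tensor_product_axioms E.tensor_product_axioms coord]) (use that in auto)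
  note \<Phi>_closed = abelian_group_hom.hom_closed[OF \<Phi>_hom]
  note \<Phi>_add = abelian_group_hom.hom_add[OF \<Phi>_hom]
  let ?F = "free_lmodule E.T (X \<times> Y)"
  interpret F: lmodule E.T ?F by (rule lmodule_free_lmodule[OF E.T.ring_axioms])
  \<comment> \<open>The retractions inside \<open>\<Phi>\<close> are K-linear and need not be
    B-linear, so linearity over the enveloping algebra is claimed on tensors of the form
    \<open>?r t\<close> only.\<close>
  have \<Phi>_smult: "\<Phi> z (e \<otimes>\<^bsub>E.T\<^esub> ?r t) = e \<otimes>\<^bsub>E.T\<^esub> \<Phi> z (?r t)"
    if e: "e \<in> carrier E.T" and t: "t \<in> carrier E.T" for e t z
    using e
  proof (induction e rule: E.tensor_induct)
    case (pure d d')
    show ?case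
      using t
    proof (induction t rule: E.tensor_induct)
      case (pure x y)
      from pure \<open>d \<in> carrier B\<close> \<open>d' \<in> carrier (opposite B)\<close> show ?case
        by (simp add: r_pure E.pure_mult \<Phi>_pure I.I_l_closed J.I_r_closed i_smult j_smult ij_closed)
    next
      case (add X Y)
      then show ?case using pure by (simp add: E.T.r_distr \<Phi>_add \<Phi>_closed)
    qed
  next
    case (add X Y)
    then show ?case using t by (simp add: E.T.l_distr \<Phi>_add \<Phi>_closed)
  qed
  have pure_supp: "(\<lambda>z. \<Phi> z (E.pure x y)) \<in> carrier ?F" "finite {u. i (\<rho> x) u \<noteq> \<zero>\<^bsub>B\<^esub>}" "finite {u. j (\<sigma> y) u \<noteq> \<zero>\<^bsub>B\<^esub>}"
    if "x \<in> carrier B" "y \<in> carrier B" for x y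
  proof -
    have x: "finite {u. i (\<rho> x) u \<noteq> \<zero>\<^bsub>B\<^esub>}" "\<And>u. u \<notin> X \<Longrightarrow> i (\<rho> x) u = \<zero>\<^bsub>B\<^esub>"
      and y: "finite {u. j (\<sigma> y) u \<noteq> \<zero>\<^bsub>B\<^esub>}" "\<And>u. u \<notin> Y \<Longrightarrow> j (\<sigma> y) u = \<zero>\<^bsub>B\<^esub>"
      using i_carr[of "\<rho> x"] j_carr[of "\<sigma> y"] that by (auto simp: carrier_free_lmodule)
    have zero: "E.pure \<zero>\<^bsub>B\<^esub> u = \<zero>\<^bsub>E.T\<^esub>" "E.pure u \<zero>\<^bsub>B\<^esub> = \<zero>\<^bsub>E.T\<^esub>" if "u \<in> carrier B" for u
      using E.pure_zero(1)[of u] E.pure_zero(2)[of u] that by simp_all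
    have "{z. \<Phi> z (E.pure x y) \<noteq> \<zero>\<^bsub>E.T\<^esub>} \<subseteq> {u. i (\<rho> x) u \<noteq> \<zero>\<^bsub>B\<^esub>} \<times> {u. j (\<sigma> y) u \<noteq> \<zero>\<^bsub>B\<^esub>}"
      using that by (auto simp: \<Phi>_pure zero ij_closed)
    then have "finite {z. \<Phi> z (E.pure x y) \<noteq> \<zero>\<^bsub>E.T\<^esub>}"
      by (rule finite_subset) (simp add: x y)
    then show "(\<lambda>z. \<Phi> z (E.pure x y)) \<in> carrier ?F"
      using that x(2) y(2) by (auto simp: carrier_free_lmodule \<Phi>_closed \<Phi>_pure zero ij_closed)
    show "finite {u. i (\<rho> x) u \<noteq> \<zero>\<^bsub>B\<^esub>}" "finite {u. j (\<sigma> y) u \<noteq> \<zero>\<^bsub>B\<^esub>}" by (fact x y)+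
  qed
  have \<Phi>_F: "(\<lambda>z. \<Phi> z t) \<in> carrier ?F" if "t \<in> carrier E.T" for t
    using that
  proof (induction t rule: E.tensor_induct)
    case (pure x y)
    then show ?case by (simp add: pure_supp(1))
  next
    case (add X Y)
    then show ?case using F.M.a_closed[OF add(3,4)] by (simp add: \<Phi>_add)
  qed
  let ?b = "\<lambda>z. E.pure (b (fst z)) (c (snd z))"
  have bc: "x \<in> X \<Longrightarrow> b x \<in> I" "y \<in> Y \<Longrightarrow> c y \<in> J" "x \<in> X \<Longrightarrow> b x \<in> carrier B" "y \<in> Y \<Longrightarrow> c y \<in> carrier B" for x y
    using b c by (auto simp: Pi_iff I.a_Hcarr J.a_Hcarr)
  have b_closed: "?b \<in> X \<times> Y \<rightarrow> carrier (ideal_lmodule E.T ?T)"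
    using bc by (auto simp: tensor_ideal_def E r_pure)
  interpret reg: lmodule E.T "ideal_lmodule E.T (carrier E.T)"
    by (rule lmodule_ideal_lmodule[OF E.T.oneideal])
  have incl: "(\<lambda>x. x) \<in> lmodule_hom E.T (ideal_lmodule E.T ?T) (ideal_lmodule E.T (carrier E.T))"
    by (rule lmodule_homI) (auto simp: tensor_ideal_def E)
  have b_reg: "?b \<in> X \<times> Y \<rightarrow> carrier (ideal_lmodule E.T (carrier E.T))"
    using bc by auto
  note lift_hom = reg.free_lift_hom[OF b_reg]
  \<comment> \<open>Stated for \<open>?r t\<close> with arbitrary \<open>t\<close>: a fixed tensor
    is a sum of pure tensors that need not be fixed themselves, so an induction cannot stay among
    the fixed ones. The sums are formed in the regular module, where all summands are
    available.\<close>
  have expand: "free_lift E.T (ideal_lmodule E.T (carrier E.T)) ?b (\<lambda>z. \<Phi> z (?r t)) = ?r t"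
    if "t \<in> carrier E.T" for t
    using that
  proof (induction t rule: E.tensor_induct)
    case (pure x y)
    then have xy: "x \<in> carrier B" "y \<in> carrier B" by simp_all
    define v w where "v = \<rho> x" and "w = \<sigma> y"
    have vw: "v \<in> I" "w \<in> J" "v \<in> carrier B" "w \<in> carrier B" using xy by (simp_all add: v_def w_def)
    let ?U = "{u. i v u \<noteq> \<zero>\<^bsub>B\<^esub>}" and ?V = "{u. j w u \<noteq> \<zero>\<^bsub>B\<^esub>}"
    have U: "finite ?U" "?U \<subseteq> X" and V: "finite ?V" "?V \<subseteq> Y"
      using i_carr[OF vw(1)] j_carr[OF vw(2)] by (auto simp: carrier_free_lmodule)
    have zero: "E.pure \<zero>\<^bsub>B\<^esub> u = \<zero>\<^bsub>E.T\<^esub>" "E.pure u \<zero>\<^bsub>B\<^esub> = \<zero>\<^bsub>E.T\<^esub>" if "u \<in> carrier B" for u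
      using E.pure_zero(1)[of u] E.pure_zero(2)[of u] that by simp_all
    have "free_lift E.T (ideal_lmodule E.T (carrier E.T)) ?b (\<lambda>z. \<Phi> z (E.pure v w))
        = (\<Oplus>\<^bsub>ideal_lmodule E.T (carrier E.T)\<^esub>p\<in>?U. \<Oplus>\<^bsub>ideal_lmodule E.T (carrier E.T)\<^esub>q\<in>?V.
            \<Phi> (p, q) (E.pure v w) \<odot>\<^bsub>ideal_lmodule E.T (carrier E.T)\<^esub> ?b (p, q))"
      by (rule reg.free_lift_Times)
        (use U V bc vw in \<open>auto simp: \<Phi>_pure zero ij_closed \<Phi>_closed subset_iff\<close>)
    also have "\<dots> = (\<Oplus>\<^bsub>ideal_lmodule E.T (carrier E.T)\<^esub>p\<in>?U. \<Oplus>\<^bsub>ideal_lmodule E.T (carrier E.T)\<^esub>q\<in>?V.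
            E.pure (i v p \<otimes>\<^bsub>B\<^esub> b p) (c q \<otimes>\<^bsub>B\<^esub> j w q))"
      by (intro reg.M.finsum_cong' Pi_I reg.M.finsum_closed refl)
        (use U V bc vw in \<open>auto simp: \<Phi>_pure ij_closed E.pure_mult subset_iff\<close>)
    also have "\<dots> = (\<Oplus>\<^bsub>E.T\<^esub>p\<in>?U. \<Oplus>\<^bsub>E.T\<^esub>q\<in>?V. E.pure (i v p \<otimes>\<^bsub>B\<^esub> b p) (c q \<otimes>\<^bsub>B\<^esub> j w q))"
    proof -
      interpret id: abelian_group_hom "ideal_lmodule E.T (carrier E.T)" E.T "\<lambda>x. x"
        by (rule abelian_group_homI'[OF reg.M.abelian_group_axioms E.T.is_abelian_group]) auto
      have row: "(\<Oplus>\<^bsub>ideal_lmodule E.T (carrier E.T)\<^esub>q\<in>?V. E.pure (i v p \<otimes>\<^bsub>B\<^esub> b p) (c q \<otimes>\<^bsub>B\<^esub> j w q))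
          = (\<Oplus>\<^bsub>E.T\<^esub>q\<in>?V. E.pure (i v p \<otimes>\<^bsub>B\<^esub> b p) (c q \<otimes>\<^bsub>B\<^esub> j w q))" if "p \<in> ?U" for p
        by (rule id.hom_finsum) (use U V bc vw that in \<open>auto simp: ij_closed subset_iff\<close>)
      have cl: "(\<Oplus>\<^bsub>E.T\<^esub>q\<in>?V. E.pure (i v p \<otimes>\<^bsub>B\<^esub> b p) (c q \<otimes>\<^bsub>B\<^esub> j w q)) \<in> carrier E.T" if "p \<in> ?U" for p
        by (rule E.T.finsum_closed) (use U V bc vw that in \<open>auto simp: ij_closed subset_iff\<close>)
      have "(\<Oplus>\<^bsub>ideal_lmodule E.T (carrier E.T)\<^esub>p\<in>?U. \<Oplus>\<^bsub>ideal_lmodule E.T (carrier E.T)\<^esub>q\<in>?V.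
            E.pure (i v p \<otimes>\<^bsub>B\<^esub> b p) (c q \<otimes>\<^bsub>B\<^esub> j w q))
        = (\<Oplus>\<^bsub>ideal_lmodule E.T (carrier E.T)\<^esub>p\<in>?U. \<Oplus>\<^bsub>E.T\<^esub>q\<in>?V. E.pure (i v p \<otimes>\<^bsub>B\<^esub> b p) (c q \<otimes>\<^bsub>B\<^esub> j w q))"
        by (rule reg.M.finsum_cong') (use cl row in auto)
      also have "\<dots> = (\<Oplus>\<^bsub>E.T\<^esub>p\<in>?U. \<Oplus>\<^bsub>E.T\<^esub>q\<in>?V. E.pure (i v p \<otimes>\<^bsub>B\<^esub> b p) (c q \<otimes>\<^bsub>B\<^esub> j w q))"
        by (rule id.hom_finsum) (use cl in auto)
      finally show ?thesis .
    qed
    also have "\<dots> = E.pure v w"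
      using E.pure_finsum[of "\<lambda>p. i v p \<otimes>\<^bsub>B\<^esub> b p" ?U "\<lambda>q. c q \<otimes>\<^bsub>B\<^esub> j w q" ?V] U V bc vw sums[OF vw(1,2)]
      by (auto simp: ij_closed subset_iff Pi_iff)
    finally show ?case using xy by (simp add: r_pure v_def w_def)
  next
    case (add X Y)
    have "(\<lambda>z. \<Phi> z (?r (X \<oplus>\<^bsub>E.T\<^esub> Y))) = (\<lambda>z. \<Phi> z (?r X)) \<oplus>\<^bsub>?F\<^esub> (\<lambda>z. \<Phi> z (?r Y))"
      using add by (simp add: \<Phi>_add)
    then show ?case
      using add lmodule_hom_add[OF lift_hom \<Phi>_F \<Phi>_F, of "?r X" "?r Y"] by simp
  qed
  have "projective_lmodule E.T (ideal_lmodule E.T ?T)"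
  proof (rule projective_lmoduleI[OF T.lmodule_axioms _ b_closed])
    show "(\<lambda>t z. \<Phi> z t) \<in> lmodule_hom E.T (ideal_lmodule E.T ?T) ?F"
    proof (rule lmodule_homI)
      show "(\<lambda>z. \<Phi> z (e \<odot>\<^bsub>ideal_lmodule E.T ?T\<^esub> t)) = e \<odot>\<^bsub>?F\<^esub> (\<lambda>z. \<Phi> z t)"
        if "e \<in> carrier E.T" "t \<in> carrier (ideal_lmodule E.T ?T)" for e t
        using that \<Phi>_smult[of e t] by (auto simp: tensor_ideal_def E)
    qed (auto simp: tensor_ideal_def E \<Phi>_F \<Phi>_add)
    fix t assume "t \<in> carrier (ideal_lmodule E.T ?T)"
    then have t: "t \<in> carrier E.T" "?r t = t" by (simp_all add: tensor_ideal_def E)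
    have "free_lift E.T (ideal_lmodule E.T ?T) ?b (\<lambda>z. \<Phi> z t)
        = free_lift E.T (ideal_lmodule E.T (carrier E.T)) ?b (\<lambda>z. \<Phi> z t)"
      by (rule T.hom_free_lift[OF reg.lmodule_axioms incl b_closed \<Phi>_F[OF t(1)]])
    then show "free_lift E.T (ideal_lmodule E.T ?T) ?b (\<lambda>z. \<Phi> z t) = t"
      using expand[OF t(1)] t(2) by simp
  qed
  then show ?thesis by (simp add: E)
qed


lemma enveloping_module_simps [simp]:
  "carrier (enveloping_module R) = carrier R" "zero (enveloping_module R) = zero R" "add (enveloping_module R) = add R"
  by (simp_all add: enveloping_module_def)

section \<open>The homotope\<close>

locale homotope_algebra = unital_algebra K A
  for K :: "('k, 'p) ring_scheme" and A :: "('k, 'a, 'q) module_scheme" +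
  fixes \<Delta> :: 'a
  assumes Delta [simp]: "\<Delta> \<in> carrier A"
begin

abbreviation "B \<equiv> unital_homotope K A \<Delta>"

lemma B_simps [simp]:
  "carrier B = carrier K \<times> carrier A"
  "x \<otimes>\<^bsub>B\<^esub> y = (fst x \<otimes>\<^bsub>K\<^esub> fst y, fst x \<odot>\<^bsub>A\<^esub> snd y \<oplus>\<^bsub>A\<^esub> fst y \<odot>\<^bsub>A\<^esub> snd x \<oplus>\<^bsub>A\<^esub> snd x \<otimes>\<^bsub>A\<^esub> \<Delta> \<otimes>\<^bsub>A\<^esub> snd y)"
  "\<one>\<^bsub>B\<^esub> = (\<one>\<^bsub>K\<^esub>, \<zero>\<^bsub>A\<^esub>)" "\<zero>\<^bsub>B\<^esub> = (\<zero>\<^bsub>K\<^esub>, \<zero>\<^bsub>A\<^esub>)"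
  "x \<oplus>\<^bsub>B\<^esub> y = (fst x \<oplus>\<^bsub>K\<^esub> fst y, snd x \<oplus>\<^bsub>A\<^esub> snd y)"
  "k \<odot>\<^bsub>B\<^esub> x = (k \<otimes>\<^bsub>K\<^esub> fst x, k \<odot>\<^bsub>A\<^esub> snd x)"
  by (simp_all add: unital_homotope_def adjoin_unit_def case_prod_unfold)

interpretation B: unital_algebra K B by (rule unital_algebra_unital_homotope[OF Delta])
interpretation EA: tensor_product K A "opposite A" by (rule tensor_product_opposite)
interpretation EB: tensor_product K B "opposite B" by (rule B.tensor_product_opposite)

text \<open>The two homomorphisms \<open>B \<rightarrow> A\<close> through which \<open>B\<close> acts on the ideal \<open>A\<^sub>\<Delta>\<close> from the left and
  from the right.\<close>

definition left_hom :: "'k \<times> 'a \<Rightarrow> 'a"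
  where "left_hom x = fst x \<odot>\<^bsub>A\<^esub> \<one>\<^bsub>A\<^esub> \<oplus>\<^bsub>A\<^esub> snd x \<otimes>\<^bsub>A\<^esub> \<Delta>"

definition right_hom :: "'k \<times> 'a \<Rightarrow> 'a"
  where "right_hom x = fst x \<odot>\<^bsub>A\<^esub> \<one>\<^bsub>A\<^esub> \<oplus>\<^bsub>A\<^esub> \<Delta> \<otimes>\<^bsub>A\<^esub> snd x"

lemma left_hom_closed [simp]: "x \<in> carrier K \<times> carrier A \<Longrightarrow> left_hom x \<in> carrier A"
  and right_hom_closed [simp]: "x \<in> carrier K \<times> carrier A \<Longrightarrow> right_hom x \<in> carrier A"
  by (auto simp: left_hom_def right_hom_def)

lemma left_hom_linear: "left_hom \<in> lmodule_hom K B A"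
  by (rule lmodule_homI)
    (auto simp: left_hom_def smult_l_distr smult_r_distr A.l_distr smult_assoc1 smult_assoc_l M.a_ac)

lemma right_hom_linear: "right_hom \<in> lmodule_hom K B A"
  by (rule lmodule_homI)
    (auto simp: right_hom_def smult_l_distr smult_r_distr A.r_distr smult_assoc1 smult_assoc_r M.a_ac)

lemma left_action:
  "\<lbrakk>x \<in> carrier B; a \<in> carrier A\<rbrakk> \<Longrightarrow> x \<otimes>\<^bsub>B\<^esub> (\<zero>\<^bsub>K\<^esub>, a) = (\<zero>\<^bsub>K\<^esub>, left_hom x \<otimes>\<^bsub>A\<^esub> a)"
  by (auto simp: left_hom_def A.l_distr smult_assoc_l)

lemma right_action:
  "\<lbrakk>x \<in> carrier B; a \<in> carrier A\<rbrakk> \<Longrightarrow> (\<zero>\<^bsub>K\<^esub>, a) \<otimes>\<^bsub>B\<^esub> x = (\<zero>\<^bsub>K\<^esub>, a \<otimes>\<^bsub>A\<^esub> right_hom x)"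
  by (auto simp: right_hom_def A.r_distr smult_assoc_r A.m_assoc)

text \<open>\<open>left_hom x\<close> can be read off from the product of \<open>x\<close> with the
  element (0, 1), so multiplicativity is associativity of \<open>B\<close>.\<close>

lemma left_hom_mult:
  assumes "x \<in> carrier B" "y \<in> carrier B"
  shows "left_hom (x \<otimes>\<^bsub>B\<^esub> y) = left_hom x \<otimes>\<^bsub>A\<^esub> left_hom y"
proof -
  have "(\<zero>\<^bsub>K\<^esub>, left_hom (x \<otimes>\<^bsub>B\<^esub> y) \<otimes>\<^bsub>A\<^esub> \<one>\<^bsub>A\<^esub>) = (x \<otimes>\<^bsub>B\<^esub> y) \<otimes>\<^bsub>B\<^esub> (\<zero>\<^bsub>K\<^esub>, \<one>\<^bsub>A\<^esub>)"
    using assms by (intro left_action[symmetric] B.A.m_closed) auto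
  also have "\<dots> = x \<otimes>\<^bsub>B\<^esub> (y \<otimes>\<^bsub>B\<^esub> (\<zero>\<^bsub>K\<^esub>, \<one>\<^bsub>A\<^esub>))"
    using assms by (intro B.A.m_assoc) auto
  also have "\<dots> = (\<zero>\<^bsub>K\<^esub>, left_hom x \<otimes>\<^bsub>A\<^esub> (left_hom y \<otimes>\<^bsub>A\<^esub> \<one>\<^bsub>A\<^esub>))"
    using assms by (simp only: left_action A.one_closed A.m_closed left_hom_closed B_simps(1)[symmetric])
  finally show ?thesis
    using assms B.A.m_closed[OF assms] by (simp del: B_simps(2))
qed

lemma right_hom_mult:
  assumes "x \<in> carrier B" "y \<in> carrier B"
  shows "right_hom (x \<otimes>\<^bsub>B\<^esub> y) = right_hom x \<otimes>\<^bsub>A\<^esub> right_hom y"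
proof -
  have "(\<zero>\<^bsub>K\<^esub>, \<one>\<^bsub>A\<^esub> \<otimes>\<^bsub>A\<^esub> right_hom (x \<otimes>\<^bsub>B\<^esub> y)) = (\<zero>\<^bsub>K\<^esub>, \<one>\<^bsub>A\<^esub>) \<otimes>\<^bsub>B\<^esub> (x \<otimes>\<^bsub>B\<^esub> y)"
    using assms by (intro right_action[symmetric] B.A.m_closed) auto
  also have "\<dots> = ((\<zero>\<^bsub>K\<^esub>, \<one>\<^bsub>A\<^esub>) \<otimes>\<^bsub>B\<^esub> x) \<otimes>\<^bsub>B\<^esub> y"
    using assms by (intro B.A.m_assoc[symmetric]) auto
  also have "\<dots> = (\<zero>\<^bsub>K\<^esub>, (\<one>\<^bsub>A\<^esub> \<otimes>\<^bsub>A\<^esub> right_hom x) \<otimes>\<^bsub>A\<^esub> right_hom y)"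
    using assms by (simp only: right_action A.one_closed A.m_closed right_hom_closed B_simps(1)[symmetric])
  finally show ?thesis
    using assms B.A.m_closed[OF assms] by (simp del: B_simps(2))
qed

section \<open>The homomorphism of enveloping algebras\<close>

definition env_hom :: "(('k \<times> 'a) \<times> ('k \<times> 'a) \<Rightarrow>\<^sub>0 int) set \<Rightarrow> ('a \<times> 'a \<Rightarrow>\<^sub>0 int) set"
  where "env_hom = tensor_map K A (opposite A) left_hom right_hom"

lemma env_hom_additive: "abelian_group_hom EB.T EA.T env_hom"
  unfolding env_hom_def
  by (rule tensor_map_hom[OF EB.tensor_product_axioms EA.tensor_product_axioms left_hom_linear])
    (simp add: right_hom_linear)

lemma env_hom_pure:
  "\<lbrakk>x \<in> carrier B; y \<in> carrier B\<rbrakk> \<Longrightarrow> env_hom (EB.pure x y) = EA.pure (left_hom x) (right_hom y)"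
  unfolding env_hom_def
  by (rule tensor_map_pure[OF EB.tensor_product_axioms EA.tensor_product_axioms left_hom_linear])
    (simp_all add: right_hom_linear)

interpretation \<phi>: abelian_group_hom EB.T EA.T env_hom by (rule env_hom_additive)

lemma env_hom_ring_hom: "env_hom \<in> ring_hom (enveloping_algebra K B) (enveloping_algebra K A)"
  unfolding enveloping_algebra_def
proof (rule ring_hom_memI)
  have one: "left_hom \<one>\<^bsub>B\<^esub> = \<one>\<^bsub>A\<^esub>" "right_hom \<one>\<^bsub>B\<^esub> = \<one>\<^bsub>A\<^esub>"
    by (simp_all add: left_hom_def right_hom_def)
  show "env_hom \<one>\<^bsub>EB.T\<^esub> = \<one>\<^bsub>EA.T\<^esub>"
    using env_hom_pure[of "\<one>\<^bsub>B\<^esub>" "\<one>\<^bsub>B\<^esub>"] B.A.one_closed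
    by (simp add: EB.tensor_one EA.tensor_one one del: B_simps(3))
  show "env_hom (x \<otimes>\<^bsub>EB.T\<^esub> y) = env_hom x \<otimes>\<^bsub>EA.T\<^esub> env_hom y"
    if x: "x \<in> carrier EB.T" and y: "y \<in> carrier EB.T" for x y
    using x
  proof (induction x rule: EB.tensor_induct)
    case (pure b c)
    show ?case
      using y
    proof (induction y rule: EB.tensor_induct)
      case (pure b' c')
      \<comment> \<open>The opposite multiplication puts \<open>c'\<close> before \<open>c\<close>
        on both sides, so it is multiplicativity of \<open>right_hom\<close> that is needed, not a
        reversal of products.\<close>
      have bc: "b \<in> carrier B" "b' \<in> carrier B" "c \<in> carrier B" "c' \<in> carrier B"
        using pure \<open>b \<in> carrier B\<close> \<open>c \<in> carrier (opposite B)\<close> by simp_all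
      have "env_hom (EB.pure b c \<otimes>\<^bsub>EB.T\<^esub> EB.pure b' c') = env_hom (EB.pure (b \<otimes>\<^bsub>B\<^esub> b') (c' \<otimes>\<^bsub>B\<^esub> c))"
        using bc EB.pure_mult[of b b' c c'] by simp
      also have "\<dots> = EA.pure (left_hom b \<otimes>\<^bsub>A\<^esub> left_hom b') (right_hom c' \<otimes>\<^bsub>A\<^esub> right_hom c)"
        using bc B.A.m_closed by (simp only: env_hom_pure left_hom_mult right_hom_mult)
      also have "\<dots> = env_hom (EB.pure b c) \<otimes>\<^bsub>EA.T\<^esub> env_hom (EB.pure b' c')"
        using bc by (simp add: env_hom_pure EA.pure_mult)
      finally show ?case .
    next
      case (add X Y)
      then show ?case using EB.pure_closed[OF pure] by (simp add: EB.T.r_distr EA.T.r_distr)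
    qed
  next
    case (add X Y)
    then show ?case using y by (simp add: EB.T.l_distr EA.T.l_distr)
  qed
qed simp_all

section \<open>Projectivity of the enveloping algebra of A over that of B\<close>

definition ideal_part :: "'k \<times> 'a \<Rightarrow> 'k \<times> 'a"
  where "ideal_part x = (\<zero>\<^bsub>K\<^esub>, snd x)"

lemma retraction_ideal_part: "ideal_retraction K B (homotope_ideal K A) ideal_part"
  unfolding ideal_retraction_def
  using ideal_homotope_ideal[OF Delta]
  by (auto simp: ideal_part_def homotope_ideal_def intro!: lmodule_homI)

text \<open>With the whole algebra as an ideal of itself, \<open>projective_tensor_ideal\<close>
  also covers products with only one proper factor.\<close>

lemma retraction_id: "ideal_retraction K B (carrier B) (\<lambda>x. x)"
  unfolding ideal_retraction_def using B.A.oneideal lmodule_hom_id by blast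

lemma inject_linear: "Pair \<zero>\<^bsub>K\<^esub> \<in> lmodule_hom K A B"
  by (rule lmodule_homI) auto

lemma snd_linear: "snd \<in> lmodule_hom K B A"
  by (rule lmodule_homI) auto

abbreviation "tmap \<equiv> tensor_map K B (opposite B)"

text \<open>The restricted enveloping algebra of \<open>A\<close> is compared with the square of the
  ideal in \<open>E\<^sub>B\<close>, projective by \<open>projective_tensor_ideal\<close>:
  \<open>?u\<close> sends a \<otimes> b to (0, a) \<otimes> (0, b), and \<open>?v\<close> is a left
  inverse.\<close>

lemma projective_env:
  assumes I: "projective_lmodule B (ideal_lmodule B (homotope_ideal K A))"
    and I': "projective_lmodule (opposite B) (ideal_lmodule (opposite B) (homotope_ideal K A))"
  shows "projective_lmodule (enveloping_algebra K B)
    (restrict_scalars env_hom (ideal_lmodule (enveloping_algebra K A) (carrier (enveloping_algebra K A))))"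
proof -
  let ?u = "tmap (Pair \<zero>\<^bsub>K\<^esub>) (Pair \<zero>\<^bsub>K\<^esub>)" and ?v = "tensor_map K A (opposite A) snd snd" and ?r = "tmap ideal_part ideal_part"
  interpret u: abelian_group_hom EA.T EB.T ?u
    by (rule tensor_map_hom[OF EA.tensor_product_axioms EB.tensor_product_axioms inject_linear]) (simp add: inject_linear)
  interpret v: abelian_group_hom EB.T EA.T ?v
    by (rule tensor_map_hom[OF EB.tensor_product_axioms EA.tensor_product_axioms snd_linear]) (simp add: snd_linear)
  interpret r: abelian_group_hom EB.T EB.T ?r
    by (rule tensor_retraction_hom[OF B.unital_algebra_axioms retraction_ideal_part retraction_ideal_part])
  have u_pure: "?u (EA.pure a b) = EB.pure (\<zero>\<^bsub>K\<^esub>, a) (\<zero>\<^bsub>K\<^esub>, b)" if "a \<in> carrier A" "b \<in> carrier A" for a b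
    by (rule tensor_map_pure[OF EA.tensor_product_axioms EB.tensor_product_axioms inject_linear])
      (use that in \<open>simp_all add: inject_linear\<close>)
  have v_pure: "?v (EB.pure x y) = EA.pure (snd x) (snd y)" if "x \<in> carrier B" "y \<in> carrier B" for x y
    by (rule tensor_map_pure[OF EB.tensor_product_axioms EA.tensor_product_axioms snd_linear])
      (use that in \<open>simp_all add: snd_linear\<close>)
  have r_pure: "?r (EB.pure x y) = EB.pure (\<zero>\<^bsub>K\<^esub>, snd x) (\<zero>\<^bsub>K\<^esub>, snd y)" if "x \<in> carrier B" "y \<in> carrier B" for x y
    using tensor_retraction_pure[OF B.unital_algebra_axioms retraction_ideal_part retraction_ideal_part that] by (simp add: ideal_part_def)
  have vu: "?v (?u X) = X" if "X \<in> carrier EA.T" for X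
    using that by (induction X rule: EA.tensor_induct) (simp_all add: u_pure v_pure)
  have ru: "?r (?u X) = ?u X" if "X \<in> carrier EA.T" for X
    using that by (induction X rule: EA.tensor_induct) (simp_all add: u_pure r_pure)
  \<comment> \<open>This and \<open>act_A\<close> are the same formula on the two sides of
    \<open>?u\<close>; their agreement is the whole reason for linearity.\<close>
  have act: "EB.pure x y \<otimes>\<^bsub>EB.T\<^esub> EB.pure (\<zero>\<^bsub>K\<^esub>, a) (\<zero>\<^bsub>K\<^esub>, b)
      = EB.pure (\<zero>\<^bsub>K\<^esub>, left_hom x \<otimes>\<^bsub>A\<^esub> a) (\<zero>\<^bsub>K\<^esub>, b \<otimes>\<^bsub>A\<^esub> right_hom y)"
    if "x \<in> carrier B" "y \<in> carrier B" "a \<in> carrier A" "b \<in> carrier A" for x y a b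
    using that EB.pure_mult[of x "(\<zero>\<^bsub>K\<^esub>, a)" y "(\<zero>\<^bsub>K\<^esub>, b)"] left_action[of x a] right_action[of y b]
    by (simp del: B_simps(2))
  have act_A: "env_hom (EB.pure x y) \<otimes>\<^bsub>EA.T\<^esub> EA.pure a b = EA.pure (left_hom x \<otimes>\<^bsub>A\<^esub> a) (b \<otimes>\<^bsub>A\<^esub> right_hom y)"
    if "x \<in> carrier B" "y \<in> carrier B" "a \<in> carrier A" "b \<in> carrier A" for x y a b
    using that by (simp add: env_hom_pure EA.pure_mult)
  have u_smult: "?u (env_hom e \<otimes>\<^bsub>EA.T\<^esub> X) = e \<otimes>\<^bsub>EB.T\<^esub> ?u X"
    if e: "e \<in> carrier EB.T" and X: "X \<in> carrier EA.T" for e X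
    using e
  proof (induction e rule: EB.tensor_induct)
    case (pure x y)
    show ?case
      using X
    proof (induction X rule: EA.tensor_induct)
      case (pure a b)
      then have ab: "a \<in> carrier A" "b \<in> carrier A" by simp_all
      have xy: "x \<in> carrier B" "y \<in> carrier B" using \<open>x \<in> carrier B\<close> \<open>y \<in> carrier (opposite B)\<close> by simp_all
      show ?case
        using ab xy unfolding act_A[OF xy ab] u_pure[OF ab] act[OF xy ab] by (intro u_pure) auto
    next
      case (add X Y)
      then show ?case using EB.pure_closed[OF pure] by (simp add: EB.T.r_distr EA.T.r_distr)
    qed
  next
    case (add X' Y')
    then show ?case using X by (simp add: EB.T.l_distr EA.T.l_distr)
  qed
  \<comment> \<open>\<open>snd\<close> forgets scalar parts, which contribute to products in
    \<open>B\<close>; hence the restriction to tensors \<open>?r t\<close> of the ideal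
    square.\<close>
  have v_smult: "?v (e \<otimes>\<^bsub>EB.T\<^esub> ?r t) = env_hom e \<otimes>\<^bsub>EA.T\<^esub> ?v (?r t)"
    if e: "e \<in> carrier EB.T" and t: "t \<in> carrier EB.T" for e t
    using e
  proof (induction e rule: EB.tensor_induct)
    case (pure x y)
    show ?case
      using t
    proof (induction t rule: EB.tensor_induct)
      case (pure a b)
      then have ab: "snd a \<in> carrier A" "snd b \<in> carrier A" and ab': "a \<in> carrier B" "b \<in> carrier B" by auto
      have xy: "x \<in> carrier B" "y \<in> carrier B" using \<open>x \<in> carrier B\<close> \<open>y \<in> carrier (opposite B)\<close> by simp_all
      have "?v (EB.pure (\<zero>\<^bsub>K\<^esub>, snd a) (\<zero>\<^bsub>K\<^esub>, snd b)) = EA.pure (snd a) (snd b)"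
        using ab by (simp add: v_pure)
      then show ?case
        using ab xy unfolding r_pure[OF ab'] act[OF xy ab] by (simp only: act_A) (simp add: v_pure)
    next
      case (add X Y)
      then show ?case using EB.pure_closed[OF pure] by (simp add: EB.T.r_distr EA.T.r_distr)
    qed
  next
    case (add X Y)
    then show ?case using t by (simp add: EB.T.l_distr EA.T.l_distr)
  qed
  show ?thesis
  proof (rule projective_lmodule_retract[OF _ projective_tensor_ideal[OF B.unital_algebra_axioms retraction_ideal_part retraction_ideal_part I I']])
    show "lmodule (enveloping_algebra K B)
        (restrict_scalars env_hom (ideal_lmodule (enveloping_algebra K A) (carrier (enveloping_algebra K A))))"
      using lmodule_ideal_lmodule[OF EA.T.oneideal] EB.T.ring_axioms env_hom_ring_hom
      by (intro lmodule_restrict_scalars) (simp_all add: enveloping_algebra_def)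
    show "?u \<in> lmodule_hom (enveloping_algebra K B)
        (restrict_scalars env_hom (ideal_lmodule (enveloping_algebra K A) (carrier (enveloping_algebra K A))))
        (ideal_lmodule (enveloping_algebra K B) (tensor_ideal K B ideal_part ideal_part))"
      by (rule lmodule_homI) (auto simp: enveloping_algebra_def tensor_ideal_def ru u_smult)
    show "?v \<in> lmodule_hom (enveloping_algebra K B) (ideal_lmodule (enveloping_algebra K B) (tensor_ideal K B ideal_part ideal_part))
        (restrict_scalars env_hom (ideal_lmodule (enveloping_algebra K A) (carrier (enveloping_algebra K A))))"
    proof (rule lmodule_homI)
      fix e t assume "e \<in> carrier (enveloping_algebra K B)"
        "t \<in> carrier (ideal_lmodule (enveloping_algebra K B) (tensor_ideal K B ideal_part ideal_part))"
      then show "?v (e \<odot>\<^bsub>ideal_lmodule (enveloping_algebra K B) (tensor_ideal K B ideal_part ideal_part)\<^esub> t)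
          = e \<odot>\<^bsub>restrict_scalars env_hom (ideal_lmodule (enveloping_algebra K A) (carrier (enveloping_algebra K A)))\<^esub> ?v t"
        using v_smult[of e t] by (simp add: enveloping_algebra_def tensor_ideal_def)
    qed (auto simp: enveloping_algebra_def tensor_ideal_def)
  qed (simp add: enveloping_algebra_def vu)
qed

section \<open>The ideal as a restricted bimodule and its resolution\<close>

text \<open>Identifies the ideal, as a module over the enveloping algebra of \<open>B\<close>, with
  the restriction of \<open>enveloping_module A\<close>. It makes the augmentation of a restricted
  resolution linear.\<close>

lemma enveloping_smult_inject:
  assumes e: "e \<in> carrier EB.T" and a: "a \<in> carrier A"
  shows "e \<odot>\<^bsub>enveloping_module B\<^esub> (\<zero>\<^bsub>K\<^esub>, a) = (\<zero>\<^bsub>K\<^esub>, env_hom e \<odot>\<^bsub>enveloping_module A\<^esub> a)"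
proof -
  interpret MA: lmodule EA.T "enveloping_module A"
    using lmodule_enveloping_module by (simp add: enveloping_algebra_def)
  interpret MB: lmodule EB.T "enveloping_module B"
    using B.lmodule_enveloping_module by (simp add: enveloping_algebra_def)
  show ?thesis
    using e
  proof (induction e rule: EB.tensor_induct)
    case (pure x y)
    then have xy: "x \<in> carrier B" "y \<in> carrier B" by simp_all
    have "EB.pure x y \<odot>\<^bsub>enveloping_module B\<^esub> (\<zero>\<^bsub>K\<^esub>, a) = x \<otimes>\<^bsub>B\<^esub> (\<zero>\<^bsub>K\<^esub>, a) \<otimes>\<^bsub>B\<^esub> y"
      using xy a by (intro B.enveloping_smult_pure) auto
    also have "\<dots> = (\<zero>\<^bsub>K\<^esub>, left_hom x \<otimes>\<^bsub>A\<^esub> a \<otimes>\<^bsub>A\<^esub> right_hom y)"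
      using xy a by (simp only: left_action right_action A.m_closed left_hom_closed B_simps(1)[symmetric])
    also have "left_hom x \<otimes>\<^bsub>A\<^esub> a \<otimes>\<^bsub>A\<^esub> right_hom y = env_hom (EB.pure x y) \<odot>\<^bsub>enveloping_module A\<^esub> a"
      using xy a by (simp add: env_hom_pure enveloping_smult_pure)
    finally show ?case .
  next
    case (add X Y)
    then show ?case
      using a MB.smult_l_distr[of X Y "(\<zero>\<^bsub>K\<^esub>, a)"] by (simp add: MA.smult_l_distr)
  qed
qed

lemma lmodule_homotope_ideal:
  "lmodule (enveloping_algebra K B) ((enveloping_module B)\<lparr>carrier := homotope_ideal K A\<rparr>)"
proof (rule lmodule_submodule[OF B.lmodule_enveloping_module])
  interpret MA: lmodule EA.T "enveloping_module A"
    using lmodule_enveloping_module by (simp add: enveloping_algebra_def)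
  fix e x assume e: "e \<in> carrier (enveloping_algebra K B)" and "x \<in> homotope_ideal K A"
  then obtain a where a: "x = (\<zero>\<^bsub>K\<^esub>, a)" "a \<in> carrier A" by (auto simp: homotope_ideal_def)
  have e': "e \<in> carrier EB.T" using e by (simp add: enveloping_algebra_def)
  show "e \<odot>\<^bsub>enveloping_module B\<^esub> x \<in> homotope_ideal K A"
    using MA.smult_closed[OF \<phi>.hom_closed[OF e'], of a] a(2)
    by (simp add: a(1) enveloping_smult_inject[OF e' a(2)] homotope_ideal_def)
qed (auto simp: homotope_ideal_def)

text \<open>Exactness concerns the underlying groups, which restriction leaves alone; only
  projectivity of the terms calls for the hypotheses on the ideal.\<close>

lemma restricted_resolution:
  assumes I: "projective_lmodule B (ideal_lmodule B (homotope_ideal K A))"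
    and I': "projective_lmodule (opposite B) (ideal_lmodule (opposite B) (homotope_ideal K A))"
    and P: "projective_resolution (enveloping_algebra K A) (enveloping_module A) P d e"
  shows "projective_resolution (enveloping_algebra K B) ((enveloping_module B)\<lparr>carrier := homotope_ideal K A\<rparr>)
    (\<lambda>i. restrict_scalars env_hom (P i)) d (\<lambda>x. (\<zero>\<^bsub>K\<^esub>, e x))"
  unfolding projective_resolution_def One_nat_def
proof (intro conjI allI)
  have EB_ring: "ring (enveloping_algebra K B)"
    using EB.T.ring_axioms by (simp add: enveloping_algebra_def)
  show "projective_lmodule (enveloping_algebra K B) (restrict_scalars env_hom (P i))" for i
    by (rule projective_restrict_scalars[OF EB_ring env_hom_ring_hom projective_env[OF I I']
          projective_resolution_projective[OF P]])
  show "d i \<in> lmodule_hom (enveloping_algebra K B) (restrict_scalars env_hom (P (Suc i))) (restrict_scalars env_hom (P i))" for i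
    by (rule restrict_scalars_hom[OF env_hom_ring_hom projective_resolution_differential[OF P]])
  note e = lmodule_homD[OF projective_resolution_augmentation[OF P]]
  show "(\<lambda>x. (\<zero>\<^bsub>K\<^esub>, e x)) \<in> lmodule_hom (enveloping_algebra K B) (restrict_scalars env_hom (P 0))
      ((enveloping_module B)\<lparr>carrier := homotope_ideal K A\<rparr>)"
  proof (rule lmodule_homI)
    fix c x assume c: "c \<in> carrier (enveloping_algebra K B)" and "x \<in> carrier (restrict_scalars env_hom (P 0))"
    then have x: "x \<in> carrier (P 0)" by simp
    have "c \<in> carrier EB.T" using c by (simp add: enveloping_algebra_def)
    then show "(\<zero>\<^bsub>K\<^esub>, e (c \<odot>\<^bsub>restrict_scalars env_hom (P 0)\<^esub> x))
        = c \<odot>\<^bsub>(enveloping_module B)\<lparr>carrier := homotope_ideal K A\<rparr>\<^esub> (\<zero>\<^bsub>K\<^esub>, e x)"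
      using e(3)[OF ring_hom_closed[OF env_hom_ring_hom c] x] enveloping_smult_inject[of c "e x"] e(1)[OF x]
      by simp
  qed (use e in \<open>auto simp: homotope_ideal_def\<close>)
  have "(\<lambda>x. (\<zero>\<^bsub>K\<^esub>, e x)) ` carrier (P 0) = Pair \<zero>\<^bsub>K\<^esub> ` e ` carrier (P 0)" by auto
  then show "(\<lambda>x. (\<zero>\<^bsub>K\<^esub>, e x)) ` carrier (restrict_scalars env_hom (P 0))
      = carrier ((enveloping_module B)\<lparr>carrier := homotope_ideal K A\<rparr>)"
    using projective_resolution_surj[OF P] by (auto simp: homotope_ideal_def)
qed (simp_all add: projective_resolution_exact_0[OF P] projective_resolution_exact_Suc[OF P])

section \<open>The resolution of the quotient of B by the ideal\<close>

definition scalar_part :: "'k \<times> 'a \<Rightarrow> 'k \<times> 'a"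
  where "scalar_part x = (fst x, \<zero>\<^bsub>A\<^esub>)"

lemma scalar_part_linear: "scalar_part \<in> lmodule_hom K B B"
  by (rule lmodule_homI) (auto simp: scalar_part_def)

lemma ideal_part_linear: "ideal_part \<in> lmodule_hom K B B"
  by (rule ideal_retractionD(2)[OF retraction_ideal_part])

lemma ideal_part_closed: "x \<in> carrier B \<Longrightarrow> ideal_part x \<in> carrier B"
  by (rule lmodule_hom_closed[OF ideal_part_linear])

lemma scalar_part_closed: "x \<in> carrier B \<Longrightarrow> scalar_part x \<in> carrier B"
  by (rule lmodule_hom_closed[OF scalar_part_linear])

text \<open>The multiplication map, x \<otimes> y to x y. Written as the action on one, it inherits
  linearity from the module axioms. It lifts the map onto the quotient by the ideal to
  \<open>B\<close>, as the horseshoe lemma asks.\<close>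

definition augmentation :: "(('k \<times> 'a) \<times> ('k \<times> 'a) \<Rightarrow>\<^sub>0 int) set \<Rightarrow> 'k \<times> 'a"
  where "augmentation z = z \<odot>\<^bsub>enveloping_module B\<^esub> \<one>\<^bsub>B\<^esub>"

lemma augmentation_additive: "abelian_group_hom EB.T B augmentation"
proof -
  interpret MB: lmodule EB.T "enveloping_module B"
    using B.lmodule_enveloping_module by (simp add: enveloping_algebra_def)
  show ?thesis
    unfolding augmentation_def
    using MB.smult_closed MB.smult_l_distr B.A.one_closed
    by (intro abelian_group_homI' EB.T.is_abelian_group B.A.is_abelian_group) (simp_all del: B_simps)
qed

interpretation aug: abelian_group_hom EB.T B augmentation by (rule augmentation_additive)

lemma augmentation_pure:
  assumes "x \<in> carrier B" "y \<in> carrier B"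
  shows "augmentation (EB.pure x y) = x \<otimes>\<^bsub>B\<^esub> y"
  using assms B.enveloping_smult_pure[OF assms B.A.one_closed] B.A.r_one
  unfolding augmentation_def by (simp del: B_simps)

lemma tmap_additive:
  "\<lbrakk>\<rho> \<in> lmodule_hom K B B; \<sigma> \<in> lmodule_hom K B B\<rbrakk> \<Longrightarrow> abelian_group_hom EB.T EB.T (tmap \<rho> \<sigma>)"
  by (rule tensor_map_hom[OF EB.tensor_product_axioms EB.tensor_product_axioms]) simp_all

lemma tmap_pure:
  "\<lbrakk>\<rho> \<in> lmodule_hom K B B; \<sigma> \<in> lmodule_hom K B B; x \<in> carrier B; y \<in> carrier B\<rbrakk> \<Longrightarrow>
    tmap \<rho> \<sigma> (EB.pure x y) = EB.pure (\<rho> x) (\<sigma> y)"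
  by (rule tensor_map_pure[OF EB.tensor_product_axioms EB.tensor_product_axioms]) simp_all

lemma tmap_comp:
  assumes "\<rho> \<in> lmodule_hom K B B" "\<sigma> \<in> lmodule_hom K B B" "\<rho>' \<in> lmodule_hom K B B" "\<sigma>' \<in> lmodule_hom K B B"
    and X: "X \<in> carrier EB.T"
  shows "tmap \<rho> \<sigma> (tmap \<rho>' \<sigma>' X) = tmap (\<lambda>x. \<rho> (\<rho>' x)) (\<lambda>x. \<sigma> (\<sigma>' x)) X"
  using X
proof (induction X rule: EB.tensor_induct)
  case (pure x y)
  then show ?case
    using assms by (simp add: tmap_pure lmodule_hom_comp lmodule_hom_closed del: B_simps)
next
  case (add X Y)
  note homs = tmap_additive[OF assms(1,2)] tmap_additive[OF assms(3,4)]
    tmap_additive[OF lmodule_hom_comp[OF assms(3,1)] lmodule_hom_comp[OF assms(4,2)]]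
  show ?case
    using add homs[THEN abelian_group_hom.hom_add] homs[THEN abelian_group_hom.hom_closed] by simp
qed

text \<open>With I for the ideal, these three are I \<otimes> B, B \<otimes> I and I \<otimes> I
  inside the enveloping algebra.\<close>

abbreviation "J\<^sub>1 \<equiv> tensor_ideal K B ideal_part (\<lambda>x. x)"
abbreviation "J\<^sub>2 \<equiv> tensor_ideal K B (\<lambda>x. x) ideal_part"
abbreviation "J\<^sub>1\<^sub>2 \<equiv> tensor_ideal K B ideal_part ideal_part"

lemma ideal_part_idem [simp]: "ideal_part (ideal_part x) = ideal_part x" "ideal_part (scalar_part x) = (\<zero>\<^bsub>K\<^esub>, \<zero>\<^bsub>A\<^esub>)"
  by (simp_all add: ideal_part_def scalar_part_def)

text \<open>The idempotents that cut out \<open>J\<^sub>1\<close> and \<open>J\<^sub>2\<close>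
  compose to the one of \<open>J\<^sub>1\<^sub>2\<close>. This equality is what makes the quotient
  resolution exact in degree 1.\<close>

lemma J_inter: "J\<^sub>1\<^sub>2 = J\<^sub>1 \<inter> J\<^sub>2"
proof (intro equalityI subsetI IntI)
  note comp = tmap_comp[OF ideal_part_linear lmodule_hom_id ideal_part_linear ideal_part_linear]
    tmap_comp[OF lmodule_hom_id ideal_part_linear ideal_part_linear ideal_part_linear]
    tmap_comp[OF ideal_part_linear lmodule_hom_id lmodule_hom_id ideal_part_linear]
  fix x
  show "x \<in> J\<^sub>1" "x \<in> J\<^sub>2" if "x \<in> J\<^sub>1\<^sub>2"
    using that comp(1,2)[of x] by (simp_all add: tensor_ideal_def enveloping_algebra_def)
  show "x \<in> J\<^sub>1\<^sub>2" if "x \<in> J\<^sub>1 \<inter> J\<^sub>2"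
    using that comp(3)[of x] by (simp add: tensor_ideal_def enveloping_algebra_def)
qed

lemma augmentation_J:
  assumes "x \<in> J\<^sub>1 \<or> x \<in> J\<^sub>2"
  shows "augmentation x \<in> homotope_ideal K A"
proof -
  interpret I: ideal "homotope_ideal K A" B by (rule ideal_homotope_ideal[OF Delta])
  note hom1 = tmap_additive[OF ideal_part_linear lmodule_hom_id]
  note hom2 = tmap_additive[OF lmodule_hom_id ideal_part_linear]
  have ideal_part_I: "b \<in> carrier B \<Longrightarrow> ideal_part b \<in> homotope_ideal K A" for b
    by (rule ideal_retractionD(3)[OF retraction_ideal_part])
  have "augmentation (tmap ideal_part (\<lambda>x. x) z) \<in> homotope_ideal K A \<and> augmentation (tmap (\<lambda>x. x) ideal_part z) \<in> homotope_ideal K A"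
    if "z \<in> carrier EB.T" for z
    using that
  proof (induction z rule: EB.tensor_induct)
    case (pure b c)
    then show ?case
      using ideal_part_I[of b] ideal_part_I[of c]
      by (simp add: tmap_pure ideal_part_linear lmodule_hom_id ideal_part_closed augmentation_pure I.I_l_closed I.I_r_closed del: B_simps)
  next
    case (add X Y)
    then show ?case
      using abelian_group_hom.hom_add[OF hom1] abelian_group_hom.hom_add[OF hom2]
        abelian_group_hom.hom_closed[OF hom1] abelian_group_hom.hom_closed[OF hom2]
      by (simp add: I.a_closed del: B_simps)
  qed
  from this[of x] show ?thesis
    using assms by (auto simp: tensor_ideal_def enveloping_algebra_def)
qed

text \<open>From B = I + K follows B \<otimes> B = I \<otimes> B + K \<otimes> I + K \<otimes> K.
  The last part consists of the scalar multiples of 1 \<otimes> 1, and the scalar is visible after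
  multiplication, because the projection from \<open>B\<close> to K is multiplicative.\<close>

lemma tensor_decomposition:
  assumes "z \<in> carrier EB.T"
  shows "z = (tmap ideal_part (\<lambda>x. x) z \<oplus>\<^bsub>EB.T\<^esub> tmap scalar_part ideal_part z) \<oplus>\<^bsub>EB.T\<^esub> EB.pure (scalar_part (augmentation z)) \<one>\<^bsub>B\<^esub>"
  using assms
proof (induction z rule: EB.tensor_induct)
  case (pure x y)
  then have xy: "x \<in> carrier B" "y \<in> carrier B" by simp_all
  have split: "b = ideal_part b \<oplus>\<^bsub>B\<^esub> scalar_part b" if "b \<in> carrier B" for b
    using that by (auto simp: ideal_part_def scalar_part_def)
  have "EB.pure x y = EB.pure (ideal_part x \<oplus>\<^bsub>B\<^esub> scalar_part x) y" using split[OF xy(1)] by simp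
  also have "\<dots> = EB.pure (ideal_part x) y \<oplus>\<^bsub>EB.T\<^esub> EB.pure (scalar_part x) y"
    using xy ideal_part_closed scalar_part_closed by (intro EB.pure_add_left) simp_all
  also have "EB.pure (scalar_part x) y = EB.pure (scalar_part x) (ideal_part y \<oplus>\<^bsub>B\<^esub> scalar_part y)" using split[OF xy(2)] by simp
  also have "\<dots> = EB.pure (scalar_part x) (ideal_part y) \<oplus>\<^bsub>EB.T\<^esub> EB.pure (scalar_part x) (scalar_part y)"
    using xy ideal_part_closed scalar_part_closed EB.pure_add_right[of "scalar_part x" "ideal_part y" "scalar_part y"] by simp
  \<comment> \<open>A scalar in the right factor is moved across the tensor sign, which leaves one
    on the right and the product of both scalars on the left.\<close>
  also have "EB.pure (scalar_part x) (scalar_part y) = EB.pure (scalar_part x) (fst y \<odot>\<^bsub>B\<^esub> \<one>\<^bsub>B\<^esub>)"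
    using xy by (auto simp: scalar_part_def)
  also have "\<dots> = EB.pure (fst y \<odot>\<^bsub>B\<^esub> scalar_part x) \<one>\<^bsub>B\<^esub>"
    using xy scalar_part_closed[OF xy(1)] B.A.one_closed EB.pure_smult[of "fst y" "scalar_part x" "\<one>\<^bsub>B\<^esub>"] by auto
  also have "fst y \<odot>\<^bsub>B\<^esub> scalar_part x = scalar_part (augmentation (EB.pure x y))"
    using xy by (auto simp: augmentation_pure scalar_part_def R.m_comm)
  finally show ?case
    using xy ideal_part_closed[OF xy(1)] ideal_part_closed[OF xy(2)] scalar_part_closed[OF xy(1)] scalar_part_closed[of "augmentation (EB.pure x y)"]
      aug.hom_closed[of "EB.pure x y"] B.A.one_closed
    by (simp add: tmap_pure ideal_part_linear scalar_part_linear lmodule_hom_id EB.T.a_assoc del: B_simps)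
next
  case (add X Y)
  note hom1 = tmap_additive[OF ideal_part_linear lmodule_hom_id]
  note hom2 = tmap_additive[OF scalar_part_linear ideal_part_linear]
  have aug: "augmentation X \<in> carrier B" "augmentation Y \<in> carrier B"
    using add by (simp_all del: B_simps)
  let ?a = "tmap ideal_part (\<lambda>x. x)" and ?b = "tmap scalar_part ideal_part" and ?c = "\<lambda>z. EB.pure (scalar_part (augmentation z)) \<one>\<^bsub>B\<^esub>"
  have c: "?c (X \<oplus>\<^bsub>EB.T\<^esub> Y) = ?c X \<oplus>\<^bsub>EB.T\<^esub> ?c Y" "?c X \<in> carrier EB.T" "?c Y \<in> carrier EB.T"
    using add aug scalar_part_closed[OF aug(1)] scalar_part_closed[OF aug(2)] B.A.one_closed
      lmodule_hom_add[OF scalar_part_linear aug] EB.pure_add_left[of "scalar_part (augmentation X)" "scalar_part (augmentation Y)" "\<one>\<^bsub>B\<^esub>"]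
    by (simp_all del: B_simps)
  have "X \<oplus>\<^bsub>EB.T\<^esub> Y = ((?a X \<oplus>\<^bsub>EB.T\<^esub> ?b X) \<oplus>\<^bsub>EB.T\<^esub> ?c X) \<oplus>\<^bsub>EB.T\<^esub> ((?a Y \<oplus>\<^bsub>EB.T\<^esub> ?b Y) \<oplus>\<^bsub>EB.T\<^esub> ?c Y)"
    using add.IH by simp
  also have "\<dots> = ((?a X \<oplus>\<^bsub>EB.T\<^esub> ?a Y) \<oplus>\<^bsub>EB.T\<^esub> (?b X \<oplus>\<^bsub>EB.T\<^esub> ?b Y)) \<oplus>\<^bsub>EB.T\<^esub> (?c X \<oplus>\<^bsub>EB.T\<^esub> ?c Y)"
    using c(2,3) add.hyps abelian_group_hom.hom_closed[OF hom1] abelian_group_hom.hom_closed[OF hom2]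
    by (simp add: EB.T.a_ac del: B_simps)
  finally show ?case
    unfolding c(1) abelian_group_hom.hom_add[OF hom1 add.hyps] abelian_group_hom.hom_add[OF hom2 add.hyps] .
qed

text \<open>Exactness of the quotient resolution in degree 0: the scalar term of the decomposition
  vanishes, and K \<otimes> I lies in B \<otimes> I.\<close>

lemma augmentation_kernel:
  assumes z: "z \<in> carrier EB.T" and aug: "augmentation z \<in> homotope_ideal K A"
  shows "\<exists>x\<in>J\<^sub>1. \<exists>y\<in>J\<^sub>2. z = x \<oplus>\<^bsub>EB.T\<^esub> y"
proof (intro bexI)
  note hom1 = tmap_additive[OF ideal_part_linear lmodule_hom_id]
  note hom2 = tmap_additive[OF scalar_part_linear ideal_part_linear]
  have "scalar_part (augmentation z) = \<zero>\<^bsub>B\<^esub>"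
    using aug by (auto simp: homotope_ideal_def scalar_part_def)
  then have "EB.pure (scalar_part (augmentation z)) \<one>\<^bsub>B\<^esub> = \<zero>\<^bsub>EB.T\<^esub>"
    using B.A.one_closed by (simp del: B_simps)
  then show "z = tmap ideal_part (\<lambda>x. x) z \<oplus>\<^bsub>EB.T\<^esub> tmap scalar_part ideal_part z"
    using tensor_decomposition[OF z] z abelian_group_hom.hom_closed[OF hom1 z] abelian_group_hom.hom_closed[OF hom2 z]
    by simp
  show "tmap ideal_part (\<lambda>x. x) z \<in> J\<^sub>1"
    using z abelian_group_hom.hom_closed[OF hom1 z] tmap_comp[OF ideal_part_linear lmodule_hom_id ideal_part_linear lmodule_hom_id z]
    by (simp add: tensor_ideal_def enveloping_algebra_def)
  show "tmap scalar_part ideal_part z \<in> J\<^sub>2"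
    using z abelian_group_hom.hom_closed[OF hom2 z] tmap_comp[OF lmodule_hom_id ideal_part_linear scalar_part_linear ideal_part_linear z]
    by (simp add: tensor_ideal_def enveloping_algebra_def)
qed

text \<open>The tensor square \<open>J\<^sub>1\<^sub>2 \<rightarrow> J\<^sub>1 \<oplus> J\<^sub>2 \<rightarrow> E\<close> of the resolution \<open>A\<^sub>\<Delta> \<rightarrow> B\<close> of \<open>K = B / A\<^sub>\<Delta>\<close>, with all
  three terms realised inside \<open>E \<oplus> E\<close>.\<close>

lemma quotient_resolution:
  assumes I: "projective_lmodule B (ideal_lmodule B (homotope_ideal K A))"
    and I': "projective_lmodule (opposite B) (ideal_lmodule (opposite B) (homotope_ideal K A))"
  obtains Q :: "nat \<Rightarrow> ((('k \<times> 'a) \<times> ('k \<times> 'a) \<Rightarrow>\<^sub>0 int) set,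
      (('k \<times> 'a) \<times> ('k \<times> 'a) \<Rightarrow>\<^sub>0 int) set \<times> (('k \<times> 'a) \<times> ('k \<times> 'a) \<Rightarrow>\<^sub>0 int) set) module" and d s
  where "\<And>i. projective_lmodule (enveloping_algebra K B) (Q i)"
    "\<And>i. d i \<in> lmodule_hom (enveloping_algebra K B) (Q (Suc i)) (Q i)"
    "s \<in> lmodule_hom (enveloping_algebra K B) (Q 0) (enveloping_module B)"
    "\<And>x. x \<in> carrier B \<Longrightarrow> \<exists>q\<in>carrier (Q 0). s q = x"
    "d 0 ` carrier (Q (Suc 0)) = {x \<in> carrier (Q 0). s x \<in> homotope_ideal K A}"
    "\<And>i. d (Suc i) ` carrier (Q (Suc (Suc i))) = {x \<in> carrier (Q (Suc i)). d i x = \<zero>\<^bsub>Q i\<^esub>}"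
    "\<And>i. i > 2 \<Longrightarrow> carrier (Q i) = {\<zero>\<^bsub>Q i\<^esub>}"
proof -
  let ?E = "ideal_lmodule EB.T (carrier EB.T)"
  let ?D = "direct_sum ?E ?E"
  have env [simp]: "enveloping_algebra K B = EB.T" by (simp add: enveloping_algebra_def)
  interpret MB: lmodule EB.T "enveloping_module B"
    using B.lmodule_enveloping_module by simp
  have one: "\<one>\<^bsub>B\<^esub> \<in> carrier (enveloping_module B)" using B.A.one_closed by simp
  have aug_smult: "augmentation (a \<otimes>\<^bsub>EB.T\<^esub> z) = a \<odot>\<^bsub>enveloping_module B\<^esub> augmentation z"
    if "a \<in> carrier EB.T" "z \<in> carrier EB.T" for a z
    unfolding augmentation_def using that one by (rule MB.smult_assoc1)
  have proj: "projective_lmodule EB.T ?E" "projective_lmodule EB.T (ideal_lmodule EB.T J\<^sub>1)"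
    "projective_lmodule EB.T (ideal_lmodule EB.T J\<^sub>2)" "projective_lmodule EB.T (ideal_lmodule EB.T J\<^sub>1\<^sub>2)"
    using projective_tensor_ideal[OF B.unital_algebra_axioms retraction_ideal_part retraction_id I]
      projective_tensor_ideal[OF B.unital_algebra_axioms retraction_id retraction_ideal_part _ I']
      projective_tensor_ideal[OF B.unital_algebra_axioms retraction_ideal_part retraction_ideal_part I I']
      projective_regular_lmodule[OF B.A.ring_axioms]
      projective_regular_lmodule[OF ring_opposite[OF B.A.ring_axioms]]
      projective_regular_lmodule[OF EB.T.ring_axioms] by (simp_all del: B_simps)
  have lE: "lmodule EB.T ?E" by (rule projective_lmoduleD[OF proj(1)])
  interpret D: lmodule EB.T ?D by (rule lmodule_direct_sum[OF lE lE])
  interpret J12: lmodule EB.T "ideal_lmodule EB.T J\<^sub>1\<^sub>2" by (rule projective_lmoduleD[OF proj(4)])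
  have J_carr: "x \<in> carrier EB.T" if "x \<in> J\<^sub>1 \<or> x \<in> J\<^sub>2 \<or> x \<in> J\<^sub>1\<^sub>2" for x
    using that by (auto simp: tensor_ideal_def)
  have J2_neg: "\<ominus>\<^bsub>EB.T\<^esub> x \<in> J\<^sub>2" if "x \<in> J\<^sub>2" for x
    using that abelian_group_hom.hom_a_inv[OF tmap_additive[OF lmodule_hom_id ideal_part_linear], of x]
    by (simp add: tensor_ideal_def)
  have J12_closed: "\<zero>\<^bsub>EB.T\<^esub> \<in> J\<^sub>1\<^sub>2" "x \<in> J\<^sub>1\<^sub>2 \<Longrightarrow> y \<in> J\<^sub>1\<^sub>2 \<Longrightarrow> x \<oplus>\<^bsub>EB.T\<^esub> y \<in> J\<^sub>1\<^sub>2"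
      "a \<in> carrier EB.T \<Longrightarrow> x \<in> J\<^sub>1\<^sub>2 \<Longrightarrow> a \<otimes>\<^bsub>EB.T\<^esub> x \<in> J\<^sub>1\<^sub>2" for x y a
    using J12.M.zero_closed J12.M.a_closed[of x y] J12.smult_closed[of a x] by simp_all
  \<comment> \<open>The antidiagonal in degree 2 absorbs the sign of the usual tensor product
    differential, so every \<open>d i\<close> with positive index is an inclusion and only
    \<open>d 0\<close>, the addition, does any work.\<close>
  define S where "S i = (if i = 0 then carrier EB.T \<times> {\<zero>\<^bsub>EB.T\<^esub>} else if i = 1 then J\<^sub>1 \<times> J\<^sub>2
    else if i = 2 then {(x, \<ominus>\<^bsub>EB.T\<^esub> x) |x. x \<in> J\<^sub>1\<^sub>2} else {(\<zero>\<^bsub>EB.T\<^esub>, \<zero>\<^bsub>EB.T\<^esub>)})" for i :: nat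
  define Q where "Q i = ?D\<lparr>carrier := S i\<rparr>" for i
  define d where "d i z = (if i = 0 then (fst z \<oplus>\<^bsub>EB.T\<^esub> snd z, \<zero>\<^bsub>EB.T\<^esub>) else z)" for i :: nat and z
  have Q_simps [simp]: "carrier (Q i) = S i" "zero (Q i) = (\<zero>\<^bsub>EB.T\<^esub>, \<zero>\<^bsub>EB.T\<^esub>)"
    "x \<oplus>\<^bsub>Q i\<^esub> y = (fst x \<oplus>\<^bsub>EB.T\<^esub> fst y, snd x \<oplus>\<^bsub>EB.T\<^esub> snd y)"
    "a \<odot>\<^bsub>Q i\<^esub> x = (a \<otimes>\<^bsub>EB.T\<^esub> fst x, a \<otimes>\<^bsub>EB.T\<^esub> snd x)" for i x y a
    by (simp_all add: Q_def)
  have Q_1: "Q 1 = direct_sum (ideal_lmodule EB.T J\<^sub>1) (ideal_lmodule EB.T J\<^sub>2)"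
    by (simp add: Q_def S_def direct_sum_def ideal_lmodule_def)
  have lQ: "lmodule EB.T (Q i)" for i
  proof (cases "i = 1")
    case True
    then show ?thesis
      using lmodule_direct_sum[OF projective_lmoduleD[OF proj(2)] projective_lmoduleD[OF proj(3)]] Q_1 by simp
  next
    case False
    then show ?thesis
      unfolding Q_def
      by (intro lmodule_submodule[OF D.lmodule_axioms])
        (auto simp: S_def J_carr J12_closed EB.T.minus_add EB.T.r_minus)
  qed
  have proj_Q: "projective_lmodule EB.T (Q i)" for i
  proof -
    consider "i = 0" | "i = 1" | "i = 2" | "i > 2" by linarith
    then show ?thesis
    proof cases
      case 1
      show ?thesis
        by (rule projective_lmodule_retract[OF lQ proj(1), of fst _ "\<lambda>x. (x, \<zero>\<^bsub>EB.T\<^esub>)"])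
          (auto simp: 1 S_def intro!: lmodule_homI)
    next
      case 2
      then show ?thesis using projective_direct_sum[OF proj(2,3)] Q_1 by simp
    next
      case 3
      show ?thesis
        by (rule projective_lmodule_retract[OF lQ proj(4), of fst _ "\<lambda>x. (x, \<ominus>\<^bsub>EB.T\<^esub> x)"])
          (auto simp: 3 S_def J_carr EB.T.minus_add EB.T.r_minus EB.T.a_comm intro!: lmodule_homI)
    next
      case 4
      then show ?thesis by (intro projective_zero_lmodule[OF lQ]) (simp add: S_def)
    qed
  qed
  have S_2: "S 2 = {z \<in> S 1. fst z \<oplus>\<^bsub>EB.T\<^esub> snd z = \<zero>\<^bsub>EB.T\<^esub>}"
  proof (intro equalityI subsetI)
    fix z assume "z \<in> S 2"
    then show "z \<in> {z \<in> S 1. fst z \<oplus>\<^bsub>EB.T\<^esub> snd z = \<zero>\<^bsub>EB.T\<^esub>}"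
      using J2_neg J_carr by (auto simp: S_def J_inter EB.T.r_neg)
  next
    fix z assume "z \<in> {z \<in> S 1. fst z \<oplus>\<^bsub>EB.T\<^esub> snd z = \<zero>\<^bsub>EB.T\<^esub>}"
    then obtain x y where z: "z = (x, y)" "x \<in> J\<^sub>1" "y \<in> J\<^sub>2" "x \<oplus>\<^bsub>EB.T\<^esub> y = \<zero>\<^bsub>EB.T\<^esub>"
      by (auto simp: S_def)
    have xy: "x \<in> carrier EB.T" "y \<in> carrier EB.T" using z J_carr by blast+
    then have neg: "\<ominus>\<^bsub>EB.T\<^esub> y = x" "\<ominus>\<^bsub>EB.T\<^esub> x = y"
      using z(4) EB.T.a_comm EB.T.minus_equality by metis+
    then have "x \<in> J\<^sub>1\<^sub>2" using z(2) J2_neg[OF z(3)] by (simp add: J_inter)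
    then show "z \<in> S 2" using z(1) neg(2) by (auto simp: S_def)
  qed
  show ?thesis
  proof (rule that[of Q d "\<lambda>z. augmentation (fst z)"])
    show "projective_lmodule (enveloping_algebra K B) (Q i)" for i using proj_Q by simp
    show "d i \<in> lmodule_hom (enveloping_algebra K B) (Q (Suc i)) (Q i)" for i
    proof (rule lmodule_homI)
      fix x assume "x \<in> carrier (Q (Suc i))"
      then show "d i x \<in> carrier (Q i)"
        using S_2 J_carr J12_closed(1) by (cases "i = 0"; cases "i = 1") (auto simp: d_def S_def J_inter)
    next
      fix x y assume "x \<in> carrier (Q (Suc i))" "y \<in> carrier (Q (Suc i))"
      then show "d i (x \<oplus>\<^bsub>Q (Suc i)\<^esub> y) = d i x \<oplus>\<^bsub>Q i\<^esub> d i y"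
        using J_carr by (auto simp: d_def S_def EB.T.a_ac)
    next
      fix a x assume "a \<in> carrier (enveloping_algebra K B)" "x \<in> carrier (Q (Suc i))"
      then show "d i (a \<odot>\<^bsub>Q (Suc i)\<^esub> x) = a \<odot>\<^bsub>Q i\<^esub> d i x"
        using J_carr by (auto simp: d_def S_def EB.T.r_distr)
    qed
    show "(\<lambda>z. augmentation (fst z)) \<in> lmodule_hom (enveloping_algebra K B) (Q 0) (enveloping_module B)"
      by (rule lmodule_homI) (auto simp: S_def aug_smult aug.hom_closed[unfolded B_simps] simp del: B_simps)
    show "\<exists>q\<in>carrier (Q 0). augmentation (fst q) = x" if x: "x \<in> carrier B" for x
      using x B.A.one_closed augmentation_pure[OF x B.A.one_closed] B.A.r_one[OF x]
      by (intro bexI[of _ "(EB.pure x \<one>\<^bsub>B\<^esub>, \<zero>\<^bsub>EB.T\<^esub>)"]) (simp_all add: S_def del: B_simps)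
    show "d 0 ` carrier (Q (Suc 0)) = {x \<in> carrier (Q 0). augmentation (fst x) \<in> homotope_ideal K A}"
    proof (intro equalityI subsetI)
      fix z assume "z \<in> d 0 ` carrier (Q (Suc 0))"
      then obtain x y where z: "z = (x \<oplus>\<^bsub>EB.T\<^esub> y, \<zero>\<^bsub>EB.T\<^esub>)" "x \<in> J\<^sub>1" "y \<in> J\<^sub>2"
        by (auto simp: S_def d_def)
      interpret I: ideal "homotope_ideal K A" B by (rule ideal_homotope_ideal[OF Delta])
      have "x \<in> carrier EB.T" "y \<in> carrier EB.T" using z J_carr by blast+
      then show "z \<in> {x \<in> carrier (Q 0). augmentation (fst x) \<in> homotope_ideal K A}"
        using z augmentation_J[of x] augmentation_J[of y] by (simp add: S_def I.a_closed del: B_simps)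
    next
      fix z assume "z \<in> {x \<in> carrier (Q 0). augmentation (fst x) \<in> homotope_ideal K A}"
      then obtain w where w: "z = (w, \<zero>\<^bsub>EB.T\<^esub>)" "w \<in> carrier EB.T" "augmentation w \<in> homotope_ideal K A"
        by (auto simp: S_def)
      then obtain x y where "x \<in> J\<^sub>1" "y \<in> J\<^sub>2" "w = x \<oplus>\<^bsub>EB.T\<^esub> y"
        using augmentation_kernel by blast
      then show "z \<in> d 0 ` carrier (Q (Suc 0))"
        using w by (intro image_eqI[of _ _ "(x, y)"]) (auto simp: S_def d_def)
    qed
    show "d (Suc i) ` carrier (Q (Suc (Suc i))) = {x \<in> carrier (Q (Suc i)). d i x = \<zero>\<^bsub>Q i\<^esub>}" for i
    proof -
      have "d (Suc i) ` carrier (Q (Suc (Suc i))) = S (Suc (Suc i))" by (simp add: d_def)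
      also have "\<dots> = {x \<in> S (Suc i). d i x = (\<zero>\<^bsub>EB.T\<^esub>, \<zero>\<^bsub>EB.T\<^esub>)}"
      proof (cases "i = 0")
        case True
        then show ?thesis using S_2 by (simp add: d_def numeral_2_eq_2)
      next
        case False
        then have "(\<zero>\<^bsub>EB.T\<^esub>, \<zero>\<^bsub>EB.T\<^esub>) \<in> S (Suc i)"
          using J12_closed(1) by (auto simp: S_def intro!: exI[of _ "\<zero>\<^bsub>EB.T\<^esub>"])
        then show ?thesis using False by (auto simp: d_def S_def[of "Suc (Suc i)"])
      qed
      finally show ?thesis by simp
    qed
    show "carrier (Q i) = {\<zero>\<^bsub>Q i\<^esub>}" if "i > 2" for i using that by (simp add: S_def)
  qed
qed

section \<open>The bound on the dimension\<close>

text \<open>In degrees above \<open>max n 2\<close> both summands of the glued resolution vanish.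
  Its terms are modules over a product type, which
  \<open>has_projective_resolution_of_lengthI\<close> accepts.\<close>

lemma has_projective_resolution_homotope:
  assumes I: "projective_lmodule B (ideal_lmodule B (homotope_ideal K A))"
    and I': "projective_lmodule (opposite B) (ideal_lmodule (opposite B) (homotope_ideal K A))"
    and n: "has_projective_resolution_of_length (enveloping_algebra K A) (enveloping_module A) n"
  shows "has_projective_resolution_of_length (enveloping_algebra K B) (enveloping_module B) (max n 2)"
proof -
  obtain P :: "nat \<Rightarrow> (_, (('a \<times> 'a \<Rightarrow>\<^sub>0 int) set, 'a) formal_lincomb) module" and d e
    where P: "projective_resolution (enveloping_algebra K A) (enveloping_module A) P d e"
      and P_0: "\<forall>i>n. carrier (P i) = {\<zero>\<^bsub>P i\<^esub>}"
    using n unfolding has_projective_resolution_of_length_def by blast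
  show ?thesis
  proof (rule quotient_resolution[OF I I'])
    fix Q :: "nat \<Rightarrow> (_, (('k \<times> 'a) \<times> ('k \<times> 'a) \<Rightarrow>\<^sub>0 int) set \<times> (('k \<times> 'a) \<times> ('k \<times> 'a) \<Rightarrow>\<^sub>0 int) set) module"
      and d' s
    assume Q: "\<And>i. projective_lmodule (enveloping_algebra K B) (Q i)"
      "\<And>i. d' i \<in> lmodule_hom (enveloping_algebra K B) (Q (Suc i)) (Q i)"
      "s \<in> lmodule_hom (enveloping_algebra K B) (Q 0) (enveloping_module B)"
      "\<And>x. x \<in> carrier B \<Longrightarrow> \<exists>q\<in>carrier (Q 0). s q = x"
      "d' 0 ` carrier (Q (Suc 0)) = {x \<in> carrier (Q 0). s x \<in> homotope_ideal K A}"
      "\<And>i. d' (Suc i) ` carrier (Q (Suc (Suc i))) = {x \<in> carrier (Q (Suc i)). d' i x = \<zero>\<^bsub>Q i\<^esub>}"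
      "\<And>i. i > 2 \<Longrightarrow> carrier (Q i) = {\<zero>\<^bsub>Q i\<^esub>}"
    interpret MB: lmodule "enveloping_algebra K B" "enveloping_module B"
      by (rule B.lmodule_enveloping_module)
    have "\<exists>d e. projective_resolution (enveloping_algebra K B) (enveloping_module B)
        (\<lambda>i. direct_sum (restrict_scalars env_hom (P i)) (Q i)) d e"
    proof (rule horseshoe[OF B.lmodule_enveloping_module _ lmodule_homotope_ideal
          restricted_resolution[OF I I' P] Q(1,2,3) _ Q(5,6)])
      show "homotope_ideal K A \<subseteq> carrier (enveloping_module B)" by (auto simp: homotope_ideal_def)
      fix x assume x: "x \<in> carrier (enveloping_module B)"
      then obtain q where "q \<in> carrier (Q 0)" "s q = x" using Q(4)[of x] by (auto simp del: B_simps)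
      \<comment> \<open>Here \<open>s\<close> is onto \<open>B\<close> itself and not just modulo
        the ideal, so the difference is zero.\<close>
      then show "\<exists>q\<in>carrier (Q 0). x \<ominus>\<^bsub>enveloping_module B\<^esub> s q \<in> homotope_ideal K A"
        using MB.M.a_minus_self[OF x] by (intro bexI[of _ q]) (simp_all add: homotope_ideal_def)
    qed
    then obtain d'' e'' where "projective_resolution (enveloping_algebra K B) (enveloping_module B)
        (\<lambda>i. direct_sum (restrict_scalars env_hom (P i)) (Q i)) d'' e''" by blast
    then show ?thesis
      by (rule has_projective_resolution_of_lengthI[OF B.lmodule_enveloping_module]) (simp add: P_0 Q(7))
  qed
qed

end

theorem theorem31:
  fixes K :: "('k, 'p) ring_scheme" and A :: "('k, 'a, 'q) module_scheme" and \<Delta> :: 'a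
  assumes "unital_algebra K A"
    and "is_free_lmodule K A"
    and "well_tempered K A \<Delta>"
  shows "Hdim K (unital_homotope K A \<Delta>) \<le> max (Hdim K A) 2"
proof -
  let ?B = "unital_homotope K A \<Delta>"
  let ?L = "\<lambda>R. {enat n |n. has_projective_resolution_of_length (enveloping_algebra K R) (enveloping_module R) n}"
  interpret homotope_algebra K A \<Delta>
    using assms(1,3) by (simp add: homotope_algebra_def homotope_algebra_axioms_def well_tempered_def)
  have I: "projective_lmodule ?B (ideal_lmodule ?B (homotope_ideal K A))"
    and I': "projective_lmodule (opposite ?B) (ideal_lmodule (opposite ?B) (homotope_ideal K A))"
    using assms(3) by (simp_all add: well_tempered_def Let_def)
  show ?thesis
  proof (cases "?L A = {}")
    case True
    then have "Hdim K A = \<infinity>"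
      unfolding Hdim_def projective_dim_def by (simp only: Inf_enat_def) simp
    then show ?thesis by simp
  next
    case False
    \<comment> \<open>The infimum of a nonempty set of extended naturals is attained, so the
      dimension is the length of an actual resolution.\<close>
    then have "Hdim K A \<in> ?L A"
      unfolding Hdim_def projective_dim_def Inf_enat_def by (auto intro: LeastI)
    then obtain n where n: "Hdim K A = enat n"
      "has_projective_resolution_of_length (enveloping_algebra K A) (enveloping_module A) n" by auto
    have "Hdim K ?B \<le> enat (max n 2)"
      unfolding Hdim_def projective_dim_def
      using has_projective_resolution_homotope[OF I I' n(2)] by (intro Inf_lower) blast
    also have "\<dots> = max (Hdim K A) 2"
      by (simp add: n(1) max_def numeral_eq_enat)
    finally show ?thesis .
  qed
qed

end
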